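(* Let $\mathcal A,\mathcal B,\mathcal C$ be symmetric monoidal categories. There is an adjunction $En\dashv Rn:[\mathcal A\otimes\mathcal B,\mathcal C]\to[\mathcal A,[\mathcal B,\mathcal C]]$ in the 2-category $\mathrm{SMC}$, where $Rn$ is strict and the underlying adjunction in $\mathbf{Cat}$ is the adjunction between the functors $En:\mathrm{SMC}(\mathcal A,[\mathcal B,\mathcal C])\to\mathrm{SMC}(\mathcal A\otimes\mathcal B,\mathcal C)$ and $Rn:\mathrm{SMC}(\mathcal A\otimes\mathcal B,\mathcal C)\to\mathrm{SMC}(\mathcal A,[\mathcal B,\mathcal C])$ whose unit is the identity ($Rn\circ En=1$) and whose counit is $\epsilon$.
   Context: **Basics.** All symmetric monoidal categories are small, with tensor $\otimes$, unit $I$ and natural isomorphisms $ass_{a,b,c}:a\otimes(b\otimes c)\to(a\otimes b)\otimes c$, $r_a:a\otimes I\to a$, $l_a:I\otimes a\to a$, $s_{a,b}:a\otimes b\to b\otimes a$ satisfying the usual coherence axioms. A symmetric monoidal functor $F:\mathcal A\to\mathcal B$ is a lax one: a functor with an arrow $F^0:I\to F(I)$ and a natural family $F^2_{x,y}:Fx\otimes Fy\to F(x\otimes y)$ satisfying the usual associativity, unit and symmetry axioms; it is strict if $F^0$ and all $F^2_{x,y}$ are identities. $\mathrm{SMC}$ is the 2-category of symmetric monoidal categories, symmetric monoidal functors and monoidal natural transformations. **Internal hom.** $[\mathcal A,\mathcal B]$ is the category $\mathrm{SMC}(\mathcal A,\mathcal B)$ with the pointwise symmetric monoidal structure: $(F\Box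 G)(a)=Fa\otimes Ga$, $(F\Box G)^0$ is $I\cong I\otimes I\xrightarrow{F^0\otimes G^0}F(I)\otimes G(I)$, $(F\Box G)^2_{a,b}$ is the canonical interchange $(Fa\otimes Ga)\otimes(Fb\otimes Gb)\cong(Fa\otimes Fb)\otimes(Ga\otimes Gb)$ followed by $F^2_{a,b}\otimes G^2_{a,b}$; $(\sigma\Box\tau)_a=\sigma_a\otimes\tau_a$; the unit is the constant functor at $I_{\mathcal B}$ (with $I\to I$ the identity and $I\otimes I\to I$ the canonical arrow); $ass,r,l,s$ are pointwise. For $F:\mathcal B\to\mathcal C$, $[\mathcal A,F]:[\mathcal A,\mathcal B]\to[\mathcal A,\mathcal C]$ is $H\mapsto F\circ H$, $\theta\mapsto F*\theta$, with $[\mathcal A,F]^0$ having all components $F^0$ and $[\mathcal A,F]^2_{H,K}$ having component $F^2_{Ha,Ka}$ at $a$; for a 2-cell $\sigma$, $[\mathcal A,\sigma]_H=\sigma*H$. **Tensor.** $\mathcal A\otimes\mathcal B$ is the following symmetric monoidal category. Its objects are the formal words freely generated from a constant $I$ and symbols $a\otimes b$ ($a$ in $\mathcal A$, $b$ in $\mathcal B$) under a formal binary operation $X\otimes Y$. Its arrows are freely generated, under composition and the operations $p\mapsto X\otimes p$, $p\mapsto p\otimes X$ for objects $X$, by formal arrows $ass,r,l$ (with formal inverses) and $s$ for all objects, and by arrows $\alpha_b:I\to I_{\mathcal A}\otimes b$; $\beta_a:I\to a\otimes I_{\mathcal B}$; $\gamma_{a,a',b}:(a\otimes b)\otimes(a'\otimes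 b)\to(a\otimes a')\otimes b$; $\delta_{a,b,b'}:(a\otimes b)\otimes(a\otimes b')\to a\otimes(b\otimes b')$; $a\otimes g:a\otimes b\to a\otimes b'$ for $g:b\to b'$ in $\mathcal B$; $f\otimes b:a\otimes b\to a'\otimes b$ for $f:a\to a'$ in $\mathcal A$; modulo the smallest congruence, compatible with all $X\otimes-$ and $-\otimes X$, such that: (i) $\otimes$ is a bifunctor and $\otimes,I,ass,r,l,s$ form a symmetric monoidal structure; (ii) for each $a$, $b\mapsto a\otimes b$, $g\mapsto a\otimes g$ with structure $\beta_a$, $\delta_{a,-,-}$ is a symmetric monoidal functor $\eta(a):\mathcal B\to\mathcal A\otimes\mathcal B$; (iii) for each $b$, $a\mapsto a\otimes b$, $f\mapsto f\otimes b$ with structure $\alpha_b$, $\gamma_{-,-,b}$ is a symmetric monoidal functor $\mathcal A\to\mathcal A\otimes\mathcal B$; (iv) for each $f:a\to a'$ the family $(f\otimes b)_b$, and for each $g:b\to b'$ the family $(a\otimes g)_a$, is a monoidal natural transformation between the corresponding functors of (ii), resp. (iii); (v) with $c:I\otimes I\to I$ canonical, $\alpha_{b\otimes b'}\circ c=\delta_{I_{\mathcal A},b,b'}\circ(\alpha_b\otimes\alpha_{b'})$, $\beta_{a\otimes a'}\circ c=\gamma_{a,a',I_{\mathcal B}}\circ(\beta_a\otimes\beta_{a'})$, and $\beta_{I_{\mathcal A}}=\alpha_{I_{\mathcal B}}$; (vi) $\gamma_{a,a',b\otimes b'}\circ(\delta_{a,b,b'}\otimes\delta_{a',b,b'})=\delta_{a\otimes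 a',b,b'}\circ(\gamma_{a,a',b}\otimes\gamma_{a,a',b'})\circ m$, where $m$ is the canonical isomorphism exchanging the two middle factors $a\otimes b'$ and $a'\otimes b$. The symmetric monoidal functor $\eta:\mathcal A\to[\mathcal B,\mathcal A\otimes\mathcal B]$ is $a\mapsto\eta(a)$, $\eta(f)_b=f\otimes b$, $(\eta^0)_b=\alpha_b$, $(\eta^2_{a,a'})_b=\gamma_{a,a',b}$. **$En$, $Rn$, $\epsilon$.** For $F:\mathcal A\to[\mathcal B,\mathcal C]$, $En(F):\mathcal A\otimes\mathcal B\to\mathcal C$ is the strict symmetric monoidal functor with $a\otimes b\mapsto F(a)(b)$, $\alpha_b\mapsto(F^0)_b$, $\beta_a\mapsto(Fa)^0$, $\gamma_{a,a',b}\mapsto(F^2_{a,a'})_b$, $\delta_{a,b,b'}\mapsto(Fa)^2_{b,b'}$, $f\otimes b\mapsto F(f)_b$, $a\otimes g\mapsto F(a)(g)$. For a 2-cell $\sigma:F\to G$, $En(\sigma)_I=1$, $En(\sigma)_{a\otimes b}=(\sigma_a)_b$, $En(\sigma)_{X\otimes Y}=En(\sigma)_X\otimes En(\sigma)_Y$. $Rn$ is the functor $F\mapsto[\mathcal B,F]\circ\eta$, $\sigma\mapsto[\mathcal B,\sigma]*\eta$. For $F:\mathcal A\otimes\mathcal B\to\mathcal C$, $\epsilon_F:En(Rn(F))\to F$ is the monoidal natural transformation with $(\epsilon_F)_{a\otimes b}=1$, $(\epsilon_F)_I=F^0$, $(\epsilon_F)_{X\otimes Y}=F^2_{X,Y}\circ((\epsilon_F)_X\otimes(\epsilon_F)_Y)$.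 *)

theory Defs
  imports Main "HOL-Library.FuncSet"
begin

section \<open>Symmetric monoidal categories\<close>

text \<open>
  A small category is given by a set of objects and a set of arrows inside ambient types; the
  operations are only meaningful on these sets.  The tensor is written \<open>\<otimes>\<close> on objects and \<open>\<odot>\<close> on
  arrows, and composition is in the applicative order: \<open>g \<cdot> f\<close> is \<open>g\<close> after \<open>f\<close>.
\<close>

record ('o, 'm) smcat =
  Obj :: "'o set"
  Arr :: "'m set"
  Dom :: "'m \<Rightarrow> 'o"
  Cod :: "'m \<Rightarrow> 'o"
  Ide :: "'o \<Rightarrow> 'm"
  Comp :: "'m \<Rightarrow> 'm \<Rightarrow> 'm" (infixr "\<cdot>\<index>" 65)
  UnitO :: "'o"
  TenO :: "'o \<Rightarrow> 'o \<Rightarrow> 'o" (infixr "\<otimes>\<index>" 75)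
  TenA :: "'m \<Rightarrow> 'm \<Rightarrow> 'm" (infixr "\<odot>\<index>" 75)
  Ass :: "'o \<Rightarrow> 'o \<Rightarrow> 'o \<Rightarrow> 'm"
  Run :: "'o \<Rightarrow> 'm"
  Lun :: "'o \<Rightarrow> 'm"
  Sym :: "'o \<Rightarrow> 'o \<Rightarrow> 'm"

definition hom :: "('o, 'm) smcat \<Rightarrow> 'o \<Rightarrow> 'o \<Rightarrow> 'm set" where
  "hom C x y = {f \<in> Arr C. Dom C f = x \<and> Cod C f = y}"

definition is_inverse :: "('o, 'm) smcat \<Rightarrow> 'm \<Rightarrow> 'm \<Rightarrow> bool" where
  "is_inverse C f g \<longleftrightarrow> f \<in> Arr C \<and> g \<in> hom C (Cod C f) (Dom C f)
     \<and> g \<cdot>\<^bsub>C\<^esub> f = Ide C (Dom C f) \<and> f \<cdot>\<^bsub>C\<^esub> g = Ide C (Cod C f)"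

definition iso :: "('o, 'm) smcat \<Rightarrow> 'm \<Rightarrow> bool" where
  "iso C f \<longleftrightarrow> (\<exists>g. is_inverse C f g)"

definition inv_arr :: "('o, 'm) smcat \<Rightarrow> 'm \<Rightarrow> 'm" where
  "inv_arr C f = (THE g. is_inverse C f g)"

locale category =
  fixes C :: "('o, 'm) smcat" (structure)
  assumes Dom_Obj: "f \<in> Arr C \<Longrightarrow> Dom C f \<in> Obj C"
    and Cod_Obj: "f \<in> Arr C \<Longrightarrow> Cod C f \<in> Obj C"
    and Ide_hom: "x \<in> Obj C \<Longrightarrow> Ide C x \<in> hom C x x"
    and Comp_hom: "\<lbrakk>f \<in> hom C x y; g \<in> hom C y z\<rbrakk> \<Longrightarrow> g \<cdot> f \<in> hom C x z"
    and Comp_Ide: "f \<in> hom C x y \<Longrightarrow> f \<cdot> Ide C x = f"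
    and Ide_Comp: "f \<in> hom C x y \<Longrightarrow> Ide C y \<cdot> f = f"
    and Comp_assoc: "\<lbrakk>f \<in> hom C w x; g \<in> hom C x y; h \<in> hom C y z\<rbrakk> \<Longrightarrow> h \<cdot> (g \<cdot> f) = (h \<cdot> g) \<cdot> f"

locale symmetric_monoidal_category = category C
  for C :: "('o, 'm) smcat" (structure) +
  assumes UnitO_Obj: "UnitO C \<in> Obj C"
    and TenO_Obj: "\<lbrakk>x \<in> Obj C; y \<in> Obj C\<rbrakk> \<Longrightarrow> x \<otimes> y \<in> Obj C"
    and TenA_hom: "\<lbrakk>f \<in> hom C x x'; g \<in> hom C y y'\<rbrakk> \<Longrightarrow> f \<odot> g \<in> hom C (x \<otimes> y) (x' \<otimes> y')"
    and TenA_Ide: "\<lbrakk>x \<in> Obj C; y \<in> Obj C\<rbrakk> \<Longrightarrow> Ide C x \<odot> Ide C y = Ide C (x \<otimes> y)"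
    and TenA_Comp: "\<lbrakk>f \<in> hom C x x'; f' \<in> hom C x' x''; g \<in> hom C y y'; g' \<in> hom C y' y''\<rbrakk>
          \<Longrightarrow> (f' \<cdot> f) \<odot> (g' \<cdot> g) = (f' \<odot> g') \<cdot> (f \<odot> g)"
    and Ass_hom: "\<lbrakk>x \<in> Obj C; y \<in> Obj C; z \<in> Obj C\<rbrakk>
          \<Longrightarrow> Ass C x y z \<in> hom C (x \<otimes> (y \<otimes> z)) ((x \<otimes> y) \<otimes> z)"
    and Ass_iso: "\<lbrakk>x \<in> Obj C; y \<in> Obj C; z \<in> Obj C\<rbrakk> \<Longrightarrow> iso C (Ass C x y z)"
    and Ass_natural: "\<lbrakk>f \<in> hom C x x'; g \<in> hom C y y'; h \<in> hom C z z'\<rbrakk>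
          \<Longrightarrow> Ass C x' y' z' \<cdot> (f \<odot> (g \<odot> h)) = ((f \<odot> g) \<odot> h) \<cdot> Ass C x y z"
    and Run_hom: "x \<in> Obj C \<Longrightarrow> Run C x \<in> hom C (x \<otimes> UnitO C) x"
    and Run_iso: "x \<in> Obj C \<Longrightarrow> iso C (Run C x)"
    and Run_natural: "f \<in> hom C x x' \<Longrightarrow> Run C x' \<cdot> (f \<odot> Ide C (UnitO C)) = f \<cdot> Run C x"
    and Lun_hom: "x \<in> Obj C \<Longrightarrow> Lun C x \<in> hom C (UnitO C \<otimes> x) x"
    and Lun_iso: "x \<in> Obj C \<Longrightarrow> iso C (Lun C x)"
    and Lun_natural: "f \<in> hom C x x' \<Longrightarrow> Lun C x' \<cdot> (Ide C (UnitO C) \<odot> f) = f \<cdot> Lun C x"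
    and Sym_hom: "\<lbrakk>x \<in> Obj C; y \<in> Obj C\<rbrakk> \<Longrightarrow> Sym C x y \<in> hom C (x \<otimes> y) (y \<otimes> x)"
    and Sym_natural: "\<lbrakk>f \<in> hom C x x'; g \<in> hom C y y'\<rbrakk>
          \<Longrightarrow> Sym C x' y' \<cdot> (f \<odot> g) = (g \<odot> f) \<cdot> Sym C x y"
    and pentagon: "\<lbrakk>w \<in> Obj C; x \<in> Obj C; y \<in> Obj C; z \<in> Obj C\<rbrakk>
          \<Longrightarrow> Ass C (w \<otimes> x) y z \<cdot> Ass C w x (y \<otimes> z)
            = (Ass C w x y \<odot> Ide C z) \<cdot> Ass C w (x \<otimes> y) z \<cdot> (Ide C w \<odot> Ass C x y z)"
    and triangle: "\<lbrakk>x \<in> Obj C; y \<in> Obj C\<rbrakk>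
          \<Longrightarrow> (Run C x \<odot> Ide C y) \<cdot> Ass C x (UnitO C) y = Ide C x \<odot> Lun C y"
    and Sym_Sym: "\<lbrakk>x \<in> Obj C; y \<in> Obj C\<rbrakk> \<Longrightarrow> Sym C y x \<cdot> Sym C x y = Ide C (x \<otimes> y)"
    and Lun_Sym: "x \<in> Obj C \<Longrightarrow> Lun C x \<cdot> Sym C x (UnitO C) = Run C x"
    and hexagon: "\<lbrakk>x \<in> Obj C; y \<in> Obj C; z \<in> Obj C\<rbrakk>
          \<Longrightarrow> Ass C z x y \<cdot> Sym C (x \<otimes> y) z \<cdot> Ass C x y z
            = (Sym C x z \<odot> Ide C y) \<cdot> Ass C x z y \<cdot> (Ide C x \<odot> Sym C y z)"

text \<open>The canonical isomorphism \<open>(w \<otimes> x) \<otimes> (y \<otimes> z) \<rightarrow> (w \<otimes> y) \<otimes> (x \<otimes> z)\<close>.\<close>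

definition interchange :: "('o, 'm) smcat \<Rightarrow> 'o \<Rightarrow> 'o \<Rightarrow> 'o \<Rightarrow> 'o \<Rightarrow> 'm" where
  "interchange C w x y z =
     inv_arr C (Ass C (w \<otimes>\<^bsub>C\<^esub> y) x z)
     \<cdot>\<^bsub>C\<^esub> (Ass C w y x \<odot>\<^bsub>C\<^esub> Ide C z)
     \<cdot>\<^bsub>C\<^esub> ((Ide C w \<odot>\<^bsub>C\<^esub> Sym C x y) \<odot>\<^bsub>C\<^esub> Ide C z)
     \<cdot>\<^bsub>C\<^esub> (inv_arr C (Ass C w x y) \<odot>\<^bsub>C\<^esub> Ide C z)
     \<cdot>\<^bsub>C\<^esub> Ass C (w \<otimes>\<^bsub>C\<^esub> x) y z"

section \<open>Symmetric monoidal functors and monoidal natural transformations\<close>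

text \<open>
  Functors and transformations are required to be \<^emph>\<open>extensional\<close> (undefined outside the sets of
  objects and arrows of the source), so that HOL equality of the records below is equality of
  functors and of transformations.
\<close>

record ('o1, 'm1, 'o2, 'm2) smfun =
  FO :: "'o1 \<Rightarrow> 'o2"
  FA :: "'m1 \<Rightarrow> 'm2"
  F0 :: "'m2"
  F2 :: "'o1 \<Rightarrow> 'o1 \<Rightarrow> 'm2"

locale symmetric_monoidal_functor =
  A: symmetric_monoidal_category A + B: symmetric_monoidal_category B
  for A :: "('o1, 'm1) smcat" and B :: "('o2, 'm2) smcat" +
  fixes F :: "('o1, 'm1, 'o2, 'm2) smfun"
  assumes FO_funcset: "FO F \<in> Obj A \<rightarrow>\<^sub>E Obj B"
    and FA_funcset: "FA F \<in> Arr A \<rightarrow>\<^sub>E Arr B"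
    and FA_hom: "f \<in> hom A x y \<Longrightarrow> FA F f \<in> hom B (FO F x) (FO F y)"
    and FA_Ide: "x \<in> Obj A \<Longrightarrow> FA F (Ide A x) = Ide B (FO F x)"
    and FA_Comp: "\<lbrakk>f \<in> hom A x y; g \<in> hom A y z\<rbrakk> \<Longrightarrow> FA F (g \<cdot>\<^bsub>A\<^esub> f) = FA F g \<cdot>\<^bsub>B\<^esub> FA F f"
    and F0_hom: "F0 F \<in> hom B (UnitO B) (FO F (UnitO A))"
    and F2_funcset: "F2 F \<in> Obj A \<rightarrow>\<^sub>E Obj A \<rightarrow>\<^sub>E Arr B"
    and F2_hom: "\<lbrakk>x \<in> Obj A; y \<in> Obj A\<rbrakk> \<Longrightarrow> F2 F x y \<in> hom B (FO F x \<otimes>\<^bsub>B\<^esub> FO F y) (FO F (x \<otimes>\<^bsub>A\<^esub> y))"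
    and F2_natural: "\<lbrakk>f \<in> hom A x x'; g \<in> hom A y y'\<rbrakk>
          \<Longrightarrow> F2 F x' y' \<cdot>\<^bsub>B\<^esub> (FA F f \<odot>\<^bsub>B\<^esub> FA F g) = FA F (f \<odot>\<^bsub>A\<^esub> g) \<cdot>\<^bsub>B\<^esub> F2 F x y"
    and F2_Ass: "\<lbrakk>x \<in> Obj A; y \<in> Obj A; z \<in> Obj A\<rbrakk>
          \<Longrightarrow> FA F (Ass A x y z) \<cdot>\<^bsub>B\<^esub> F2 F x (y \<otimes>\<^bsub>A\<^esub> z) \<cdot>\<^bsub>B\<^esub> (Ide B (FO F x) \<odot>\<^bsub>B\<^esub> F2 F y z)
            = F2 F (x \<otimes>\<^bsub>A\<^esub> y) z \<cdot>\<^bsub>B\<^esub> (F2 F x y \<odot>\<^bsub>B\<^esub> Ide B (FO F z))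
              \<cdot>\<^bsub>B\<^esub> Ass B (FO F x) (FO F y) (FO F z)"
    and F2_Run: "x \<in> Obj A
          \<Longrightarrow> FA F (Run A x) \<cdot>\<^bsub>B\<^esub> F2 F x (UnitO A) \<cdot>\<^bsub>B\<^esub> (Ide B (FO F x) \<odot>\<^bsub>B\<^esub> F0 F) = Run B (FO F x)"
    and F2_Lun: "x \<in> Obj A
          \<Longrightarrow> FA F (Lun A x) \<cdot>\<^bsub>B\<^esub> F2 F (UnitO A) x \<cdot>\<^bsub>B\<^esub> (F0 F \<odot>\<^bsub>B\<^esub> Ide B (FO F x)) = Lun B (FO F x)"
    and F2_Sym: "\<lbrakk>x \<in> Obj A; y \<in> Obj A\<rbrakk>
          \<Longrightarrow> FA F (Sym A x y) \<cdot>\<^bsub>B\<^esub> F2 F x y = F2 F y x \<cdot>\<^bsub>B\<^esub> Sym B (FO F x) (FO F y)"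

definition strict_functor ::
  "('o1, 'm1) smcat \<Rightarrow> ('o2, 'm2) smcat \<Rightarrow> ('o1, 'm1, 'o2, 'm2) smfun \<Rightarrow> bool" where
  "strict_functor A B F \<longleftrightarrow> symmetric_monoidal_functor A B F
     \<and> F0 F = Ide B (UnitO B)
     \<and> (\<forall>x\<in>Obj A. \<forall>y\<in>Obj A. F2 F x y = Ide B (FO F x \<otimes>\<^bsub>B\<^esub> FO F y))"

definition id_functor :: "('o, 'm) smcat \<Rightarrow> ('o, 'm, 'o, 'm) smfun" where
  "id_functor A = \<lparr>FO = \<lambda>x\<in>Obj A. x, FA = \<lambda>f\<in>Arr A. f, F0 = Ide A (UnitO A),
     F2 = \<lambda>x\<in>Obj A. \<lambda>y\<in>Obj A. Ide A (x \<otimes>\<^bsub>A\<^esub> y)\<rparr>"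

text \<open>\<open>comp_functor A C G F\<close> is \<open>G \<circ> F\<close> for \<open>F : A \<rightarrow> B\<close> and \<open>G : B \<rightarrow> C\<close>.\<close>

definition comp_functor ::
  "('o1, 'm1) smcat \<Rightarrow> ('o3, 'm3) smcat \<Rightarrow> ('o2, 'm2, 'o3, 'm3) smfun
     \<Rightarrow> ('o1, 'm1, 'o2, 'm2) smfun \<Rightarrow> ('o1, 'm1, 'o3, 'm3) smfun" where
  "comp_functor A C G F =
     \<lparr>FO = \<lambda>x\<in>Obj A. FO G (FO F x),
      FA = \<lambda>f\<in>Arr A. FA G (FA F f),
      F0 = FA G (F0 F) \<cdot>\<^bsub>C\<^esub> F0 G,
      F2 = \<lambda>x\<in>Obj A. \<lambda>y\<in>Obj A. FA G (F2 F x y) \<cdot>\<^bsub>C\<^esub> F2 G (FO F x) (FO F y)\<rparr>"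

record ('o1, 'm1, 'o2, 'm2) smtrans =
  Src :: "('o1, 'm1, 'o2, 'm2) smfun"
  Tgt :: "('o1, 'm1, 'o2, 'm2) smfun"
  Cmp :: "'o1 \<Rightarrow> 'm2"

locale monoidal_transformation =
  Src: symmetric_monoidal_functor A B "Src \<sigma>" + Tgt: symmetric_monoidal_functor A B "Tgt \<sigma>"
  for A :: "('o1, 'm1) smcat" and B :: "('o2, 'm2) smcat"
    and \<sigma> :: "('o1, 'm1, 'o2, 'm2) smtrans" +
  assumes Cmp_funcset: "Cmp \<sigma> \<in> Obj A \<rightarrow>\<^sub>E Arr B"
    and Cmp_hom: "x \<in> Obj A \<Longrightarrow> Cmp \<sigma> x \<in> hom B (FO (Src \<sigma>) x) (FO (Tgt \<sigma>) x)"
    and Cmp_natural: "f \<in> hom A x y \<Longrightarrow> Cmp \<sigma> y \<cdot>\<^bsub>B\<^esub> FA (Src \<sigma>) f = FA (Tgt \<sigma>) f \<cdot>\<^bsub>B\<^esub> Cmp \<sigma> x"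
    and Cmp_F0: "Cmp \<sigma> (UnitO A) \<cdot>\<^bsub>B\<^esub> F0 (Src \<sigma>) = F0 (Tgt \<sigma>)"
    and Cmp_F2: "\<lbrakk>x \<in> Obj A; y \<in> Obj A\<rbrakk>
          \<Longrightarrow> Cmp \<sigma> (x \<otimes>\<^bsub>A\<^esub> y) \<cdot>\<^bsub>B\<^esub> F2 (Src \<sigma>) x y = F2 (Tgt \<sigma>) x y \<cdot>\<^bsub>B\<^esub> (Cmp \<sigma> x \<odot>\<^bsub>B\<^esub> Cmp \<sigma> y)"

text \<open>\<open>whisker_right A C \<sigma> H\<close> is \<open>\<sigma> * H\<close> and \<open>whisker_left A C F \<theta>\<close> is \<open>F * \<theta>\<close>, where \<open>H : A \<rightarrow> B\<close>,
  \<open>\<theta>\<close> is a transformation between functors \<open>A \<rightarrow> B\<close>, \<open>F : B \<rightarrow> C\<close> and \<open>\<sigma>\<close> is a transformation between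
  functors \<open>B \<rightarrow> C\<close>.\<close>

definition whisker_right ::
  "('o1, 'm1) smcat \<Rightarrow> ('o3, 'm3) smcat \<Rightarrow> ('o2, 'm2, 'o3, 'm3) smtrans
     \<Rightarrow> ('o1, 'm1, 'o2, 'm2) smfun \<Rightarrow> ('o1, 'm1, 'o3, 'm3) smtrans" where
  "whisker_right A C \<sigma> H =
     \<lparr>Src = comp_functor A C (Src \<sigma>) H, Tgt = comp_functor A C (Tgt \<sigma>) H,
      Cmp = \<lambda>a\<in>Obj A. Cmp \<sigma> (FO H a)\<rparr>"

definition whisker_left ::
  "('o1, 'm1) smcat \<Rightarrow> ('o3, 'm3) smcat \<Rightarrow> ('o2, 'm2, 'o3, 'm3) smfun
     \<Rightarrow> ('o1, 'm1, 'o2, 'm2) smtrans \<Rightarrow> ('o1, 'm1, 'o3, 'm3) smtrans" where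
  "whisker_left A C F \<theta> =
     \<lparr>Src = comp_functor A C F (Src \<theta>), Tgt = comp_functor A C F (Tgt \<theta>),
      Cmp = \<lambda>a\<in>Obj A. FA F (Cmp \<theta> a)\<rparr>"

section \<open>The internal hom\<close>

definition box_functor ::
  "('o1, 'm1) smcat \<Rightarrow> ('o2, 'm2) smcat \<Rightarrow> ('o1, 'm1, 'o2, 'm2) smfun
     \<Rightarrow> ('o1, 'm1, 'o2, 'm2) smfun \<Rightarrow> ('o1, 'm1, 'o2, 'm2) smfun" where
  "box_functor A B F G =
     \<lparr>FO = \<lambda>a\<in>Obj A. FO F a \<otimes>\<^bsub>B\<^esub> FO G a,
      FA = \<lambda>f\<in>Arr A. FA F f \<odot>\<^bsub>B\<^esub> FA G f,
      F0 = (F0 F \<odot>\<^bsub>B\<^esub> F0 G) \<cdot>\<^bsub>B\<^esub> inv_arr B (Run B (UnitO B)),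
      F2 = \<lambda>a\<in>Obj A. \<lambda>b\<in>Obj A. (F2 F a b \<odot>\<^bsub>B\<^esub> F2 G a b)
             \<cdot>\<^bsub>B\<^esub> interchange B (FO F a) (FO G a) (FO F b) (FO G b)\<rparr>"

definition unit_functor ::
  "('o1, 'm1) smcat \<Rightarrow> ('o2, 'm2) smcat \<Rightarrow> ('o1, 'm1, 'o2, 'm2) smfun" where
  "unit_functor A B =
     \<lparr>FO = \<lambda>a\<in>Obj A. UnitO B,
      FA = \<lambda>f\<in>Arr A. Ide B (UnitO B),
      F0 = Ide B (UnitO B),
      F2 = \<lambda>a\<in>Obj A. \<lambda>b\<in>Obj A. Run B (UnitO B)\<rparr>"

definition internal_hom ::
  "('o1, 'm1) smcat \<Rightarrow> ('o2, 'm2) smcat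
     \<Rightarrow> (('o1, 'm1, 'o2, 'm2) smfun, ('o1, 'm1, 'o2, 'm2) smtrans) smcat"
  ("\<lbrakk>_, _\<rbrakk>") where
  "\<lbrakk>A, B\<rbrakk> =
     \<lparr>Obj = {F. symmetric_monoidal_functor A B F},
      Arr = {\<sigma>. monoidal_transformation A B \<sigma>},
      Dom = Src,
      Cod = Tgt,
      Ide = \<lambda>F. \<lparr>Src = F, Tgt = F, Cmp = \<lambda>a\<in>Obj A. Ide B (FO F a)\<rparr>,
      Comp = \<lambda>\<tau> \<sigma>. \<lparr>Src = Src \<sigma>, Tgt = Tgt \<tau>, Cmp = \<lambda>a\<in>Obj A. Cmp \<tau> a \<cdot>\<^bsub>B\<^esub> Cmp \<sigma> a\<rparr>,
      UnitO = unit_functor A B,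
      TenO = box_functor A B,
      TenA = \<lambda>\<sigma> \<tau>. \<lparr>Src = box_functor A B (Src \<sigma>) (Src \<tau>), Tgt = box_functor A B (Tgt \<sigma>) (Tgt \<tau>),
                     Cmp = \<lambda>a\<in>Obj A. Cmp \<sigma> a \<odot>\<^bsub>B\<^esub> Cmp \<tau> a\<rparr>,
      Ass = \<lambda>F G H. \<lparr>Src = box_functor A B F (box_functor A B G H),
                     Tgt = box_functor A B (box_functor A B F G) H,
                     Cmp = \<lambda>a\<in>Obj A. Ass B (FO F a) (FO G a) (FO H a)\<rparr>,
      Run = \<lambda>F. \<lparr>Src = box_functor A B F (unit_functor A B), Tgt = F,
                 Cmp = \<lambda>a\<in>Obj A. Run B (FO F a)\<rparr>,
      Lun = \<lambda>F. \<lparr>Src = box_functor A B (unit_functor A B) F, Tgt = F,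
                 Cmp = \<lambda>a\<in>Obj A. Lun B (FO F a)\<rparr>,
      Sym = \<lambda>F G. \<lparr>Src = box_functor A B F G, Tgt = box_functor A B G F,
                   Cmp = \<lambda>a\<in>Obj A. Sym B (FO F a) (FO G a)\<rparr>\<rparr>"

text \<open>\<open>hom_post A B C F\<close> is \<open>[A, F]\<close> for \<open>F : B \<rightarrow> C\<close>; \<open>hom_post_trans A B C \<sigma>\<close> is \<open>[A, \<sigma>]\<close>.\<close>

definition hom_post ::
  "('o1, 'm1) smcat \<Rightarrow> ('o2, 'm2) smcat \<Rightarrow> ('o3, 'm3) smcat \<Rightarrow> ('o2, 'm2, 'o3, 'm3) smfun
     \<Rightarrow> (('o1, 'm1, 'o2, 'm2) smfun, ('o1, 'm1, 'o2, 'm2) smtrans,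
          ('o1, 'm1, 'o3, 'm3) smfun, ('o1, 'm1, 'o3, 'm3) smtrans) smfun" where
  "hom_post A B C F =
     \<lparr>FO = \<lambda>H\<in>Obj \<lbrakk>A, B\<rbrakk>. comp_functor A C F H,
      FA = \<lambda>\<theta>\<in>Arr \<lbrakk>A, B\<rbrakk>. whisker_left A C F \<theta>,
      F0 = \<lparr>Src = unit_functor A C, Tgt = comp_functor A C F (unit_functor A B),
            Cmp = \<lambda>a\<in>Obj A. F0 F\<rparr>,
      F2 = \<lambda>H\<in>Obj \<lbrakk>A, B\<rbrakk>. \<lambda>K\<in>Obj \<lbrakk>A, B\<rbrakk>.
             \<lparr>Src = box_functor A C (comp_functor A C F H) (comp_functor A C F K),
              Tgt = comp_functor A C F (box_functor A B H K),
              Cmp = \<lambda>a\<in>Obj A. F2 F (FO H a) (FO K a)\<rparr>\<rparr>"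

definition hom_post_trans ::
  "('o1, 'm1) smcat \<Rightarrow> ('o2, 'm2) smcat \<Rightarrow> ('o3, 'm3) smcat \<Rightarrow> ('o2, 'm2, 'o3, 'm3) smtrans
     \<Rightarrow> (('o1, 'm1, 'o2, 'm2) smfun, ('o1, 'm1, 'o2, 'm2) smtrans,
          ('o1, 'm1, 'o3, 'm3) smfun, ('o1, 'm1, 'o3, 'm3) smtrans) smtrans" where
  "hom_post_trans A B C \<sigma> =
     \<lparr>Src = hom_post A B C (Src \<sigma>), Tgt = hom_post A B C (Tgt \<sigma>),
      Cmp = \<lambda>H\<in>Obj \<lbrakk>A, B\<rbrakk>. whisker_right A C \<sigma> H\<rparr>"

section \<open>Adjunctions in the 2-category of symmetric monoidal categories\<close>

text \<open>\<open>L : E \<rightarrow> D\<close> is left adjoint to \<open>R : D \<rightarrow> E\<close> with unit \<open>u\<close> and counit \<open>e\<close>.  The triangle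
  identities \<open>(e * L) \<cdot> (L * u) = 1\<close> and \<open>(R * e) \<cdot> (u * R) = 1\<close> are equations between 2-cells,
  that is, between arrows of \<open>\<lbrakk>E, D\<rbrakk>\<close> and of \<open>\<lbrakk>D, E\<rbrakk>\<close>.\<close>

definition smc_adjunction ::
  "('o1, 'm1) smcat \<Rightarrow> ('o2, 'm2) smcat \<Rightarrow> ('o1, 'm1, 'o2, 'm2) smfun
     \<Rightarrow> ('o2, 'm2, 'o1, 'm1) smfun \<Rightarrow> ('o1, 'm1, 'o1, 'm1) smtrans
     \<Rightarrow> ('o2, 'm2, 'o2, 'm2) smtrans \<Rightarrow> bool" where
  "smc_adjunction E D L R u e \<longleftrightarrow>
     symmetric_monoidal_functor E D L \<and>
     symmetric_monoidal_functor D E R \<and>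
     u \<in> hom \<lbrakk>E, E\<rbrakk> (id_functor E) (comp_functor E E R L) \<and>
     e \<in> hom \<lbrakk>D, D\<rbrakk> (comp_functor D D L R) (id_functor D) \<and>
     whisker_right E D e L \<cdot>\<^bsub>\<lbrakk>E, D\<rbrakk>\<^esub> whisker_left E D L u = Ide \<lbrakk>E, D\<rbrakk> L \<and>
     whisker_left D E R e \<cdot>\<^bsub>\<lbrakk>D, E\<rbrakk>\<^esub> whisker_right D E u R = Ide \<lbrakk>D, E\<rbrakk> R"

section \<open>The tensor product\<close>

datatype ('o1, 'o2) word =
    WUnit
  | WGen 'o1 'o2
  | WTen "('o1, 'o2) word" "('o1, 'o2) word" (infixr "\<oplus>" 75)

text \<open>Formal arrows, before taking the quotient.  \<open>TLeft X p\<close> is \<open>X \<otimes> p\<close> and \<open>TRight p X\<close> is \<open>p \<otimes> X\<close>,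
  for a word \<open>X\<close>; \<open>TFst f b\<close> is \<open>f \<otimes> b\<close> and \<open>TSnd a g\<close> is \<open>a \<otimes> g\<close>, for an object \<open>b\<close> of \<open>\<B>\<close>
  and an object \<open>a\<close> of \<open>\<A>\<close>.\<close>

datatype ('o1, 'm1, 'o2, 'm2) arrow_term =
    TIde "('o1, 'o2) word"
  | TComp "('o1, 'm1, 'o2, 'm2) arrow_term" "('o1, 'm1, 'o2, 'm2) arrow_term" (infixr "\<bullet>" 65)
  | TLeft "('o1, 'o2) word" "('o1, 'm1, 'o2, 'm2) arrow_term"
  | TRight "('o1, 'm1, 'o2, 'm2) arrow_term" "('o1, 'o2) word"
  | TAss "('o1, 'o2) word" "('o1, 'o2) word" "('o1, 'o2) word"
  | TAssInv "('o1, 'o2) word" "('o1, 'o2) word" "('o1, 'o2) word"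
  | TRun "('o1, 'o2) word"
  | TRunInv "('o1, 'o2) word"
  | TLun "('o1, 'o2) word"
  | TLunInv "('o1, 'o2) word"
  | TSym "('o1, 'o2) word" "('o1, 'o2) word"
  | TAlpha 'o2
  | TBeta 'o1
  | TGamma 'o1 'o1 'o2
  | TDelta 'o1 'o2 'o2
  | TFst 'm1 'o2
  | TSnd 'o1 'm2

context
  fixes A :: "('o1, 'm1) smcat" and B :: "('o2, 'm2) smcat"
begin

primrec is_word :: "('o1, 'o2) word \<Rightarrow> bool" where
  "is_word WUnit \<longleftrightarrow> True"
| "is_word (WGen a b) \<longleftrightarrow> a \<in> Obj A \<and> b \<in> Obj B"
| "is_word (X \<oplus> Y) \<longleftrightarrow> is_word X \<and> is_word Y"

primrec tdom :: "('o1, 'm1, 'o2, 'm2) arrow_term \<Rightarrow> ('o1, 'o2) word" where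
  "tdom (TIde X) = X"
| "tdom (q \<bullet> p) = tdom p"
| "tdom (TLeft X p) = X \<oplus> tdom p"
| "tdom (TRight p X) = tdom p \<oplus> X"
| "tdom (TAss X Y Z) = X \<oplus> (Y \<oplus> Z)"
| "tdom (TAssInv X Y Z) = (X \<oplus> Y) \<oplus> Z"
| "tdom (TRun X) = X \<oplus> WUnit"
| "tdom (TRunInv X) = X"
| "tdom (TLun X) = WUnit \<oplus> X"
| "tdom (TLunInv X) = X"
| "tdom (TSym X Y) = X \<oplus> Y"
| "tdom (TAlpha b) = WUnit"
| "tdom (TBeta a) = WUnit"
| "tdom (TGamma a a' b) = WGen a b \<oplus> WGen a' b"
| "tdom (TDelta a b b') = WGen a b \<oplus> WGen a b'"
| "tdom (TFst f b) = WGen (Dom A f) b"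
| "tdom (TSnd a g) = WGen a (Dom B g)"

primrec tcod :: "('o1, 'm1, 'o2, 'm2) arrow_term \<Rightarrow> ('o1, 'o2) word" where
  "tcod (TIde X) = X"
| "tcod (q \<bullet> p) = tcod q"
| "tcod (TLeft X p) = X \<oplus> tcod p"
| "tcod (TRight p X) = tcod p \<oplus> X"
| "tcod (TAss X Y Z) = (X \<oplus> Y) \<oplus> Z"
| "tcod (TAssInv X Y Z) = X \<oplus> (Y \<oplus> Z)"
| "tcod (TRun X) = X"
| "tcod (TRunInv X) = X \<oplus> WUnit"
| "tcod (TLun X) = X"
| "tcod (TLunInv X) = WUnit \<oplus> X"
| "tcod (TSym X Y) = Y \<oplus> X"
| "tcod (TAlpha b) = WGen (UnitO A) b"
| "tcod (TBeta a) = WGen a (UnitO B)"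
| "tcod (TGamma a a' b) = WGen (a \<otimes>\<^bsub>A\<^esub> a') b"
| "tcod (TDelta a b b') = WGen a (b \<otimes>\<^bsub>B\<^esub> b')"
| "tcod (TFst f b) = WGen (Cod A f) b"
| "tcod (TSnd a g) = WGen a (Cod B g)"

primrec is_arrow :: "('o1, 'm1, 'o2, 'm2) arrow_term \<Rightarrow> bool" where
  "is_arrow (TIde X) \<longleftrightarrow> is_word X"
| "is_arrow (q \<bullet> p) \<longleftrightarrow> is_arrow q \<and> is_arrow p \<and> tdom q = tcod p"
| "is_arrow (TLeft X p) \<longleftrightarrow> is_word X \<and> is_arrow p"
| "is_arrow (TRight p X) \<longleftrightarrow> is_arrow p \<and> is_word X"
| "is_arrow (TAss X Y Z) \<longleftrightarrow> is_word X \<and> is_word Y \<and> is_word Z"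
| "is_arrow (TAssInv X Y Z) \<longleftrightarrow> is_word X \<and> is_word Y \<and> is_word Z"
| "is_arrow (TRun X) \<longleftrightarrow> is_word X"
| "is_arrow (TRunInv X) \<longleftrightarrow> is_word X"
| "is_arrow (TLun X) \<longleftrightarrow> is_word X"
| "is_arrow (TLunInv X) \<longleftrightarrow> is_word X"
| "is_arrow (TSym X Y) \<longleftrightarrow> is_word X \<and> is_word Y"
| "is_arrow (TAlpha b) \<longleftrightarrow> b \<in> Obj B"
| "is_arrow (TBeta a) \<longleftrightarrow> a \<in> Obj A"
| "is_arrow (TGamma a a' b) \<longleftrightarrow> a \<in> Obj A \<and> a' \<in> Obj A \<and> b \<in> Obj B"
| "is_arrow (TDelta a b b') \<longleftrightarrow> a \<in> Obj A \<and> b \<in> Obj B \<and> b' \<in> Obj B"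
| "is_arrow (TFst f b) \<longleftrightarrow> f \<in> Arr A \<and> b \<in> Obj B"
| "is_arrow (TSnd a g) \<longleftrightarrow> a \<in> Obj A \<and> g \<in> Arr B"

definition tpar :: "('o1, 'm1, 'o2, 'm2) arrow_term \<Rightarrow> ('o1, 'm1, 'o2, 'm2) arrow_term
    \<Rightarrow> ('o1, 'm1, 'o2, 'm2) arrow_term" (infixr "\<diamondop>" 75) where
  "p \<diamondop> q = TRight p (tcod q) \<bullet> TLeft (tdom p) q"

definition tinterchange :: "('o1, 'o2) word \<Rightarrow> ('o1, 'o2) word \<Rightarrow> ('o1, 'o2) word
    \<Rightarrow> ('o1, 'o2) word \<Rightarrow> ('o1, 'm1, 'o2, 'm2) arrow_term" where
  "tinterchange W X Y Z =
     TAssInv (W \<oplus> Y) X Z \<bullet> TRight (TAss W Y X) Z \<bullet> TRight (TLeft W (TSym X Y)) Z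
     \<bullet> TRight (TAssInv W X Y) Z \<bullet> TAss (W \<oplus> X) Y Z"

text \<open>
  The defining relations.  They are stated without side conditions; only those instances whose two
  sides are well-formed parallel formal arrows enter the congruence \<open>tcong\<close> below.  Functoriality
  of \<open>\<otimes>\<close> is expressed through the operations \<open>TLeft\<close> and \<open>TRight\<close>.
\<close>

inductive trel :: "('o1, 'm1, 'o2, 'm2) arrow_term \<Rightarrow> ('o1, 'm1, 'o2, 'm2) arrow_term \<Rightarrow> bool" where
  comp_ide: "trel (p \<bullet> TIde X) p"
| ide_comp: "trel (TIde X \<bullet> p) p"
| comp_assoc: "trel (r \<bullet> (q \<bullet> p)) ((r \<bullet> q) \<bullet> p)"
  \<comment> \<open>\<open>\<otimes>\<close> is a bifunctor\<close>
| left_ide: "trel (TLeft X (TIde Y)) (TIde (X \<oplus> Y))"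
| left_comp: "trel (TLeft X (q \<bullet> p)) (TLeft X q \<bullet> TLeft X p)"
| right_ide: "trel (TRight (TIde X) Y) (TIde (X \<oplus> Y))"
| right_comp: "trel (TRight (q \<bullet> p) Y) (TRight q Y \<bullet> TRight p Y)"
| left_right: "trel (TRight p Y' \<bullet> TLeft X q) (TLeft X' q \<bullet> TRight p Y)"
  \<comment> \<open>symmetric monoidal structure\<close>
| ass_inv1: "trel (TAss X Y Z \<bullet> TAssInv X Y Z) (TIde ((X \<oplus> Y) \<oplus> Z))"
| ass_inv2: "trel (TAssInv X Y Z \<bullet> TAss X Y Z) (TIde (X \<oplus> (Y \<oplus> Z)))"
| run_inv1: "trel (TRun X \<bullet> TRunInv X) (TIde X)"
| run_inv2: "trel (TRunInv X \<bullet> TRun X) (TIde (X \<oplus> WUnit))"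
| lun_inv1: "trel (TLun X \<bullet> TLunInv X) (TIde X)"
| lun_inv2: "trel (TLunInv X \<bullet> TLun X) (TIde (WUnit \<oplus> X))"
| ass_natural: "trel (TAss X' Y' Z' \<bullet> (p \<diamondop> (q \<diamondop> r))) (((p \<diamondop> q) \<diamondop> r) \<bullet> TAss X Y Z)"
| run_natural: "trel (TRun X' \<bullet> TRight p WUnit) (p \<bullet> TRun X)"
| lun_natural: "trel (TLun X' \<bullet> TLeft WUnit p) (p \<bullet> TLun X)"
| sym_natural: "trel (TSym X' Y' \<bullet> (p \<diamondop> q)) ((q \<diamondop> p) \<bullet> TSym X Y)"
| pentagon: "trel (TAss (W \<oplus> X) Y Z \<bullet> TAss W X (Y \<oplus> Z))
    (TRight (TAss W X Y) Z \<bullet> TAss W (X \<oplus> Y) Z \<bullet> TLeft W (TAss X Y Z))"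
| triangle: "trel (TRight (TRun X) Y \<bullet> TAss X WUnit Y) (TLeft X (TLun Y))"
| sym_sym: "trel (TSym Y X \<bullet> TSym X Y) (TIde (X \<oplus> Y))"
| lun_sym: "trel (TLun X \<bullet> TSym X WUnit) (TRun X)"
| hexagon: "trel (TAss Z X Y \<bullet> TSym (X \<oplus> Y) Z \<bullet> TAss X Y Z)
    (TRight (TSym X Z) Y \<bullet> TAss X Z Y \<bullet> TLeft X (TSym Y Z))"
  \<comment> \<open>\<open>a \<otimes> -\<close> is a symmetric monoidal functor\<close>
| snd_ide: "trel (TSnd a (Ide B b)) (TIde (WGen a b))"
| snd_comp: "trel (TSnd a (g' \<cdot>\<^bsub>B\<^esub> g)) (TSnd a g' \<bullet> TSnd a g)"
| delta_natural: "trel (TDelta a b1' b2' \<bullet> (TSnd a g1 \<diamondop> TSnd a g2)) (TSnd a (g1 \<odot>\<^bsub>B\<^esub> g2) \<bullet> TDelta a b1 b2)"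
| delta_ass: "trel
    (TSnd a (Ass B b b' b'') \<bullet> TDelta a b (b' \<otimes>\<^bsub>B\<^esub> b'') \<bullet> TLeft (WGen a b) (TDelta a b' b''))
    (TDelta a (b \<otimes>\<^bsub>B\<^esub> b') b'' \<bullet> TRight (TDelta a b b') (WGen a b'')
      \<bullet> TAss (WGen a b) (WGen a b') (WGen a b''))"
| delta_run: "trel (TSnd a (Run B b) \<bullet> TDelta a b (UnitO B) \<bullet> TLeft (WGen a b) (TBeta a)) (TRun (WGen a b))"
| delta_lun: "trel (TSnd a (Lun B b) \<bullet> TDelta a (UnitO B) b \<bullet> TRight (TBeta a) (WGen a b)) (TLun (WGen a b))"
| delta_sym: "trel (TSnd a (Sym B b b') \<bullet> TDelta a b b') (TDelta a b' b \<bullet> TSym (WGen a b) (WGen a b'))"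
  \<comment> \<open>\<open>- \<otimes> b\<close> is a symmetric monoidal functor\<close>
| fst_ide: "trel (TFst (Ide A a) b) (TIde (WGen a b))"
| fst_comp: "trel (TFst (f' \<cdot>\<^bsub>A\<^esub> f) b) (TFst f' b \<bullet> TFst f b)"
| gamma_natural: "trel (TGamma a1' a2' b \<bullet> (TFst f1 b \<diamondop> TFst f2 b)) (TFst (f1 \<odot>\<^bsub>A\<^esub> f2) b \<bullet> TGamma a1 a2 b)"
| gamma_ass: "trel
    (TFst (Ass A a a' a'') b \<bullet> TGamma a (a' \<otimes>\<^bsub>A\<^esub> a'') b \<bullet> TLeft (WGen a b) (TGamma a' a'' b))
    (TGamma (a \<otimes>\<^bsub>A\<^esub> a') a'' b \<bullet> TRight (TGamma a a' b) (WGen a'' b)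
      \<bullet> TAss (WGen a b) (WGen a' b) (WGen a'' b))"
| gamma_run: "trel (TFst (Run A a) b \<bullet> TGamma a (UnitO A) b \<bullet> TLeft (WGen a b) (TAlpha b)) (TRun (WGen a b))"
| gamma_lun: "trel (TFst (Lun A a) b \<bullet> TGamma (UnitO A) a b \<bullet> TRight (TAlpha b) (WGen a b)) (TLun (WGen a b))"
| gamma_sym: "trel (TFst (Sym A a a') b \<bullet> TGamma a a' b) (TGamma a' a b \<bullet> TSym (WGen a b) (WGen a' b))"
  \<comment> \<open>\<open>f \<otimes> -\<close> and \<open>- \<otimes> g\<close> are monoidal natural transformations\<close>
| fst_snd: "trel (TFst f b' \<bullet> TSnd a g) (TSnd a' g \<bullet> TFst f b)"
| fst_beta: "trel (TFst f (UnitO B) \<bullet> TBeta a) (TBeta a')"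
| fst_delta: "trel (TFst f (b \<otimes>\<^bsub>B\<^esub> b') \<bullet> TDelta a b b') (TDelta a' b b' \<bullet> (TFst f b \<diamondop> TFst f b'))"
| snd_alpha: "trel (TSnd (UnitO A) g \<bullet> TAlpha b) (TAlpha b')"
| snd_gamma: "trel (TSnd (a \<otimes>\<^bsub>A\<^esub> a') g \<bullet> TGamma a a' b) (TGamma a a' b' \<bullet> (TSnd a g \<diamondop> TSnd a' g))"
  \<comment> \<open>\<open>b \<mapsto> \<alpha>\<^sub>b\<close> and \<open>b \<mapsto> \<gamma>\<^sub>a\<^sub>,\<^sub>a\<^sub>'\<^sub>,\<^sub>b\<close> respect the structure \<open>\<beta>, \<delta>\<close>; \<open>TRun WUnit\<close> is the canonical \<open>I \<otimes> I \<rightarrow> I\<close>\<close>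
| alpha_delta: "trel (TAlpha (b \<otimes>\<^bsub>B\<^esub> b') \<bullet> TRun WUnit) (TDelta (UnitO A) b b' \<bullet> (TAlpha b \<diamondop> TAlpha b'))"
| beta_gamma: "trel (TBeta (a \<otimes>\<^bsub>A\<^esub> a') \<bullet> TRun WUnit) (TGamma a a' (UnitO B) \<bullet> (TBeta a \<diamondop> TBeta a'))"
| beta_alpha: "trel (TBeta (UnitO A)) (TAlpha (UnitO B))"
| gamma_delta: "trel (TGamma a a' (b \<otimes>\<^bsub>B\<^esub> b') \<bullet> (TDelta a b b' \<diamondop> TDelta a' b b'))
    (TDelta (a \<otimes>\<^bsub>A\<^esub> a') b b' \<bullet> (TGamma a a' b \<diamondop> TGamma a a' b')
      \<bullet> tinterchange (WGen a b) (WGen a b') (WGen a' b) (WGen a' b'))"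

inductive tcong :: "('o1, 'm1, 'o2, 'm2) arrow_term \<Rightarrow> ('o1, 'm1, 'o2, 'm2) arrow_term \<Rightarrow> bool" where
  tcong_rel: "\<lbrakk>trel p q; is_arrow p; is_arrow q; tdom p = tdom q; tcod p = tcod q\<rbrakk> \<Longrightarrow> tcong p q"
| tcong_refl: "is_arrow p \<Longrightarrow> tcong p p"
| tcong_sym: "tcong p q \<Longrightarrow> tcong q p"
| tcong_trans: "\<lbrakk>tcong p q; tcong q r\<rbrakk> \<Longrightarrow> tcong p r"
| tcong_comp: "\<lbrakk>tcong p p'; tcong q q'; tdom q = tcod p\<rbrakk> \<Longrightarrow> tcong (q \<bullet> p) (q' \<bullet> p')"
| tcong_left: "\<lbrakk>is_word X; tcong p p'\<rbrakk> \<Longrightarrow> tcong (TLeft X p) (TLeft X p')"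
| tcong_right: "\<lbrakk>is_word X; tcong p p'\<rbrakk> \<Longrightarrow> tcong (TRight p X) (TRight p' X)"

definition cls :: "('o1, 'm1, 'o2, 'm2) arrow_term \<Rightarrow> ('o1, 'm1, 'o2, 'm2) arrow_term set" where
  "cls p = {(p, q). tcong p q} `` {p}"

text \<open>Congruent formal arrows have the same source and target, and all operations respect the
  congruence, so the choice of representative made by \<open>rep\<close> is immaterial below.\<close>

definition rep :: "('o1, 'm1, 'o2, 'm2) arrow_term set \<Rightarrow> ('o1, 'm1, 'o2, 'm2) arrow_term" where
  "rep c = (SOME p. p \<in> c)"

definition tensor :: "(('o1, 'o2) word, ('o1, 'm1, 'o2, 'm2) arrow_term set) smcat" where
  "tensor =
     \<lparr>Obj = {X. is_word X},
      Arr = {p. is_arrow p} // {(p, q). tcong p q},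
      Dom = \<lambda>c. tdom (rep c),
      Cod = \<lambda>c. tcod (rep c),
      Ide = \<lambda>X. cls (TIde X),
      Comp = \<lambda>d c. cls (rep d \<bullet> rep c),
      UnitO = WUnit,
      TenO = WTen,
      TenA = \<lambda>c d. cls (rep c \<diamondop> rep d),
      Ass = \<lambda>X Y Z. cls (TAss X Y Z),
      Run = \<lambda>X. cls (TRun X),
      Lun = \<lambda>X. cls (TLun X),
      Sym = \<lambda>X Y. cls (TSym X Y)\<rparr>"

text \<open>The functors \<open>\<eta>(a) : \<B> \<rightarrow> \<A> \<otimes> \<B>\<close> and \<open>\<eta> : \<A> \<rightarrow> [\<B>, \<A> \<otimes> \<B>]\<close>.\<close>

definition eta_at ::
  "'o1 \<Rightarrow> ('o2, 'm2, ('o1, 'o2) word, ('o1, 'm1, 'o2, 'm2) arrow_term set) smfun" where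
  "eta_at a =
     \<lparr>FO = \<lambda>b\<in>Obj B. WGen a b,
      FA = \<lambda>g\<in>Arr B. cls (TSnd a g),
      F0 = cls (TBeta a),
      F2 = \<lambda>b\<in>Obj B. \<lambda>b'\<in>Obj B. cls (TDelta a b b')\<rparr>"

definition eta ::
  "('o1, 'm1,
    ('o2, 'm2, ('o1, 'o2) word, ('o1, 'm1, 'o2, 'm2) arrow_term set) smfun,
    ('o2, 'm2, ('o1, 'o2) word, ('o1, 'm1, 'o2, 'm2) arrow_term set) smtrans) smfun" where
  "eta =
     \<lparr>FO = \<lambda>a\<in>Obj A. eta_at a,
      FA = \<lambda>f\<in>Arr A. \<lparr>Src = eta_at (Dom A f), Tgt = eta_at (Cod A f),
                       Cmp = \<lambda>b\<in>Obj B. cls (TFst f b)\<rparr>,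
      F0 = \<lparr>Src = unit_functor B tensor, Tgt = eta_at (UnitO A), Cmp = \<lambda>b\<in>Obj B. cls (TAlpha b)\<rparr>,
      F2 = \<lambda>a\<in>Obj A. \<lambda>a'\<in>Obj A.
             \<lparr>Src = box_functor B tensor (eta_at a) (eta_at a'), Tgt = eta_at (a \<otimes>\<^bsub>A\<^esub> a'),
              Cmp = \<lambda>b\<in>Obj B. cls (TGamma a a' b)\<rparr>\<rparr>"

end

section \<open>The functors \<open>En\<close> and \<open>Rn\<close> and the transformation \<open>\<epsilon>\<close>\<close>

text \<open>A functor \<open>F : \<A> \<rightarrow> [\<B>, \<C>]\<close> and a transformation between two such functors.\<close>

type_synonym ('o1, 'm1, 'o2, 'm2, 'o3, 'm3) curried_fun =
  "('o1, 'm1, ('o2, 'm2, 'o3, 'm3) smfun, ('o2, 'm2, 'o3, 'm3) smtrans) smfun"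

type_synonym ('o1, 'm1, 'o2, 'm2, 'o3, 'm3) curried_trans =
  "('o1, 'm1, ('o2, 'm2, 'o3, 'm3) smfun, ('o2, 'm2, 'o3, 'm3) smtrans) smtrans"

text \<open>A functor \<open>\<A> \<otimes> \<B> \<rightarrow> \<C>\<close> and a transformation between two such functors.\<close>

type_synonym ('o1, 'm1, 'o2, 'm2, 'o3, 'm3) tensor_fun =
  "(('o1, 'o2) word, ('o1, 'm1, 'o2, 'm2) arrow_term set, 'o3, 'm3) smfun"

type_synonym ('o1, 'm1, 'o2, 'm2, 'o3, 'm3) tensor_trans =
  "(('o1, 'o2) word, ('o1, 'm1, 'o2, 'm2) arrow_term set, 'o3, 'm3) smtrans"

context
  fixes A :: "('o1, 'm1) smcat" and B :: "('o2, 'm2) smcat" and C :: "('o3, 'm3) smcat"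
begin

primrec en_word :: "('o1, 'm1, 'o2, 'm2, 'o3, 'm3) curried_fun \<Rightarrow> ('o1, 'o2) word \<Rightarrow> 'o3" where
  "en_word F WUnit = UnitO C"
| "en_word F (WGen a b) = FO (FO F a) b"
| "en_word F (X \<oplus> Y) = en_word F X \<otimes>\<^bsub>C\<^esub> en_word F Y"

primrec en_term ::
  "('o1, 'm1, 'o2, 'm2, 'o3, 'm3) curried_fun \<Rightarrow> ('o1, 'm1, 'o2, 'm2) arrow_term \<Rightarrow> 'm3" where
  "en_term F (TIde X) = Ide C (en_word F X)"
| "en_term F (q \<bullet> p) = en_term F q \<cdot>\<^bsub>C\<^esub> en_term F p"
| "en_term F (TLeft X p) = Ide C (en_word F X) \<odot>\<^bsub>C\<^esub> en_term F p"
| "en_term F (TRight p X) = en_term F p \<odot>\<^bsub>C\<^esub> Ide C (en_word F X)"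
| "en_term F (TAss X Y Z) = Ass C (en_word F X) (en_word F Y) (en_word F Z)"
| "en_term F (TAssInv X Y Z) = inv_arr C (Ass C (en_word F X) (en_word F Y) (en_word F Z))"
| "en_term F (TRun X) = Run C (en_word F X)"
| "en_term F (TRunInv X) = inv_arr C (Run C (en_word F X))"
| "en_term F (TLun X) = Lun C (en_word F X)"
| "en_term F (TLunInv X) = inv_arr C (Lun C (en_word F X))"
| "en_term F (TSym X Y) = Sym C (en_word F X) (en_word F Y)"
| "en_term F (TAlpha b) = Cmp (F0 F) b"
| "en_term F (TBeta a) = F0 (FO F a)"
| "en_term F (TGamma a a' b) = Cmp (F2 F a a') b"
| "en_term F (TDelta a b b') = F2 (FO F a) b b'"
| "en_term F (TFst f b) = Cmp (FA F f) b"
| "en_term F (TSnd a g) = FA (FO F a) g"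

text \<open>\<open>en_term F\<close> sends congruent formal arrows to the same arrow of \<open>\<C>\<close> when \<open>F\<close> is a symmetric
  monoidal functor \<open>\<A> \<rightarrow> [\<B>, \<C>]\<close>; this is what makes \<open>En F\<close> the strict symmetric monoidal functor
  with the prescribed values on generators.\<close>

definition En :: "('o1, 'm1, 'o2, 'm2, 'o3, 'm3) curried_fun
    \<Rightarrow> ('o1, 'm1, 'o2, 'm2, 'o3, 'm3) tensor_fun" where
  "En F =
     \<lparr>FO = \<lambda>X\<in>Obj (tensor A B). en_word F X,
      FA = \<lambda>c\<in>Arr (tensor A B). en_term F (rep c),
      F0 = Ide C (UnitO C),
      F2 = \<lambda>X\<in>Obj (tensor A B). \<lambda>Y\<in>Obj (tensor A B). Ide C (en_word F X \<otimes>\<^bsub>C\<^esub> en_word F Y)\<rparr>"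

primrec en_cmp ::
  "('o1, 'm1, 'o2, 'm2, 'o3, 'm3) curried_trans \<Rightarrow> ('o1, 'o2) word \<Rightarrow> 'm3" where
  "en_cmp \<sigma> WUnit = Ide C (UnitO C)"
| "en_cmp \<sigma> (WGen a b) = Cmp (Cmp \<sigma> a) b"
| "en_cmp \<sigma> (X \<oplus> Y) = en_cmp \<sigma> X \<odot>\<^bsub>C\<^esub> en_cmp \<sigma> Y"

definition En_trans :: "('o1, 'm1, 'o2, 'm2, 'o3, 'm3) curried_trans
    \<Rightarrow> ('o1, 'm1, 'o2, 'm2, 'o3, 'm3) tensor_trans" where
  "En_trans \<sigma> = \<lparr>Src = En (Src \<sigma>), Tgt = En (Tgt \<sigma>), Cmp = \<lambda>X\<in>Obj (tensor A B). en_cmp \<sigma> X\<rparr>"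

definition Rn :: "('o1, 'm1, 'o2, 'm2, 'o3, 'm3) tensor_fun
    \<Rightarrow> ('o1, 'm1, 'o2, 'm2, 'o3, 'm3) curried_fun" where
  "Rn F = comp_functor A \<lbrakk>B, C\<rbrakk> (hom_post B (tensor A B) C F) (eta A B)"

definition Rn_trans :: "('o1, 'm1, 'o2, 'm2, 'o3, 'm3) tensor_trans
    \<Rightarrow> ('o1, 'm1, 'o2, 'm2, 'o3, 'm3) curried_trans" where
  "Rn_trans \<sigma> = whisker_right A \<lbrakk>B, C\<rbrakk> (hom_post_trans B (tensor A B) C \<sigma>) (eta A B)"

primrec eps_cmp :: "('o1, 'm1, 'o2, 'm2, 'o3, 'm3) tensor_fun \<Rightarrow> ('o1, 'o2) word \<Rightarrow> 'm3" where
  "eps_cmp F WUnit = F0 F"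
| "eps_cmp F (WGen a b) = Ide C (FO F (WGen a b))"
| "eps_cmp F (X \<oplus> Y) = F2 F X Y \<cdot>\<^bsub>C\<^esub> (eps_cmp F X \<odot>\<^bsub>C\<^esub> eps_cmp F Y)"

definition eps :: "('o1, 'm1, 'o2, 'm2, 'o3, 'm3) tensor_fun
    \<Rightarrow> ('o1, 'm1, 'o2, 'm2, 'o3, 'm3) tensor_trans" where
  "eps F = \<lparr>Src = En (Rn F), Tgt = F, Cmp = \<lambda>X\<in>Obj (tensor A B). eps_cmp F X\<rparr>"

end

end

theory Submission
  imports Defs
begin

text \<open>
  \<open>Rn\<close> is strict and \<open>Rn \<circ> En = 1\<close>.  Hence an arrow \<open>h : En F \<rightarrow> G\<close> equals
  \<open>\<epsilon>\<^sub>G \<cdot> En (Rn h)\<close>, so it is determined by \<open>Rn h\<close>.  The components of \<open>\<epsilon>\<close> at the unit functor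
  and at \<open>En F \<box> En G\<close> are built from identities and from canonical isomorphisms of \<open>\<C>\<close>, so they
  are invertible; their inverses are \<open>En\<^sup>0\<close> and \<open>En\<^sup>2\<close>.  Every axiom for this structure is an
  equation between arrows out of some \<open>En F\<close>, and \<open>Rn\<close> turns both sides into the same
  arrow.

  That \<open>[\<A>, \<B>]\<close> is symmetric monoidal needs coherence for the interchange isomorphism.  Letting
  the objects act on \<open>\<C>\<close> by left tensoring makes the associativity and unit constraints identities;
  the required equations then reduce to naturality of the symmetry and its two hexagons.
\<close>

section \<open>Arrow-theoretic simplification rules\<close>

text \<open>The choice of \<open>En\<^sup>0\<close> and \<open>En\<^sup>2\<close> is an instance of
  doctrinal adjunction: the constraints of a right adjoint give its left adjoint constraints in the
  colax direction, and a left adjoint in SMC needs these to be invertible. Because the unit is the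
  identity, these mates are plain components of \<open>\<epsilon>\<close>. They are the exception:
  at a word, \<open>\<epsilon>\<close> is assembled from \<open>F0\<close> and \<open>F2\<close> of
  a functor that is only lax, so in general it has no inverse. Two obstacles shape the rest.
  Strictness of \<open>Rn\<close> and \<open>Rn \<circ> En = 1\<close> are equalities of records, so
  inverses and interchanges formed in \<open>\<lbrakk>B, C\<rbrakk>\<close> must be computed
  component by component. And the constraints of a lax functor cannot be inverted, so its
  compatibility with canonical arrows has to be handled by commuting squares. No general coherence
  theorem is proved. Each canonical equation is treated singly: both sides are decomposed into
  constraints, and the arrows that they induce on the unit object are compared.\<close>

abbreviation "SMF \<equiv> symmetric_monoidal_functor"

abbreviation "MT \<equiv> monoidal_transformation"

lemma hom_iff [simp]: "f \<in> hom C x y \<longleftrightarrow> f \<in> Arr C \<and> Dom C f = x \<and> Cod C f = y"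
  by (auto simp: hom_def)

section \<open>Composition, inverses and cancellation in a category\<close>

context category
begin

lemma Dom_in_Obj [simp]: "f \<in> Arr C \<Longrightarrow> Dom C f \<in> Obj C"
  by (rule Dom_Obj)

lemma Cod_in_Obj [simp]: "f \<in> Arr C \<Longrightarrow> Cod C f \<in> Obj C"
  by (rule Cod_Obj)

lemma Ide_simps [simp]:
  assumes "x \<in> Obj C"
  shows "Ide C x \<in> Arr C" "Dom C (Ide C x) = x" "Cod C (Ide C x) = x"
  using Ide_hom [OF assms] by auto

lemma Comp_simps [simp]:
  assumes "f \<in> Arr C" "g \<in> Arr C" "Dom C g = Cod C f"
  shows "g \<cdot> f \<in> Arr C" "Dom C (g \<cdot> f) = Dom C f" "Cod C (g \<cdot> f) = Cod C g"
  using Comp_hom [of f "Dom C f" "Cod C f" g "Cod C g"] assms by auto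

lemma Comp_Ide_eq [simp]: "f \<in> Arr C \<Longrightarrow> Dom C f = x \<Longrightarrow> f \<cdot> Ide C x = f"
  using Comp_Ide [of f x "Cod C f"] by simp

lemma Ide_Comp_eq [simp]: "f \<in> Arr C \<Longrightarrow> Cod C f = x \<Longrightarrow> Ide C x \<cdot> f = f"
  using Ide_Comp [of f "Dom C f" x] by simp

text \<open>Composites are normalised by nesting to the right, against the direction of the axiom. A
  two-factor equation then no longer matches inside a longer chain, which is why several
  cancellation and naturality rules below have a variant with a trailing factor.\<close>

lemma Comp_assoc_eq [simp]:
  assumes "f \<in> Arr C" "g \<in> Arr C" "h \<in> Arr C" "Dom C g = Cod C f" "Dom C h = Cod C g"
  shows "(h \<cdot> g) \<cdot> f = h \<cdot> (g \<cdot> f)"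
  using Comp_assoc [of f _ _ g _ h] assms by simp

lemma is_inverse_unique:
  assumes "is_inverse C f g" "is_inverse C f h"
  shows "g = h"
proof -
  have "g = g \<cdot> (f \<cdot> h)" using assms by (simp add: is_inverse_def)
  also have "\<dots> = (g \<cdot> f) \<cdot> h"
    using assms by (subst Comp_assoc_eq) (auto simp: is_inverse_def simp del: Comp_assoc_eq)
  also have "\<dots> = h" using assms by (simp add: is_inverse_def del: Comp_assoc_eq)
  finally show ?thesis .
qed

lemma inv_arr_eq: "is_inverse C f g \<Longrightarrow> inv_arr C f = g"
  unfolding inv_arr_def using is_inverse_unique by blast

lemma is_inverse_inv_arr: "iso C f \<Longrightarrow> is_inverse C f (inv_arr C f)"
  using inv_arr_eq by (auto simp: iso_def)

lemma iso_Arr: "iso C f \<Longrightarrow> f \<in> Arr C"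
  by (auto simp: iso_def is_inverse_def)

lemma inv_arr_simps [simp]:
  assumes "iso C f"
  shows "inv_arr C f \<in> Arr C" "Dom C (inv_arr C f) = Cod C f" "Cod C (inv_arr C f) = Dom C f"
    "inv_arr C f \<cdot> f = Ide C (Dom C f)" "f \<cdot> inv_arr C f = Ide C (Cod C f)"
  using is_inverse_inv_arr [OF assms] by (auto simp: is_inverse_def)

lemma inv_arr_Comp_Comp [simp]:
  assumes "iso C f" "g \<in> Arr C"
  shows "Cod C g = Dom C f \<Longrightarrow> inv_arr C f \<cdot> (f \<cdot> g) = g"
    "Cod C g = Cod C f \<Longrightarrow> f \<cdot> (inv_arr C f \<cdot> g) = g"
  using assms iso_Arr [OF assms(1)]
  by (simp_all add: Comp_assoc_eq [symmetric] del: Comp_assoc_eq)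

lemma isoI:
  assumes "f \<in> Arr C" "g \<in> Arr C" "Dom C g = Cod C f" "Cod C g = Dom C f"
    "g \<cdot> f = Ide C (Dom C f)" "f \<cdot> g = Ide C (Cod C f)"
  shows "iso C f" "inv_arr C f = g"
  using assms by (auto simp: iso_def is_inverse_def intro!: inv_arr_eq)

lemma iso_Ide [simp]: "x \<in> Obj C \<Longrightarrow> iso C (Ide C x)"
  by (rule isoI [where g = "Ide C x"]) auto

lemma inv_Ide [simp]: "x \<in> Obj C \<Longrightarrow> inv_arr C (Ide C x) = Ide C x"
  by (rule isoI) auto

lemma iso_inv_arr [simp]: "iso C f \<Longrightarrow> iso C (inv_arr C f)"
  by (rule isoI [where g = f]) (auto dest: iso_Arr)

lemma iso_Comp [simp]: "iso C f \<Longrightarrow> iso C g \<Longrightarrow> Dom C g = Cod C f \<Longrightarrow> iso C (g \<cdot> f)"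
  by (rule isoI [where g = "inv_arr C f \<cdot> inv_arr C g"]) (simp_all add: iso_Arr)

lemma iso_cancel_left:
  assumes "iso C f" "g \<in> Arr C" "h \<in> Arr C" "Cod C g = Dom C f" "Cod C h = Dom C f" "f \<cdot> g = f \<cdot> h"
  shows "g = h"
  using assms inv_arr_Comp_Comp(1) by metis

lemma iso_cancel_right:
  assumes f: "iso C f" and "g \<in> Arr C" "h \<in> Arr C" "Dom C g = Cod C f" "Dom C h = Cod C f" "g \<cdot> f = h \<cdot> f"
  shows "g = h"
proof -
  have "(g \<cdot> f) \<cdot> inv_arr C f = (h \<cdot> f) \<cdot> inv_arr C f" using assms(6) by simp
  then show ?thesis using assms(1-5) iso_Arr [OF f] by simp
qed

end

section \<open>Rewriting in a symmetric monoidal category, and equations derived from the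
  axioms\<close>

context symmetric_monoidal_category
begin

lemmas SMC_axioms = symmetric_monoidal_category_axioms

lemma UnitO_in_Obj [simp]: "UnitO C \<in> Obj C"
  by (rule UnitO_Obj)

lemma TenO_in_Obj [simp]: "x \<in> Obj C \<Longrightarrow> y \<in> Obj C \<Longrightarrow> x \<otimes> y \<in> Obj C"
  by (rule TenO_Obj)

lemma TenA_simps [simp]:
  assumes "f \<in> Arr C" "g \<in> Arr C"
  shows "f \<odot> g \<in> Arr C" "Dom C (f \<odot> g) = Dom C f \<otimes> Dom C g" "Cod C (f \<odot> g) = Cod C f \<otimes> Cod C g"
  using TenA_hom [of f _ _ g] assms by auto

lemma TenA_Ide_Ide [simp]: "x \<in> Obj C \<Longrightarrow> y \<in> Obj C \<Longrightarrow> Ide C x \<odot> Ide C y = Ide C (x \<otimes> y)"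
  by (rule TenA_Ide)

text \<open>The simplifier merges composites of tensors into tensors of composites. Where a
  naturality square has to stay visible, proofs write an identity as
  \<open>Ide C x \<odot> Ide C y\<close> or remove this rule.\<close>

lemma Comp_TenA [simp]:
  assumes "f \<in> Arr C" "f' \<in> Arr C" "g \<in> Arr C" "g' \<in> Arr C" "Dom C f' = Cod C f" "Dom C g' = Cod C g"
  shows "(f' \<odot> g') \<cdot> (f \<odot> g) = (f' \<cdot> f) \<odot> (g' \<cdot> g)"
  using TenA_Comp [of f _ _ f' _ g _ _ g'] assms by simp

lemma Comp_TenA_Comp [simp]:
  assumes "f \<in> Arr C" "f' \<in> Arr C" "g \<in> Arr C" "g' \<in> Arr C" "Dom C f' = Cod C f" "Dom C g' = Cod C g"
    "k \<in> Arr C" "Cod C k = Dom C f \<otimes> Dom C g"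
  shows "(f' \<odot> g') \<cdot> ((f \<odot> g) \<cdot> k) = ((f' \<cdot> f) \<odot> (g' \<cdot> g)) \<cdot> k"
proof -
  have "(f' \<odot> g') \<cdot> ((f \<odot> g) \<cdot> k) = ((f' \<odot> g') \<cdot> (f \<odot> g)) \<cdot> k"
    using assms by (subst Comp_assoc_eq) auto
  then show ?thesis using assms by simp
qed

lemma Ass_simps [simp]:
  assumes "x \<in> Obj C" "y \<in> Obj C" "z \<in> Obj C"
  shows "Ass C x y z \<in> Arr C" "Dom C (Ass C x y z) = x \<otimes> (y \<otimes> z)" "Cod C (Ass C x y z) = (x \<otimes> y) \<otimes> z"
    "iso C (Ass C x y z)"
  using Ass_hom [OF assms] Ass_iso [OF assms] by auto

lemma Run_simps [simp]:
  assumes "x \<in> Obj C"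
  shows "Run C x \<in> Arr C" "Dom C (Run C x) = x \<otimes> UnitO C" "Cod C (Run C x) = x" "iso C (Run C x)"
  using Run_hom [OF assms] Run_iso [OF assms] by auto

lemma Lun_simps [simp]:
  assumes "x \<in> Obj C"
  shows "Lun C x \<in> Arr C" "Dom C (Lun C x) = UnitO C \<otimes> x" "Cod C (Lun C x) = x" "iso C (Lun C x)"
  using Lun_hom [OF assms] Lun_iso [OF assms] by auto

lemma Sym_simps [simp]:
  assumes "x \<in> Obj C" "y \<in> Obj C"
  shows "Sym C x y \<in> Arr C" "Dom C (Sym C x y) = x \<otimes> y" "Cod C (Sym C x y) = y \<otimes> x"
  using Sym_hom [OF assms] by auto

lemma Sym_inverse [simp]: "x \<in> Obj C \<Longrightarrow> y \<in> Obj C \<Longrightarrow> Sym C y x \<cdot> Sym C x y = Ide C (x \<otimes> y)"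
  by (rule Sym_Sym)

lemma iso_Sym [simp]:
  assumes "x \<in> Obj C" "y \<in> Obj C"
  shows "iso C (Sym C x y)" "inv_arr C (Sym C x y) = Sym C y x"
  using isoI [of "Sym C x y" "Sym C y x"] assms by simp_all

lemma iso_TenA [simp]:
  assumes "iso C f" "iso C g"
  shows "iso C (f \<odot> g)" "inv_arr C (f \<odot> g) = inv_arr C f \<odot> inv_arr C g"
  using isoI [of "f \<odot> g" "inv_arr C f \<odot> inv_arr C g"] assms by (simp_all add: iso_Arr)

lemma Ass_nat:
  assumes "f \<in> Arr C" "g \<in> Arr C" "h \<in> Arr C" "x = Cod C f" "y = Cod C g" "z = Cod C h"
  shows "Ass C x y z \<cdot> (f \<odot> (g \<odot> h)) = ((f \<odot> g) \<odot> h) \<cdot> Ass C (Dom C f) (Dom C g) (Dom C h)"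
  using assms Ass_natural [of f _ _ g _ _ h] by simp

lemma Ass_inv_nat:
  assumes "f \<in> Arr C" "g \<in> Arr C" "h \<in> Arr C" "x = Cod C f" "y = Cod C g" "z = Cod C h"
  shows "inv_arr C (Ass C x y z) \<cdot> ((f \<odot> g) \<odot> h) = (f \<odot> (g \<odot> h))
    \<cdot> inv_arr C (Ass C (Dom C f) (Dom C g) (Dom C h))"
proof -
  have "inv_arr C (Ass C x y z) \<cdot> ((f \<odot> g) \<odot> h) = inv_arr C (Ass C x y z) \<cdot> (((f \<odot> g) \<odot> h)
    \<cdot> Ass C (Dom C f) (Dom C g) (Dom C h)) \<cdot> inv_arr C (Ass C (Dom C f) (Dom C g) (Dom C h))"
    using assms by simp
  then show ?thesis
    unfolding Ass_nat [OF assms, symmetric] using assms by simp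
qed

lemma Run_nat: "f \<in> Arr C \<Longrightarrow> x = Cod C f \<Longrightarrow> Run C x \<cdot> (f \<odot> Ide C (UnitO C)) = f \<cdot> Run C (Dom C f)"
  using Run_natural by simp

lemma Lun_nat: "f \<in> Arr C \<Longrightarrow> x = Cod C f \<Longrightarrow> Lun C x \<cdot> (Ide C (UnitO C) \<odot> f) = f \<cdot> Lun C (Dom C f)"
  using Lun_natural by simp

lemma Sym_nat: "f \<in> Arr C \<Longrightarrow> g \<in> Arr C \<Longrightarrow> x = Cod C f \<Longrightarrow> y = Cod C g \<Longrightarrow>
    Sym C x y \<cdot> (f \<odot> g) = (g \<odot> f) \<cdot> Sym C (Dom C f) (Dom C g)"
  using Sym_natural by simp

text \<open>Applies an equation between two-factor composites in front of a further factor
  \<open>k\<close>, as right-nested chains require.\<close>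

lemma Comp_reassoc:
  assumes "g \<cdot> f = g' \<cdot> f'" "f \<in> Arr C" "g \<in> Arr C" "f' \<in> Arr C" "g' \<in> Arr C" "k \<in> Arr C"
    "Dom C g = Cod C f" "Dom C g' = Cod C f'" "Dom C f = Cod C k" "Dom C f' = Cod C k"
  shows "g \<cdot> (f \<cdot> k) = g' \<cdot> (f' \<cdot> k)"
  using assms by (metis Comp_assoc_eq)

text \<open>By naturality of \<open>Lun\<close>, tensoring with the unit is naturally isomorphic to
  the identity functor, hence faithful.\<close>

lemma Unit_left_cancel:
  assumes "f \<in> Arr C" "g \<in> Arr C" "Dom C f = Dom C g" "Cod C f = Cod C g"
    and "Ide C (UnitO C) \<odot> f = Ide C (UnitO C) \<odot> g"
  shows "f = g"
proof (rule iso_cancel_right)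
  show "f \<cdot> Lun C (Dom C g) = g \<cdot> Lun C (Dom C g)"
    using assms Lun_nat [of f "Cod C f"] Lun_nat [of g "Cod C g"] by simp
qed (use assms in auto)

lemma Unit_right_cancel:
  assumes "f \<in> Arr C" "g \<in> Arr C" "Dom C f = Dom C g" "Cod C f = Cod C g"
    and "f \<odot> Ide C (UnitO C) = g \<odot> Ide C (UnitO C)"
  shows "f = g"
proof (rule iso_cancel_right)
  show "f \<cdot> Run C (Dom C g) = g \<cdot> Run C (Dom C g)"
    using assms Run_nat [of f "Cod C f"] Run_nat [of g "Cod C g"] by simp
qed (use assms in auto)

text \<open>Kelly's derivation of a unit law that is not among the axioms. After tensoring with the
  unit on the left, the pentagon at \<open>I, I, x, y\<close> and two triangles give the equation up
  to the invertible \<open>Ass C I x y\<close>; both decorations are then cancelled.\<close>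

lemma Lun_TenO:
  assumes x: "x \<in> Obj C" and y: "y \<in> Obj C"
  shows "Lun C (x \<otimes> y) = (Lun C x \<odot> Ide C y) \<cdot> Ass C (UnitO C) x y"
proof -
  let ?I = "UnitO C" let ?i = "Ide C (UnitO C)"
  note xy = x y
  have "Ass C ?I x y \<cdot> (?i \<odot> Lun C (x \<otimes> y)) = Ass C ?I x y \<cdot> ((Run C ?I \<odot> (Ide C x \<odot> Ide C y))
    \<cdot> Ass C ?I ?I (x \<otimes> y))"
    using xy by (simp add: triangle)
  also have "\<dots> = (Ass C ?I x y \<cdot> (Run C ?I \<odot> (Ide C x \<odot> Ide C y))) \<cdot> Ass C ?I ?I (x \<otimes> y)"
    using xy by (simp del: TenA_Ide_Ide)
  also have "\<dots> = ((Run C ?I \<odot> Ide C x) \<odot> Ide C y) \<cdot> Ass C (?I \<otimes> ?I) x y \<cdot> Ass C ?I ?I (x \<otimes> y)"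
    using xy by (subst Ass_nat) auto
  also have "\<dots> = ((Run C ?I \<odot> Ide C x) \<odot> Ide C y) \<cdot> (Ass C ?I ?I x \<odot> Ide C y) \<cdot> Ass C ?I (?I \<otimes> x) y
    \<cdot> (?i \<odot> Ass C ?I x y)"
    using xy by (subst pentagon) auto
  also have "\<dots> = ((?i \<odot> Lun C x) \<odot> Ide C y) \<cdot> Ass C ?I (?I \<otimes> x) y \<cdot> (?i \<odot> Ass C ?I x y)"
    using xy by (simp add: triangle)
  also have "\<dots> = (((?i \<odot> Lun C x) \<odot> Ide C y) \<cdot> Ass C ?I (?I \<otimes> x) y) \<cdot> (?i \<odot> Ass C ?I x y)"
    using xy by simp
  also have "\<dots> = (Ass C ?I x y \<cdot> (?i \<odot> (Lun C x \<odot> Ide C y))) \<cdot> (?i \<odot> Ass C ?I x y)"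
    using xy by (subst Ass_nat) auto
  also have "\<dots> = Ass C ?I x y \<cdot> (?i \<odot> ((Lun C x \<odot> Ide C y) \<cdot> Ass C ?I x y))"
    using xy by simp
  finally have "?i \<odot> Lun C (x \<otimes> y) = ?i \<odot> ((Lun C x \<odot> Ide C y) \<cdot> Ass C ?I x y)"
    by (rule iso_cancel_left [rotated -1]) (use xy in auto)
  then show ?thesis by (rule Unit_left_cancel [rotated -1]) (use xy in auto)
qed

lemma Sym_TenO_left:
  assumes "x \<in> Obj C" "y \<in> Obj C" "z \<in> Obj C"
  shows "Sym C (x \<otimes> y) z = inv_arr C (Ass C z x y) \<cdot> (Sym C x z \<odot> Ide C y) \<cdot> Ass C x z y
    \<cdot> (Ide C x \<odot> Sym C y z) \<cdot> inv_arr C (Ass C x y z)"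
proof -
  have "Sym C (x \<otimes> y) z = inv_arr C (Ass C z x y) \<cdot> (Ass C z x y \<cdot> Sym C (x \<otimes> y) z \<cdot> Ass C x y z)
    \<cdot> inv_arr C (Ass C x y z)"
    using assms by simp
  also have "\<dots> = inv_arr C (Ass C z x y) \<cdot> (Sym C x z \<odot> Ide C y) \<cdot> Ass C x z y
    \<cdot> (Ide C x \<odot> Sym C y z) \<cdot> inv_arr C (Ass C x y z)"
    using assms by (subst hexagon) auto
  finally show ?thesis .
qed

text \<open>The second hexagon is the first one inverted, because the inverse of a symmetry is again
  a symmetry.\<close>

lemma Sym_TenO_right:
  assumes "x \<in> Obj C" "y \<in> Obj C" "z \<in> Obj C"
  shows "Sym C z (x \<otimes> y) = Ass C x y z \<cdot> (Ide C x \<odot> Sym C z y) \<cdot> inv_arr C (Ass C x z y)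
    \<cdot> (Sym C z x \<odot> Ide C y) \<cdot> Ass C z x y"
  (is "_ = ?g")
proof -
  have "inv_arr C (Sym C (x \<otimes> y) z) = ?g"
  proof (rule isoI)
    show "?g \<cdot> Sym C (x \<otimes> y) z = Ide C (Dom C (Sym C (x \<otimes> y) z))"
      using assms by (simp add: Sym_TenO_left)
    show "Sym C (x \<otimes> y) z \<cdot> ?g = Ide C (Cod C (Sym C (x \<otimes> y) z))"
      using assms by (simp add: Sym_TenO_left)
  qed (use assms in auto)
  then show ?thesis using assms by simp
qed

end

section \<open>Coherence for bracketings\<close>

text \<open>An object of \<open>C\<close> does not remember how it was built by tensoring, so the
  recursions below run over formal trees; \<open>ev\<close> forgets the tree.\<close>

datatype 'o bracketing = Unit | Leaf 'o | Node "'o bracketing" "'o bracketing"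

context symmetric_monoidal_category
begin

primrec ev :: "'o bracketing \<Rightarrow> 'o" where
  "ev Unit = UnitO C"
| "ev (Leaf x) = x"
| "ev (Node s t) = ev s \<otimes> ev t"

primrec act :: "'o bracketing \<Rightarrow> 'o \<Rightarrow> 'o" where
  "act Unit n = n"
| "act (Leaf x) n = x \<otimes> n"
| "act (Node s t) n = act s (act t n)"

primrec act_arr :: "'o bracketing \<Rightarrow> 'm \<Rightarrow> 'm" where
  "act_arr Unit f = f"
| "act_arr (Leaf x) f = Ide C x \<odot> f"
| "act_arr (Node s t) f = act_arr s (act_arr t f)"

text \<open>The canonical isomorphism from \<open>ev s \<otimes> n\<close> to
  \<open>act s n\<close>, which deletes units and brackets to the right. The inverse of
  \<open>Ass\<close> occurs because \<open>Ass\<close> itself brackets to the left.\<close>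

primrec flatten :: "'o bracketing \<Rightarrow> 'o \<Rightarrow> 'm" where
  "flatten Unit n = Lun C n"
| "flatten (Leaf x) n = Ide C (x \<otimes> n)"
| "flatten (Node s t) n =
     act_arr s (flatten t n) \<cdot> flatten s (ev t \<otimes> n) \<cdot> inv_arr C (Ass C (ev s) (ev t) n)"

abbreviation valid :: "'o bracketing \<Rightarrow> bool" where
  "valid s \<equiv> set_bracketing s \<subseteq> Obj C"

lemma ev_in_Obj [simp]: "valid s \<Longrightarrow> ev s \<in> Obj C"
  by (induction s) auto

lemma act_in_Obj [simp]: "valid s \<Longrightarrow> n \<in> Obj C \<Longrightarrow> act s n \<in> Obj C"
  by (induction s arbitrary: n) auto

lemma act_arr_simps [simp]:
  assumes "valid s" "f \<in> Arr C"
  shows "act_arr s f \<in> Arr C" "Dom C (act_arr s f) = act s (Dom C f)" "Cod C (act_arr s f) = act s (Cod C f)"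
  using assms by (induction s arbitrary: f) auto

lemma act_arr_Ide [simp]: "valid s \<Longrightarrow> n \<in> Obj C \<Longrightarrow> act_arr s (Ide C n) = Ide C (act s n)"
  by (induction s arbitrary: n) auto

lemma act_arr_Comp:
  assumes "valid s" "f \<in> Arr C" "g \<in> Arr C" "Dom C g = Cod C f"
  shows "act_arr s (g \<cdot> f) = act_arr s g \<cdot> act_arr s f"
  using assms by (induction s arbitrary: f g) auto

lemma iso_act_arr [simp]: "valid s \<Longrightarrow> iso C f \<Longrightarrow> iso C (act_arr s f)"
  by (induction s arbitrary: f) auto

lemma flatten_simps [simp]:
  assumes "valid s" "n \<in> Obj C"
  shows "flatten s n \<in> Arr C" "Dom C (flatten s n) = ev s \<otimes> n" "Cod C (flatten s n) = act s n"
    "iso C (flatten s n)"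
  using assms by (induction s arbitrary: n) auto

lemma flatten_natural:
  assumes "valid s" "f \<in> Arr C" "n = Cod C f"
  shows "flatten s n \<cdot> (Ide C (ev s) \<odot> f) = act_arr s f \<cdot> flatten s (Dom C f)"
  using assms
proof (induction s arbitrary: f n)
  case Unit
  then show ?case by (simp add: Lun_nat)
next
  case (Leaf x)
  then show ?case by simp
next
  case (Node s t)
  then have v: "valid s" "valid t" by auto
  note [simp] = \<open>f \<in> Arr C\<close> v
  have "flatten (Node s t) n \<cdot> (Ide C (ev (Node s t)) \<odot> f)
    = act_arr s (flatten t n) \<cdot> flatten s (ev t \<otimes> n) \<cdot>
    inv_arr C (Ass C (ev s) (ev t) n) \<cdot> ((Ide C (ev s) \<odot> Ide C (ev t)) \<odot> f)"
    using Node by simp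
  also have "\<dots> = act_arr s (flatten t n) \<cdot> (flatten s (ev t \<otimes> n)
    \<cdot> (Ide C (ev s) \<odot> (Ide C (ev t) \<odot> f))) \<cdot> inv_arr C (Ass C (ev s) (ev t) (Dom C f))"
    using Node by (subst Ass_inv_nat) auto
  also have "\<dots> = (act_arr s (flatten t n) \<cdot> act_arr s (Ide C (ev t) \<odot> f))
    \<cdot> flatten s (ev t \<otimes> Dom C f) \<cdot> inv_arr C (Ass C (ev s) (ev t) (Dom C f))"
    using Node by (subst Node.IH(1)) auto
  also have "\<dots> = (act_arr s (act_arr t f \<cdot> flatten t (Dom C f))) \<cdot> flatten s (ev t \<otimes> Dom C f)
    \<cdot> inv_arr C (Ass C (ev s) (ev t) (Dom C f))"
    using Node by (subst act_arr_Comp [symmetric]) (auto simp: Node.IH(2))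
  finally show ?case by (simp add: act_arr_Comp)
qed

text \<open>Bracketings act on objects by iterated left tensoring, and every canonical arrow induces a
  natural transformation between such actions.  Associativity and unit constraints induce
  identities, so that equations between canonical arrows become equations in a strict setting.\<close>

definition acts_as :: "'o bracketing \<Rightarrow> 'o bracketing \<Rightarrow> 'm \<Rightarrow> ('o \<Rightarrow> 'm) \<Rightarrow> bool" where
  "acts_as s t f \<phi> \<longleftrightarrow> valid s \<and> valid t \<and> f \<in> Arr C \<and> Dom C f = ev s \<and> Cod C f = ev t \<and>
     (\<forall>n\<in>Obj C. \<phi> n \<in> Arr C \<and> Dom C (\<phi> n) = act s n \<and> Cod C (\<phi> n) = act t n \<and>
        flatten t n \<cdot> (f \<odot> Ide C n) = \<phi> n \<cdot> flatten s n)"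

section \<open>Canonical arrows and the natural families that they induce\<close>

lemma acts_as_cong:
  "acts_as s t f \<phi> \<Longrightarrow> (\<And>n. n \<in> Obj C \<Longrightarrow> \<phi> n = \<psi> n) \<Longrightarrow> acts_as s t f \<psi>"
  by (simp add: acts_as_def)

text \<open>The family at the unit object determines \<open>f\<close>: since \<open>flatten\<close>
  is invertible it determines \<open>f \<odot> Ide C (UnitO C)\<close>, and tensoring with the unit
  is faithful. The coherence equations for \<open>interchange\<close> are proved by this
  rule.\<close>

lemma acts_as_unique:
  assumes "acts_as s t f \<phi>" "acts_as s t g \<psi>" "\<phi> (UnitO C) = \<psi> (UnitO C)"
  shows "f = g"
proof (rule Unit_right_cancel)
  show "f \<odot> Ide C (UnitO C) = g \<odot> Ide C (UnitO C)"
    by (rule iso_cancel_left [of "flatten t (UnitO C)"]) (use assms in \<open>auto simp: acts_as_def\<close>)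
qed (use assms in \<open>auto simp: acts_as_def\<close>)

text \<open>Conjugation with \<open>flatten\<close> turns the family into
  \<open>f \<odot> -\<close>, which is natural by bifunctoriality; the invertible
  \<open>flatten\<close> is then cancelled.\<close>

lemma acts_as_natural:
  assumes f: "acts_as s t f \<phi>" and g: "g \<in> Arr C"
  shows "\<phi> (Cod C g) \<cdot> act_arr s g = act_arr t g \<cdot> \<phi> (Dom C g)"
proof (rule iso_cancel_right [of "flatten s (Dom C g)"])
  note [simp] = g
  have [simp]: "valid s" "valid t" "f \<in> Arr C" "Dom C f = ev s" "Cod C f = ev t"
    "\<And>n. n \<in> Obj C \<Longrightarrow> \<phi> n \<in> Arr C" "\<And>n. n \<in> Obj C \<Longrightarrow> Dom C (\<phi> n) = act s n"
    "\<And>n. n \<in> Obj C \<Longrightarrow> Cod C (\<phi> n) = act t n"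
    and eq: "\<And>n. n \<in> Obj C \<Longrightarrow> flatten t n \<cdot> (f \<odot> Ide C n) = \<phi> n \<cdot> flatten s n"
    using f by (auto simp: acts_as_def)
  have "(\<phi> (Cod C g) \<cdot> act_arr s g) \<cdot> flatten s (Dom C g) = (\<phi> (Cod C g) \<cdot> flatten s (Cod C g))
    \<cdot> (Ide C (ev s) \<odot> g)" (is "?lhs = _")
    by (simp add: flatten_natural)
  also have "\<dots> = flatten t (Cod C g) \<cdot> ((f \<odot> Ide C (Cod C g)) \<cdot> (Ide C (ev s) \<odot> g))"
    by (simp add: eq [symmetric] del: Comp_TenA)
  also have "\<dots> = flatten t (Cod C g) \<cdot> ((Ide C (ev t) \<odot> g) \<cdot> (f \<odot> Ide C (Dom C g)))"
    by simp
  also have "\<dots> = (flatten t (Cod C g) \<cdot> (Ide C (ev t) \<odot> g)) \<cdot> (f \<odot> Ide C (Dom C g))"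
    by (simp del: Comp_TenA)
  also have "\<dots> = (act_arr t g \<cdot> \<phi> (Dom C g)) \<cdot> flatten s (Dom C g)"
    by (simp add: flatten_natural eq)
  finally show "?lhs = \<dots>" .
qed (use assms in \<open>auto simp: acts_as_def\<close>)

lemma acts_as_Ide: "valid s \<Longrightarrow> acts_as s s (Ide C (ev s)) (\<lambda>n. Ide C (act s n))"
  by (simp add: acts_as_def)

lemma acts_as_Comp:
  assumes "acts_as s t f \<phi>" "acts_as t u g \<psi>"
  shows "acts_as s u (g \<cdot> f) (\<lambda>n. \<psi> n \<cdot> \<phi> n)"
proof -
  have "flatten u n \<cdot> ((g \<cdot> f) \<odot> Ide C n) = (\<psi> n \<cdot> \<phi> n) \<cdot> flatten s n" if n: "n \<in> Obj C" for n
  proof -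
    note [simp] = n
    have f: "valid s" "valid t" "f \<in> Arr C" "Dom C f = ev s" "Cod C f = ev t" "\<phi> n \<in> Arr C"
      "Dom C (\<phi> n) = act s n" "Cod C (\<phi> n) = act t n" "flatten t n \<cdot> (f \<odot> Ide C n) = \<phi> n \<cdot> flatten s n"
      using assms(1) n by (auto simp: acts_as_def)
    have g: "valid u" "g \<in> Arr C" "Dom C g = ev t" "Cod C g = ev u" "\<psi> n \<in> Arr C"
      "Dom C (\<psi> n) = act t n" "Cod C (\<psi> n) = act u n" "flatten u n \<cdot> (g \<odot> Ide C n) = \<psi> n \<cdot> flatten t n"
      using assms(2) n by (auto simp: acts_as_def)
    have "flatten u n \<cdot> ((g \<cdot> f) \<odot> Ide C n) = (flatten u n \<cdot> (g \<odot> Ide C n)) \<cdot> (f \<odot> Ide C n)"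
      using f(1-8) g(1-7) by simp
    also have "\<dots> = \<psi> n \<cdot> (flatten t n \<cdot> (f \<odot> Ide C n))" unfolding g(8) using f(1-8) g(1-7) by simp
    also have "\<dots> = (\<psi> n \<cdot> \<phi> n) \<cdot> flatten s n" unfolding f(9) using f(1-8) g(1-7) by simp
    finally show ?thesis .
  qed
  then show ?thesis using assms by (simp add: acts_as_def)
qed

text \<open>The family of a tensor is the horizontal composite of the two families:
  \<open>\<psi>\<close> acts under \<open>s\<close>, then \<open>\<phi>\<close> acts in front of the
  result.\<close>

lemma acts_as_TenA:
  assumes f: "acts_as s t f \<phi>" and g: "acts_as s' t' g \<psi>"
  shows "acts_as (Node s s') (Node t t') (f \<odot> g) (\<lambda>n. \<phi> (act t' n) \<cdot> act_arr s (\<psi> n))"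
proof -
  have [simp]: "valid s" "valid t" "f \<in> Arr C" "Dom C f = ev s" "Cod C f = ev t"
    "\<And>n. n \<in> Obj C \<Longrightarrow> \<phi> n \<in> Arr C" "\<And>n. n \<in> Obj C \<Longrightarrow> Dom C (\<phi> n) = act s n"
    "\<And>n. n \<in> Obj C \<Longrightarrow> Cod C (\<phi> n) = act t n"
    and eqf: "\<And>n. n \<in> Obj C \<Longrightarrow> flatten t n \<cdot> (f \<odot> Ide C n) = \<phi> n \<cdot> flatten s n"
    using f by (auto simp: acts_as_def)
  have [simp]: "valid s'" "valid t'" "g \<in> Arr C" "Dom C g = ev s'" "Cod C g = ev t'"
    "\<And>n. n \<in> Obj C \<Longrightarrow> \<psi> n \<in> Arr C" "\<And>n. n \<in> Obj C \<Longrightarrow> Dom C (\<psi> n) = act s' n"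
    "\<And>n. n \<in> Obj C \<Longrightarrow> Cod C (\<psi> n) = act t' n"
    and eqg: "\<And>n. n \<in> Obj C \<Longrightarrow> flatten t' n \<cdot> (g \<odot> Ide C n) = \<psi> n \<cdot> flatten s' n"
    using g by (auto simp: acts_as_def)
  have "flatten (Node t t') n \<cdot> ((f \<odot> g) \<odot> Ide C n)
      = (\<phi> (act t' n) \<cdot> act_arr s (\<psi> n)) \<cdot> flatten (Node s s') n" if [simp]: "n \<in> Obj C" for n
  proof -
    let ?a = "inv_arr C (Ass C (ev s) (ev s') n)"
    have "flatten (Node t t') n \<cdot> ((f \<odot> g) \<odot> Ide C n)
      = act_arr t (flatten t' n) \<cdot> flatten t (ev t' \<otimes> n) \<cdot> ((f \<odot> (g \<odot> Ide C n)) \<cdot> ?a)"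
      by (simp add: Ass_inv_nat)
    also have "\<dots> = act_arr t (flatten t' n) \<cdot> (flatten t (ev t' \<otimes> n) \<cdot> (f \<odot> Ide C (ev t' \<otimes> n)))
      \<cdot> (Ide C (ev s) \<odot> (g \<odot> Ide C n)) \<cdot> ?a"
      by simp
    also have "\<dots> = (act_arr t (flatten t' n) \<cdot> \<phi> (ev t' \<otimes> n)) \<cdot> (flatten s (ev t' \<otimes> n)
      \<cdot> (Ide C (ev s) \<odot> (g \<odot> Ide C n))) \<cdot> ?a"
      by (simp add: eqf)
    \<comment> \<open>Naturality of \<open>\<phi>\<close> along the arrow
      \<open>flatten t' n\<close> exchanges the two.\<close>
    also have "\<dots> = (\<phi> (act t' n) \<cdot> act_arr s (flatten t' n)) \<cdot> (act_arr s (g \<odot> Ide C n)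
      \<cdot> flatten s (ev s' \<otimes> n)) \<cdot> ?a"
      using acts_as_natural [OF f, of "flatten t' n", symmetric] by (simp add: flatten_natural)
    also have "\<dots> = \<phi> (act t' n) \<cdot> act_arr s (flatten t' n \<cdot> (g \<odot> Ide C n)) \<cdot> flatten s (ev s' \<otimes> n) \<cdot> ?a"
      by (simp add: act_arr_Comp)
    also have "\<dots> = (\<phi> (act t' n) \<cdot> act_arr s (\<psi> n)) \<cdot> flatten (Node s s') n"
      by (simp add: eqg act_arr_Comp)
    finally show ?thesis .
  qed
  then show ?thesis by (simp add: acts_as_def)
qed

text \<open>A one-sided inverse of the family suffices, because \<open>f\<close> is already
  invertible and its family is \<open>f\<close> conjugated by \<open>flatten\<close>.\<close>

lemma acts_as_inverse:
  assumes "acts_as s t f \<phi>" "iso C f"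
    and \<psi>: "\<And>n. n \<in> Obj C \<Longrightarrow> \<psi> n \<in> Arr C \<and> Dom C (\<psi> n) = act t n \<and> Cod C (\<psi> n) = act s n \<and> \<psi> n \<cdot> \<phi> n
      = Ide C (act s n)"
  shows "acts_as t s (inv_arr C f) \<psi>"
proof -
  have "flatten s n \<cdot> (inv_arr C f \<odot> Ide C n) = \<psi> n \<cdot> flatten t n" if n: "n \<in> Obj C" for n
  proof -
    note [simp] = n
    have f: "valid s" "valid t" "f \<in> Arr C" "Dom C f = ev s" "Cod C f = ev t" "\<phi> n \<in> Arr C"
      "Dom C (\<phi> n) = act s n" "Cod C (\<phi> n) = act t n" "flatten t n \<cdot> (f \<odot> Ide C n) = \<phi> n \<cdot> flatten s n"
      using assms(1) n by (auto simp: acts_as_def)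
    have g: "\<psi> n \<in> Arr C" "Dom C (\<psi> n) = act t n" "Cod C (\<psi> n) = act s n" "\<psi> n \<cdot> \<phi> n = Ide C (act s n)"
      using \<psi> [OF n] by auto
    have "flatten s n \<cdot> (inv_arr C f \<odot> Ide C n) = (\<psi> n \<cdot> \<phi> n) \<cdot> (flatten s n \<cdot> (inv_arr C f \<odot> Ide C n))"
      unfolding g(4) using f(1-8) assms(2) by simp
    also have "\<dots> = \<psi> n \<cdot> (\<phi> n \<cdot> flatten s n) \<cdot> (inv_arr C f \<odot> Ide C n)"
      using f(1-8) g(1-3) assms(2) by simp
    also have "\<dots> = \<psi> n \<cdot> flatten t n"
      unfolding f(9) [symmetric] using f(1-8) g(1-3) assms(2) by simp
    finally show ?thesis .
  qed
  then show ?thesis using assms by (simp add: acts_as_def)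
qed

text \<open>Both bracketings flatten to the same object, and the pentagon says that the two
  flattenings differ exactly by the associator. The fact \<open>pent\<close> is the pentagon solved
  for the inverse associators that occur in \<open>flatten\<close>.\<close>

lemma acts_as_Ass:
  assumes [simp]: "valid s" "valid t" "valid u"
  shows "acts_as (Node s (Node t u)) (Node (Node s t) u) (Ass C (ev s) (ev t) (ev u)) (\<lambda>n. Ide C (act s (act t (act u n))))"
proof -
  have "flatten (Node (Node s t) u) n \<cdot> (Ass C (ev s) (ev t) (ev u) \<odot> Ide C n)
    = flatten (Node s (Node t u)) n"
    if [simp]: "n \<in> Obj C" for n
  proof -
    let ?S = "ev s" and ?T = "ev t" and ?U = "ev u"
    have pent: "inv_arr C (Ass C ?S ?T (?U \<otimes> n)) \<cdot> inv_arr C (Ass C (?S \<otimes> ?T) ?U n)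
      \<cdot> (Ass C ?S ?T ?U \<odot> Ide C n)
       = (Ide C ?S \<odot> inv_arr C (Ass C ?T ?U n)) \<cdot> inv_arr C (Ass C ?S (?T \<otimes> ?U) n)" (is "?l = ?r")
    proof (rule iso_cancel_right)
      show "?l \<cdot> (Ass C ?S (?T \<otimes> ?U) n \<cdot> (Ide C ?S \<odot> Ass C ?T ?U n)) = ?r \<cdot> (Ass C ?S (?T \<otimes> ?U) n
        \<cdot> (Ide C ?S \<odot> Ass C ?T ?U n))"
        using pentagon [of ?S ?T ?U n, symmetric] by simp
    qed auto
    have "flatten (Node (Node s t) u) n \<cdot> (Ass C ?S ?T ?U \<odot> Ide C n)
      = act_arr s (act_arr t (flatten u n)) \<cdot> act_arr s (flatten t (?U \<otimes> n)) \<cdot> flatten s (?T \<otimes> (?U \<otimes> n)) \<cdot> ?l"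
      by simp
    also have "\<dots> = act_arr s (act_arr t (flatten u n)) \<cdot> act_arr s (flatten t (?U \<otimes> n))
      \<cdot> (flatten s (?T \<otimes> (?U \<otimes> n)) \<cdot> (Ide C ?S \<odot> inv_arr C (Ass C ?T ?U n))) \<cdot>
      inv_arr C (Ass C ?S (?T \<otimes> ?U) n)"
      by (subst pent) simp
    also have "\<dots> = flatten (Node s (Node t u)) n"
      by (simp add: flatten_natural act_arr_Comp)
    finally show ?thesis .
  qed
  then show ?thesis by (simp add: acts_as_def del: flatten.simps)
qed

lemma acts_as_Ass_inv:
  assumes [simp]: "valid s" "valid t" "valid u"
  shows "acts_as (Node (Node s t) u) (Node s (Node t u)) (inv_arr C (Ass C (ev s) (ev t) (ev u)))
    (\<lambda>n. Ide C (act s (act t (act u n))))"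
  by (rule acts_as_inverse [OF acts_as_Ass]) auto

text \<open>The triangle axiom with \<open>n\<close> as second argument, followed by naturality of
  \<open>flatten s\<close> along \<open>Lun C n\<close>.\<close>

lemma acts_as_Run:
  assumes [simp]: "valid s"
  shows "acts_as (Node s Unit) s (Run C (ev s)) (\<lambda>n. Ide C (act s n))"
proof -
  have "flatten s n \<cdot> (Run C (ev s) \<odot> Ide C n) = flatten (Node s Unit) n" if [simp]: "n \<in> Obj C" for n
  proof -
    have "flatten s n \<cdot> (Run C (ev s) \<odot> Ide C n) = flatten s n \<cdot> (((Run C (ev s) \<odot> Ide C n)
      \<cdot> Ass C (ev s) (UnitO C) n) \<cdot> inv_arr C (Ass C (ev s) (UnitO C) n))"
      by simp
    also have "\<dots> = flatten s n \<cdot> ((Ide C (ev s) \<odot> Lun C n) \<cdot> inv_arr C (Ass C (ev s) (UnitO C) n))"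
      by (subst triangle) auto
    also have "\<dots> = (flatten s n \<cdot> (Ide C (ev s) \<odot> Lun C n)) \<cdot> inv_arr C (Ass C (ev s) (UnitO C) n)"
      by simp
    also have "\<dots> = flatten (Node s Unit) n"
      by (subst flatten_natural) auto
    finally show ?thesis .
  qed
  then show ?thesis by (simp add: acts_as_def del: flatten.simps)
qed

lemma acts_as_Run_inv:
  assumes [simp]: "valid s"
  shows "acts_as s (Node s Unit) (inv_arr C (Run C (ev s))) (\<lambda>n. Ide C (act s n))"
  by (rule acts_as_inverse [OF acts_as_Run]) auto

text \<open>\<open>Lun_TenO\<close> takes the part that the triangle axiom has for the right
  unit.\<close>

lemma acts_as_Lun:
  assumes [simp]: "valid s"
  shows "acts_as (Node Unit s) s (Lun C (ev s)) (\<lambda>n. Ide C (act s n))"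
proof -
  have "flatten s n \<cdot> (Lun C (ev s) \<odot> Ide C n) = flatten (Node Unit s) n" if [simp]: "n \<in> Obj C" for n
    by (simp add: Lun_TenO Lun_nat [symmetric] Comp_reassoc [OF Lun_nat [symmetric]])
  then show ?thesis by (simp add: acts_as_def del: flatten.simps)
qed

lemma acts_as_Lun_inv:
  assumes [simp]: "valid s"
  shows "acts_as s (Node Unit s) (inv_arr C (Lun C (ev s))) (\<lambda>n. Ide C (act s n))"
  by (rule acts_as_inverse [OF acts_as_Lun]) auto

text \<open>A symmetry with the unit is a composite of unit constraints, so it acts as an
  identity.\<close>

lemma Sym_Unit_right: "x \<in> Obj C \<Longrightarrow> Sym C x (UnitO C) = inv_arr C (Lun C x) \<cdot> Run C x"
  by (simp add: Lun_Sym [symmetric])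

lemma acts_as_Sym_Unit_right:
  assumes [simp]: "valid s"
  shows "acts_as (Node s Unit) (Node Unit s) (Sym C (ev s) (ev Unit)) (\<lambda>n. Ide C (act s n))"
  unfolding ev.simps Sym_Unit_right [OF ev_in_Obj [OF assms]]
  by (rule acts_as_cong [OF acts_as_Comp [OF acts_as_Run acts_as_Lun_inv]]) auto

lemma acts_as_Sym_Unit_left:
  assumes [simp]: "valid s"
  shows "acts_as (Node Unit s) (Node s Unit) (Sym C (ev Unit) (ev s)) (\<lambda>n. Ide C (act s n))"
  using acts_as_inverse [OF acts_as_Sym_Unit_right, of s "\<lambda>n. Ide C (act s n)"] by simp

text \<open>The action of the symmetry of two objects on \<open>n\<close>. Among the elementary
  constraints it is the only one that survives in the strict setting.\<close>

definition swap :: "'o \<Rightarrow> 'o \<Rightarrow> 'o \<Rightarrow> 'm" where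
  "swap x y n = inv_arr C (Ass C y x n) \<cdot> (Sym C x y \<odot> Ide C n) \<cdot> Ass C x y n"

lemma swap_simps [simp]:
  assumes "x \<in> Obj C" "y \<in> Obj C" "n \<in> Obj C"
  shows "swap x y n \<in> Arr C" "Dom C (swap x y n) = x \<otimes> (y \<otimes> n)" "Cod C (swap x y n) = y \<otimes> (x \<otimes> n)"
    "swap y x n \<cdot> swap x y n = Ide C (x \<otimes> (y \<otimes> n))"
  using assms by (simp_all add: swap_def)

lemma swap_swap_Comp [simp]:
  assumes "x \<in> Obj C" "y \<in> Obj C" "n \<in> Obj C" "k \<in> Arr C" "Cod C k = x \<otimes> (y \<otimes> n)"
  shows "swap y x n \<cdot> (swap x y n \<cdot> k) = k"
  using assms by (simp flip: Comp_assoc_eq)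

lemma acts_as_Sym_Leaf:
  assumes "x \<in> Obj C" "y \<in> Obj C"
  shows "acts_as (Node (Leaf x) (Leaf y)) (Node (Leaf y) (Leaf x)) (Sym C (ev (Leaf x)) (ev (Leaf y))) (swap x y)"
  using assms by (simp add: acts_as_def swap_def)

lemma swap_natural:
  assumes "x \<in> Obj C" "y \<in> Obj C" "f \<in> Arr C" "n = Cod C f"
  shows "swap x y n \<cdot> (Ide C x \<odot> (Ide C y \<odot> f)) = (Ide C y \<odot> (Ide C x \<odot> f)) \<cdot> swap x y (Dom C f)"
  using acts_as_natural [OF acts_as_Sym_Leaf [of x y], of f] assms by simp

text \<open>Merging of tensors leaves a further factor \<open>g\<close> together with
  \<open>Ide C y \<odot> f\<close> under \<open>Ide C x\<close>; this variant of naturality matches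
  the merged form.\<close>

lemma swap_natural_Comp:
  assumes "x \<in> Obj C" "y \<in> Obj C" "f \<in> Arr C" "n = Cod C f" "g \<in> Arr C" "Cod C g = y \<otimes> Dom C f"
  shows "swap x y n \<cdot> (Ide C x \<odot> ((Ide C y \<odot> f) \<cdot> g)) = (Ide C y \<odot> (Ide C x \<odot> f))
    \<cdot> swap x y (Dom C f) \<cdot> (Ide C x \<odot> g)"
proof -
  have "swap x y n \<cdot> (Ide C x \<odot> ((Ide C y \<odot> f) \<cdot> g)) = (swap x y n \<cdot> (Ide C x \<odot> (Ide C y \<odot> f)))
    \<cdot> (Ide C x \<odot> g)"
    using assms by simp
  then show ?thesis using assms by (simp add: swap_natural)
qed

text \<open>The hexagon with its associators erased: \<open>s'\<close> moves past \<open>t\<close>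
  first, then \<open>s\<close> does.\<close>

lemma acts_as_Sym_Node_left:
  assumes s: "acts_as (Node s t) (Node t s) (Sym C (ev s) (ev t)) \<phi>"
    and s': "acts_as (Node s' t) (Node t s') (Sym C (ev s') (ev t)) \<phi>'"
  shows "acts_as (Node (Node s s') t) (Node t (Node s s')) (Sym C (ev (Node s s')) (ev t))
    (\<lambda>n. \<phi> (act s' n) \<cdot> act_arr s (\<phi>' n))"
proof -
  have v [simp]: "valid s" "valid t" "valid s'"
    and ty [simp]: "\<And>n. n \<in> Obj C \<Longrightarrow> \<phi> n \<in> Arr C" "\<And>n. n \<in> Obj C \<Longrightarrow> Dom C (\<phi> n) = act s (act t n)"
    "\<And>n. n \<in> Obj C \<Longrightarrow> Cod C (\<phi> n) = act t (act s n)"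
    "\<And>n. n \<in> Obj C \<Longrightarrow> \<phi>' n \<in> Arr C" "\<And>n. n \<in> Obj C \<Longrightarrow> Dom C (\<phi>' n) = act s' (act t n)"
    "\<And>n. n \<in> Obj C \<Longrightarrow> Cod C (\<phi>' n) = act t (act s' n)"
    using s s' by (auto simp: acts_as_def)
  note c = acts_as_Comp [OF acts_as_Comp [OF acts_as_Comp [OF
    acts_as_Comp [OF acts_as_Ass_inv [of s s' t]
      acts_as_TenA [OF acts_as_Ide [of s] s']] acts_as_Ass [of s t s']]
        acts_as_TenA [OF s acts_as_Ide [of s']]] acts_as_Ass_inv [of t s s']]
  show ?thesis
    unfolding ev.simps Sym_TenO_left [OF ev_in_Obj [OF v(1)] ev_in_Obj [OF v(3)] ev_in_Obj [OF v(2)]]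
    by (rule acts_as_cong [OF c [unfolded ev.simps]]) auto
qed

text \<open>The inverted hexagon with its associators erased: \<open>t\<close> moves past
  \<open>s\<close>, then past \<open>s'\<close>.\<close>

lemma acts_as_Sym_Node_right:
  assumes s: "acts_as (Node t s) (Node s t) (Sym C (ev t) (ev s)) \<phi>"
    and s': "acts_as (Node t s') (Node s' t) (Sym C (ev t) (ev s')) \<phi>'"
  shows "acts_as (Node t (Node s s')) (Node (Node s s') t) (Sym C (ev t) (ev (Node s s')))
    (\<lambda>n. act_arr s (\<phi>' n) \<cdot> \<phi> (act s' n))"
proof -
  have v [simp]: "valid s" "valid t" "valid s'"
    and ty [simp]: "\<And>n. n \<in> Obj C \<Longrightarrow> \<phi> n \<in> Arr C" "\<And>n. n \<in> Obj C \<Longrightarrow> Dom C (\<phi> n) = act t (act s n)"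
    "\<And>n. n \<in> Obj C \<Longrightarrow> Cod C (\<phi> n) = act s (act t n)"
    "\<And>n. n \<in> Obj C \<Longrightarrow> \<phi>' n \<in> Arr C" "\<And>n. n \<in> Obj C \<Longrightarrow> Dom C (\<phi>' n) = act t (act s' n)"
    "\<And>n. n \<in> Obj C \<Longrightarrow> Cod C (\<phi>' n) = act s' (act t n)"
    using s s' by (auto simp: acts_as_def)
  note c = acts_as_Comp [OF acts_as_Comp [OF acts_as_Comp [OF
    acts_as_Comp [OF acts_as_Ass [of t s s']
      acts_as_TenA [OF s acts_as_Ide [of s']]] acts_as_Ass_inv [of s t s']]
        acts_as_TenA [OF acts_as_Ide [of s] s']] acts_as_Ass [of s s' t]]
  show ?thesis
    unfolding ev.simps Sym_TenO_right [OF ev_in_Obj [OF v(1)] ev_in_Obj [OF v(3)] ev_in_Obj [OF v(2)]]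
    by (rule acts_as_cong [OF c [unfolded ev.simps]]) auto
qed

text \<open>Of the five factors of \<open>interchange\<close> only the symmetry survives, placed
  under \<open>w\<close> and in front of \<open>z\<close>.\<close>

lemma acts_as_interchange:
  assumes v [simp]: "valid w" "valid z" and s: "acts_as (Node x y) (Node y x) (Sym C (ev x) (ev y)) \<phi>"
  shows "acts_as (Node (Node w x) (Node y z)) (Node (Node w y) (Node x z))
    (interchange C (ev w) (ev x) (ev y) (ev z)) (\<lambda>n. act_arr w (\<phi> (act z n)))"
proof -
  have v' [simp]: "valid x" "valid y"
    and ty [simp]: "\<And>n. n \<in> Obj C \<Longrightarrow> \<phi> n \<in> Arr C" "\<And>n. n \<in> Obj C \<Longrightarrow> Dom C (\<phi> n) = act x (act y n)"
    "\<And>n. n \<in> Obj C \<Longrightarrow> Cod C (\<phi> n) = act y (act x n)"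
    using s by (auto simp: acts_as_def)
  note c = acts_as_Comp [OF acts_as_Comp [OF acts_as_Comp [OF
    acts_as_Comp [OF acts_as_Ass [of "Node w x" y z]
      acts_as_TenA [OF acts_as_Ass_inv [of w x y] acts_as_Ide [of z]]] acts_as_TenA [OF
        acts_as_TenA [OF acts_as_Ide [of w] s] acts_as_Ide [of z]]]
          acts_as_TenA [OF acts_as_Ass [of w y x] acts_as_Ide [of z]]] acts_as_Ass_inv [of "Node w y" x z]]
  show ?thesis unfolding interchange_def by (rule acts_as_cong [OF c [unfolded ev.simps]]) auto
qed

end

section \<open>The interchange isomorphism\<close>

context symmetric_monoidal_category
begin

lemma interchange_simps [simp]:
  assumes "w \<in> Obj C" "x \<in> Obj C" "y \<in> Obj C" "z \<in> Obj C"
  shows "interchange C w x y z \<in> Arr C"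
    "Dom C (interchange C w x y z) = (w \<otimes> x) \<otimes> (y \<otimes> z)"
    "Cod C (interchange C w x y z) = (w \<otimes> y) \<otimes> (x \<otimes> z)"
    "iso C (interchange C w x y z)"
  using assms by (simp_all add: interchange_def)

text \<open>Needs no passage to the strict setting: the four arrows are carried through the five
  factors one after the other.\<close>

lemma interchange_natural:
  assumes "f \<in> Arr C" "g \<in> Arr C" "h \<in> Arr C" "k \<in> Arr C"
    "w = Cod C f" "x = Cod C g" "y = Cod C h" "z = Cod C k"
  shows "interchange C w x y z \<cdot> ((f \<odot> g) \<odot> (h \<odot> k)) =
    ((f \<odot> h) \<odot> (g \<odot> k)) \<cdot> interchange C (Dom C f) (Dom C g) (Dom C h) (Dom C k)"
proof -
  note [simp] = assms
  let ?w = "Dom C f" and ?x = "Dom C g" and ?y = "Dom C h" and ?z = "Dom C k"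
  have "interchange C w x y z \<cdot> ((f \<odot> g) \<odot> (h \<odot> k)) =
     inv_arr C (Ass C (w \<otimes> y) x z) \<cdot> (Ass C w y x \<odot> Ide C z) \<cdot> ((Ide C w \<odot> Sym C x y) \<odot> Ide C z)
     \<cdot> (inv_arr C (Ass C w x y) \<odot> Ide C z) \<cdot> (((f \<odot> g) \<odot> h) \<odot> k) \<cdot> Ass C (?w \<otimes> ?x) ?y ?z"
    by (simp add: interchange_def Ass_nat)
  also have "\<dots> = inv_arr C (Ass C (w \<otimes> y) x z) \<cdot> (Ass C w y x \<odot> Ide C z) \<cdot> (((Ide C w \<odot> Sym C x y)
    \<cdot> (f \<odot> (g \<odot> h))) \<odot> k)
     \<cdot> (inv_arr C (Ass C ?w ?x ?y) \<odot> Ide C ?z) \<cdot> Ass C (?w \<otimes> ?x) ?y ?z"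
    by (simp add: Ass_inv_nat)
  also have "\<dots> = inv_arr C (Ass C (w \<otimes> y) x z) \<cdot> ((Ass C w y x \<cdot> (f \<odot> (h \<odot> g))) \<odot> k)
    \<cdot> ((Ide C ?w \<odot> Sym C ?x ?y) \<odot> Ide C ?z)
     \<cdot> (inv_arr C (Ass C ?w ?x ?y) \<odot> Ide C ?z) \<cdot> Ass C (?w \<otimes> ?x) ?y ?z"
    by (simp add: Sym_nat)
  also have "\<dots> = (inv_arr C (Ass C (w \<otimes> y) x z) \<cdot> (((f \<odot> h) \<odot> g) \<odot> k)) \<cdot> (Ass C ?w ?y ?x \<odot> Ide C ?z)
    \<cdot> ((Ide C ?w \<odot> Sym C ?x ?y) \<odot> Ide C ?z)
     \<cdot> (inv_arr C (Ass C ?w ?x ?y) \<odot> Ide C ?z) \<cdot> Ass C (?w \<otimes> ?x) ?y ?z"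
    by (simp add: Ass_nat)
  also have "\<dots> = ((f \<odot> h) \<odot> (g \<odot> k)) \<cdot> interchange C ?w ?x ?y ?z"
    by (subst Ass_inv_nat) (auto simp: interchange_def)
  finally show ?thesis .
qed

lemma acts_as_interchange_Leaf:
  assumes "w \<in> Obj C" "x \<in> Obj C" "y \<in> Obj C" "z \<in> Obj C"
  shows "acts_as (Node (Node (Leaf w) (Leaf x)) (Node (Leaf y) (Leaf z))) (Node (Node (Leaf w) (Leaf y)) (Node (Leaf x) (Leaf z)))
    (interchange C w x y z) (\<lambda>n. Ide C w \<odot> swap x y (z \<otimes> n))"
  using acts_as_interchange [OF _ _ acts_as_Sym_Leaf, of "Leaf w" "Leaf z" x y] assms by simp

lemma interchange_interchange [simp]:
  assumes [simp]: "w \<in> Obj C" "x \<in> Obj C" "y \<in> Obj C" "z \<in> Obj C"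
  shows "interchange C w x y z \<cdot> interchange C w y x z = Ide C ((w \<otimes> y) \<otimes> (x \<otimes> z))"
  by (rule acts_as_unique [OF
    acts_as_Comp [OF acts_as_interchange_Leaf [of w y x z] acts_as_interchange_Leaf [of w x y z]]
        acts_as_Ide [unfolded ev.simps, of "Node (Node (Leaf w) (Leaf y)) (Node (Leaf x) (Leaf z))", unfolded ev.simps]]) simp_all

text \<open>Strictly, both sides move \<open>y\<close> past \<open>x'\<close> and
  \<open>x''\<close>, and \<open>y'\<close> past \<open>x''\<close>; they differ in the order of the
  moves, which naturality of \<open>swap\<close> settles. This yields the associativity axiom of
  \<open>box_functor\<close>.\<close>

lemma interchange_Ass:
  assumes [simp]: "x \<in> Obj C" "x' \<in> Obj C" "x'' \<in> Obj C" "y \<in> Obj C" "y' \<in> Obj C" "y'' \<in> Obj C"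
  shows "(Ass C x x' x'' \<odot> Ass C y y' y'') \<cdot> interchange C x y (x' \<otimes> x'') (y' \<otimes> y'')
      \<cdot> (Ide C (x \<otimes> y) \<odot> interchange C x' y' x'' y'')
    = interchange C (x \<otimes> x') (y \<otimes> y') x'' y'' \<cdot> (interchange C x y x' y' \<odot> Ide C (x'' \<otimes> y''))
      \<cdot> Ass C (x \<otimes> y) (x' \<otimes> y') (x'' \<otimes> y'')"
proof -
  note l = acts_as_Comp [OF acts_as_Comp [OF
    acts_as_TenA [OF acts_as_Ide [of "Node (Leaf x) (Leaf y)"] acts_as_interchange_Leaf [of x' y' x'' y'']]
     acts_as_interchange [OF _ _
       acts_as_Sym_Node_right [OF acts_as_Sym_Leaf [of y x'] acts_as_Sym_Leaf [of y x'']], of "Leaf x" "Node (Leaf y') (Leaf y'')"]]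
     acts_as_TenA [OF acts_as_Ass [of "Leaf x" "Leaf x'" "Leaf x''"] acts_as_Ass [of "Leaf y" "Leaf y'" "Leaf y''"]]]
  note r = acts_as_Comp [OF
    acts_as_Comp [OF acts_as_Ass [of "Node (Leaf x) (Leaf y)" "Node (Leaf x') (Leaf y')" "Node (Leaf x'') (Leaf y'')"]
     acts_as_TenA [OF acts_as_interchange_Leaf [of x y x' y'] acts_as_Ide [of "Node (Leaf x'') (Leaf y'')"]]]
     acts_as_interchange [OF _ _
       acts_as_Sym_Node_left [OF acts_as_Sym_Leaf [of y x''] acts_as_Sym_Leaf [of y' x'']], of "Node (Leaf x) (Leaf x')" "Leaf y''"]]
  show ?thesis
    by (rule acts_as_unique [OF l [unfolded ev.simps] r [unfolded ev.simps]]) (simp_all add: swap_natural swap_natural_Comp)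
qed

text \<open>Strictly, both sides move \<open>x'\<close> and \<open>x''\<close> past
  \<open>y\<close>, and \<open>x''\<close> past \<open>y'\<close>. This makes the associator of the
  internal hom a monoidal transformation.\<close>

lemma interchange_Ass':
  assumes [simp]: "x \<in> Obj C" "x' \<in> Obj C" "x'' \<in> Obj C" "y \<in> Obj C" "y' \<in> Obj C" "y'' \<in> Obj C"
  shows "Ass C (x \<otimes> y) (x' \<otimes> y') (x'' \<otimes> y'') \<cdot> (Ide C (x \<otimes> y) \<odot> interchange C x' x'' y' y'')
      \<cdot> interchange C x (x' \<otimes> x'') y (y' \<otimes> y'')
    = (interchange C x x' y y' \<odot> Ide C (x'' \<otimes> y'')) \<cdot> interchange C (x \<otimes> x') x'' (y \<otimes> y') y''
      \<cdot> (Ass C x x' x'' \<odot> Ass C y y' y'')"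
proof -
  note l = acts_as_Comp [OF acts_as_Comp [OF 
     acts_as_interchange [OF _ _
       acts_as_Sym_Node_left [OF acts_as_Sym_Leaf [of x' y] acts_as_Sym_Leaf [of x'' y]], of "Leaf x" "Node (Leaf y') (Leaf y'')"]
     acts_as_TenA [OF acts_as_Ide [of "Node (Leaf x) (Leaf y)"] acts_as_interchange_Leaf [of x' x'' y' y'']]]
     acts_as_Ass [of "Node (Leaf x) (Leaf y)" "Node (Leaf x') (Leaf y')" "Node (Leaf x'') (Leaf y'')"]]
  note r = acts_as_Comp [OF acts_as_Comp [OF
    acts_as_TenA [OF acts_as_Ass [of "Leaf x" "Leaf x'" "Leaf x''"] acts_as_Ass [of "Leaf y" "Leaf y'" "Leaf y''"]]
     acts_as_interchange [OF _ _
       acts_as_Sym_Node_right [OF acts_as_Sym_Leaf [of x'' y] acts_as_Sym_Leaf [of x'' y']], of "Node (Leaf x) (Leaf x')" "Leaf y''"]]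
     acts_as_TenA [OF acts_as_interchange_Leaf [of x x' y y'] acts_as_Ide [of "Node (Leaf x'') (Leaf y'')"]]]
  show ?thesis
    by (rule acts_as_unique [OF l [unfolded ev.simps] r [unfolded ev.simps]]) (simp_all add: swap_natural swap_natural_Comp)
qed

text \<open>Read from the right, the four swaps move \<open>x'\<close> past \<open>y\<close> and
  \<open>y'\<close>, then \<open>x\<close> past \<open>y\<close> and \<open>y'\<close>.\<close>

lemma acts_as_Sym_Node_Node:
  assumes "x \<in> Obj C" "x' \<in> Obj C" "y \<in> Obj C" "y' \<in> Obj C"
  shows "acts_as (Node (Node (Leaf x) (Leaf x')) (Node (Leaf y) (Leaf y'))) (Node (Node (Leaf y) (Leaf y')) (Node (Leaf x) (Leaf x')))
    (Sym C (x \<otimes> x') (y \<otimes> y'))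
    (\<lambda>n. (Ide C y \<odot> swap x y' (x' \<otimes> n)) \<cdot> swap x y (y' \<otimes> (x' \<otimes> n)) \<cdot> (Ide C x \<odot> ((Ide C y \<odot> swap x' y' n) \<cdot> swap x' y (y' \<otimes> n))))"
proof -
  note c = acts_as_Sym_Node_left [OF
    acts_as_Sym_Node_right [OF acts_as_Sym_Leaf [of x y] acts_as_Sym_Leaf [of x y']]
      acts_as_Sym_Node_right [OF acts_as_Sym_Leaf [of x' y] acts_as_Sym_Leaf [of x' y']]]
  show ?thesis
    by (rule acts_as_cong [OF c [unfolded ev.simps]]) (use assms in auto)
qed

text \<open>On the right the pair \<open>w\<close>, \<open>z\<close> is exchanged and exchanged
  back, which leaves the three swaps of the left side. This gives the symmetry axiom of
  \<open>box_functor\<close>.\<close>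

lemma interchange_Sym:
  assumes [simp]: "w \<in> Obj C" "x \<in> Obj C" "y \<in> Obj C" "z \<in> Obj C"
  shows "(Sym C w y \<odot> Sym C x z) \<cdot> interchange C w x y z = interchange C y z w x \<cdot> Sym C (w \<otimes> x) (y \<otimes> z)"
proof -
  note l = acts_as_Comp [OF acts_as_interchange_Leaf [of w x y z]
    acts_as_TenA [OF acts_as_Sym_Leaf [of w y] acts_as_Sym_Leaf [of x z]]]
  note r = acts_as_Comp [OF acts_as_Sym_Node_Node [of w x y z] acts_as_interchange_Leaf [of y z w x]]
  show ?thesis
    by (rule acts_as_unique [OF l [unfolded ev.simps] r [unfolded ev.simps]]) (simp_all add: swap_natural swap_natural_Comp)
qed

text \<open>Here it is the pair \<open>x\<close>, \<open>y\<close> that the right side exchanges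
  twice. This makes the symmetry of the internal hom monoidal.\<close>

lemma interchange_Sym':
  assumes [simp]: "w \<in> Obj C" "x \<in> Obj C" "y \<in> Obj C" "z \<in> Obj C"
  shows "interchange C x w z y \<cdot> (Sym C w x \<odot> Sym C y z) = Sym C (w \<otimes> y) (x \<otimes> z) \<cdot> interchange C w x y z"
proof -
  note r = acts_as_Comp [OF acts_as_interchange_Leaf [of w x y z] acts_as_Sym_Node_Node [of w y x z]]
  note l = acts_as_Comp [OF
    acts_as_TenA [OF acts_as_Sym_Leaf [of w x] acts_as_Sym_Leaf [of y z]] acts_as_interchange_Leaf [of x w z y]]
  show ?thesis
    by (rule acts_as_unique [OF l [unfolded ev.simps] r [unfolded ev.simps]]) (simp_all add: swap_natural swap_natural_Comp)
qed

section \<open>Coherence at the unit object\<close>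

lemma Run_UnitO: "Run C (UnitO C) = Lun C (UnitO C)"
  by (rule acts_as_unique [OF acts_as_Run [of Unit, unfolded ev.simps] acts_as_Lun [of Unit, unfolded ev.simps]]) auto

lemma Ass_UnitO: "Ass C (UnitO C) (UnitO C) (UnitO C) \<cdot> (Ide C (UnitO C) \<odot> inv_arr C (Run C (UnitO C)))
  = inv_arr C (Run C (UnitO C)) \<odot> Ide C (UnitO C)"
  by (rule acts_as_unique [OF acts_as_Comp [OF
    acts_as_TenA [OF acts_as_Ide [of Unit] acts_as_Run_inv [of Unit]] acts_as_Ass [of Unit Unit Unit], unfolded ev.simps]
   acts_as_TenA [OF acts_as_Run_inv [of Unit] acts_as_Ide [of Unit], unfolded ev.simps]]) auto

lemma Sym_UnitO: "Sym C (UnitO C) (UnitO C) = Ide C (UnitO C \<otimes> UnitO C)"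
  by (rule acts_as_unique [OF acts_as_Sym_Unit_right [of Unit, unfolded ev.simps] acts_as_Ide [of "Node Unit Unit", unfolded ev.simps]]) auto

text \<open>Gives the right unit axiom of \<open>box_functor\<close>, whose \<open>F0\<close>
  contains the inverse of \<open>Run\<close> at the unit. Strictly all factors are identities, since
  \<open>y\<close> only moves past the unit.\<close>

lemma interchange_Run:
  assumes [simp]: "x \<in> Obj C" "y \<in> Obj C"
  shows "(Run C x \<odot> Run C y) \<cdot> interchange C x y (UnitO C) (UnitO C)
    \<cdot> (Ide C (x \<otimes> y) \<odot> inv_arr C (Run C (UnitO C)))
    = Run C (x \<otimes> y)"
proof -
  note l = acts_as_Comp [OF acts_as_Comp [OF
    acts_as_TenA [OF acts_as_Ide [of "Node (Leaf x) (Leaf y)"] acts_as_Run_inv [of Unit]]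
     acts_as_interchange [OF _ _ acts_as_Sym_Unit_right [of "Leaf y"], of "Leaf x" Unit, unfolded ev.simps]]
     acts_as_TenA [OF acts_as_Run [of "Leaf x"] acts_as_Run [of "Leaf y"]]]
  show ?thesis
    by (rule acts_as_unique [OF l [unfolded ev.simps] acts_as_Run [of "Node (Leaf x) (Leaf y)", unfolded ev.simps]]) simp_all
qed

lemma interchange_Lun:
  assumes [simp]: "x \<in> Obj C" "y \<in> Obj C"
  shows "(Lun C x \<odot> Lun C y) \<cdot> interchange C (UnitO C) (UnitO C) x y
    \<cdot> (inv_arr C (Run C (UnitO C)) \<odot> Ide C (x \<otimes> y))
    = Lun C (x \<otimes> y)"
proof -
  note l = acts_as_Comp [OF acts_as_Comp [OF
    acts_as_TenA [OF acts_as_Run_inv [of Unit] acts_as_Ide [of "Node (Leaf x) (Leaf y)"]]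
     acts_as_interchange [OF _ _ acts_as_Sym_Unit_left [of "Leaf x"], of Unit "Leaf y", unfolded ev.simps]]
     acts_as_TenA [OF acts_as_Lun [of "Leaf x"] acts_as_Lun [of "Leaf y"]]]
  show ?thesis
    by (rule acts_as_unique [OF l [unfolded ev.simps] acts_as_Lun [of "Node (Leaf x) (Leaf y)", unfolded ev.simps]]) simp_all
qed

text \<open>Serves the monoidality of \<open>Run\<close> on the internal hom, where the constraint
  of the unit functor is \<open>Run\<close> at the unit.\<close>

lemma interchange_Run':
  assumes [simp]: "x \<in> Obj C" "y \<in> Obj C"
  shows "Run C (x \<otimes> y) \<cdot> (Ide C (x \<otimes> y) \<odot> Run C (UnitO C)) \<cdot> interchange C x (UnitO C) y (UnitO C)
    = Run C x \<odot> Run C y"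
proof -
  note l = acts_as_Comp [OF acts_as_Comp [OF 
     acts_as_interchange [OF _ _ acts_as_Sym_Unit_left [of "Leaf y"], of "Leaf x" Unit, unfolded ev.simps]
     acts_as_TenA [OF acts_as_Ide [of "Node (Leaf x) (Leaf y)"] acts_as_Run [of Unit]]]
     acts_as_Run [of "Node (Leaf x) (Leaf y)"]]
  show ?thesis
    by (rule acts_as_unique [OF l [unfolded ev.simps]
      acts_as_TenA [OF acts_as_Run [of "Leaf x"] acts_as_Run [of "Leaf y"], unfolded ev.simps]]) simp_all
qed

lemma interchange_Lun':
  assumes [simp]: "x \<in> Obj C" "y \<in> Obj C"
  shows "Lun C (x \<otimes> y) \<cdot> (Run C (UnitO C) \<odot> Ide C (x \<otimes> y)) \<cdot> interchange C (UnitO C) x (UnitO C) y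
    = Lun C x \<odot> Lun C y"
proof -
  note l = acts_as_Comp [OF acts_as_Comp [OF 
     acts_as_interchange [OF _ _ acts_as_Sym_Unit_right [of "Leaf x"], of Unit "Leaf y", unfolded ev.simps]
     acts_as_TenA [OF acts_as_Run [of Unit] acts_as_Ide [of "Node (Leaf x) (Leaf y)"]]]
     acts_as_Lun [of "Node (Leaf x) (Leaf y)"]]
  show ?thesis
    by (rule acts_as_unique [OF l [unfolded ev.simps]
      acts_as_TenA [OF acts_as_Lun [of "Leaf x"] acts_as_Lun [of "Leaf y"], unfolded ev.simps]]) simp_all
qed

end

section \<open>Functors, transformations and the internal hom\<close>

context symmetric_monoidal_functor
begin

lemmas SMF_axioms = symmetric_monoidal_functor_axioms

lemma FO_in_Obj [simp]: "x \<in> Obj A \<Longrightarrow> FO F x \<in> Obj B"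
  using FO_funcset by (auto simp: PiE_iff)

lemma FA_simps [simp]:
  assumes "f \<in> Arr A"
  shows "FA F f \<in> Arr B" "Dom B (FA F f) = FO F (Dom A f)" "Cod B (FA F f) = FO F (Cod A f)"
  using FA_hom [of f] assms by auto

lemma FA_Ide_eq [simp]: "x \<in> Obj A \<Longrightarrow> FA F (Ide A x) = Ide B (FO F x)"
  by (rule FA_Ide)

lemma FA_Comp_eq [simp]:
  "f \<in> Arr A \<Longrightarrow> g \<in> Arr A \<Longrightarrow> Dom A g = Cod A f \<Longrightarrow> FA F (g \<cdot>\<^bsub>A\<^esub> f) = FA F g \<cdot>\<^bsub>B\<^esub> FA F f"
  using FA_Comp [of f _ _ g] by simp

lemma F0_simps [simp]:
  "F0 F \<in> Arr B" "Dom B (F0 F) = UnitO B" "Cod B (F0 F) = FO F (UnitO A)"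
  using F0_hom by auto

lemma F2_simps [simp]:
  assumes "x \<in> Obj A" "y \<in> Obj A"
  shows "F2 F x y \<in> Arr B" "Dom B (F2 F x y) = FO F x \<otimes>\<^bsub>B\<^esub> FO F y" "Cod B (F2 F x y) = FO F (x \<otimes>\<^bsub>A\<^esub> y)"
  using F2_hom [OF assms] by auto

lemma F2_nat:
  assumes "f \<in> Arr A" "g \<in> Arr A" "x = Cod A f" "y = Cod A g"
  shows "F2 F x y \<cdot>\<^bsub>B\<^esub> (FA F f \<odot>\<^bsub>B\<^esub> FA F g) = FA F (f \<odot>\<^bsub>A\<^esub> g) \<cdot>\<^bsub>B\<^esub> F2 F (Dom A f) (Dom A g)"
  using F2_natural [of f _ _ g] assms by simp

lemma iso_FA [simp]:
  assumes "iso A f"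
  shows "iso B (FA F f)" "inv_arr B (FA F f) = FA F (inv_arr A f)"
proof -
  have "f \<in> Arr A" using assms by (rule A.iso_Arr)
  then show "iso B (FA F f)" "inv_arr B (FA F f) = FA F (inv_arr A f)"
    using assms B.isoI [of "FA F f" "FA F (inv_arr A f)"] by (simp_all flip: FA_Comp_eq)
qed

lemma FO_ext: "FO F \<in> extensional (Obj A)"
  using FO_funcset by (auto simp: PiE_iff)

lemma FA_ext: "FA F \<in> extensional (Arr A)"
  using FA_funcset by (auto simp: PiE_iff)

lemma F2_ext: "F2 F \<in> extensional (Obj A)" "x \<in> Obj A \<Longrightarrow> F2 F x \<in> extensional (Obj A)"
  using F2_funcset by (auto simp: PiE_iff)

end

text \<open>Restates the locale with equations for \<open>Dom\<close> and \<open>Cod\<close> in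
  place of membership in \<open>hom\<close>, and with extensionality in place of function sets;
  goals of this shape yield to rewriting.\<close>

lemma symmetric_monoidal_functorI:
  fixes B (structure)
  assumes "symmetric_monoidal_category A" "symmetric_monoidal_category B"
    and "FO F \<in> extensional (Obj A)" "FA F \<in> extensional (Arr A)" "F2 F \<in> extensional (Obj A)"
    and "\<And>x. x \<in> Obj A \<Longrightarrow> F2 F x \<in> extensional (Obj A)"
    and "\<And>x. x \<in> Obj A \<Longrightarrow> FO F x \<in> Obj B"
    and "\<And>f. f \<in> Arr A \<Longrightarrow> FA F f \<in> Arr B"
    and "\<And>f. f \<in> Arr A \<Longrightarrow> Dom B (FA F f) = FO F (Dom A f)"
    and "\<And>f. f \<in> Arr A \<Longrightarrow> Cod B (FA F f) = FO F (Cod A f)"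
    and "\<And>x. x \<in> Obj A \<Longrightarrow> FA F (Ide A x) = Ide B (FO F x)"
    and "\<And>f g. f \<in> Arr A \<Longrightarrow> g \<in> Arr A \<Longrightarrow> Dom A g = Cod A f \<Longrightarrow> FA F (g \<cdot>\<^bsub>A\<^esub> f) = FA F g \<cdot> FA F f"
    and "F0 F \<in> Arr B" "Dom B (F0 F) = UnitO B" "Cod B (F0 F) = FO F (UnitO A)"
    and "\<And>x y. x \<in> Obj A \<Longrightarrow> y \<in> Obj A \<Longrightarrow> F2 F x y \<in> Arr B"
    and "\<And>x y. x \<in> Obj A \<Longrightarrow> y \<in> Obj A \<Longrightarrow> Dom B (F2 F x y) = FO F x \<otimes> FO F y"
    and "\<And>x y. x \<in> Obj A \<Longrightarrow> y \<in> Obj A \<Longrightarrow> Cod B (F2 F x y) = FO F (x \<otimes>\<^bsub>A\<^esub> y)"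
    and "\<And>f g. f \<in> Arr A \<Longrightarrow> g \<in> Arr A \<Longrightarrow> F2 F (Cod A f) (Cod A g) \<cdot> (FA F f \<odot> FA F g) = FA F (f \<odot>\<^bsub>A\<^esub> g)
      \<cdot> F2 F (Dom A f) (Dom A g)"
    and "\<And>x y z. x \<in> Obj A \<Longrightarrow> y \<in> Obj A \<Longrightarrow> z \<in> Obj A \<Longrightarrow> FA F (Ass A x y z) \<cdot> F2 F x (y \<otimes>\<^bsub>A\<^esub> z)
      \<cdot> (Ide B (FO F x) \<odot> F2 F y z)
            = F2 F (x \<otimes>\<^bsub>A\<^esub> y) z \<cdot> (F2 F x y \<odot> Ide B (FO F z)) \<cdot> Ass B (FO F x) (FO F y) (FO F z)"
    and "\<And>x. x \<in> Obj A \<Longrightarrow> FA F (Run A x) \<cdot> F2 F x (UnitO A) \<cdot> (Ide B (FO F x) \<odot> F0 F) = Run B (FO F x)"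
    and "\<And>x. x \<in> Obj A \<Longrightarrow> FA F (Lun A x) \<cdot> F2 F (UnitO A) x \<cdot> (F0 F \<odot> Ide B (FO F x)) = Lun B (FO F x)"
    and "\<And>x y. x \<in> Obj A \<Longrightarrow> y \<in> Obj A \<Longrightarrow> FA F (Sym A x y) \<cdot> F2 F x y = F2 F y x \<cdot> Sym B (FO F x) (FO F y)"
  shows "SMF A B F"
proof -
  interpret A: symmetric_monoidal_category A by fact
  interpret B: symmetric_monoidal_category B by fact
  show ?thesis
    by standard (use assms in \<open>auto simp: PiE_iff\<close>)
qed

lemma smfun_eqI:
  assumes "SMF A B F" "SMF A B G"
    and "\<And>x. x \<in> Obj A \<Longrightarrow> FO F x = FO G x" "\<And>f. f \<in> Arr A \<Longrightarrow> FA F f = FA G f" "F0 F = F0 G"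
    and "\<And>x y. x \<in> Obj A \<Longrightarrow> y \<in> Obj A \<Longrightarrow> F2 F x y = F2 G x y"
  shows "F = G"
proof -
  interpret F: symmetric_monoidal_functor A B F by fact
  interpret G: symmetric_monoidal_functor A B G by fact
  show ?thesis
  proof (rule smfun.equality)
    show "FO F = FO G" by (rule extensionalityI [OF F.FO_ext G.FO_ext]) fact
    show "FA F = FA G" by (rule extensionalityI [OF F.FA_ext G.FA_ext]) fact
    show "F2 F = F2 G"
      by (rule extensionalityI [OF F.F2_ext(1) G.F2_ext(1)], rule extensionalityI [OF F.F2_ext(2) G.F2_ext(2)])
        (use assms in auto)
  qed (use assms in auto)
qed

context monoidal_transformation
begin

lemma Cmp_simps [simp]:
  assumes "x \<in> Obj A"
  shows "Cmp \<sigma> x \<in> Arr B" "Dom B (Cmp \<sigma> x) = FO (Src \<sigma>) x" "Cod B (Cmp \<sigma> x) = FO (Tgt \<sigma>) x"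
  using Cmp_hom [OF assms] by auto

lemma Cmp_nat: "f \<in> Arr A \<Longrightarrow> y = Cod A f \<Longrightarrow> Cmp \<sigma> y \<cdot>\<^bsub>B\<^esub> FA (Src \<sigma>) f = FA (Tgt \<sigma>) f \<cdot>\<^bsub>B\<^esub> Cmp \<sigma> (Dom A f)"
  using Cmp_natural [of f] by simp

lemma Cmp_ext: "Cmp \<sigma> \<in> extensional (Obj A)"
  using Cmp_funcset by (auto simp: PiE_iff)

end

lemma monoidal_transformationI:
  fixes B (structure)
  assumes "SMF A B (Src \<sigma>)" "SMF A B (Tgt \<sigma>)"
    and "Cmp \<sigma> \<in> extensional (Obj A)"
    and "\<And>x. x \<in> Obj A \<Longrightarrow> Cmp \<sigma> x \<in> Arr B"
    and "\<And>x. x \<in> Obj A \<Longrightarrow> Dom B (Cmp \<sigma> x) = FO (Src \<sigma>) x"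
    and "\<And>x. x \<in> Obj A \<Longrightarrow> Cod B (Cmp \<sigma> x) = FO (Tgt \<sigma>) x"
    and "\<And>f. f \<in> Arr A \<Longrightarrow> Cmp \<sigma> (Cod A f) \<cdot> FA (Src \<sigma>) f = FA (Tgt \<sigma>) f \<cdot> Cmp \<sigma> (Dom A f)"
    and "Cmp \<sigma> (UnitO A) \<cdot> F0 (Src \<sigma>) = F0 (Tgt \<sigma>)"
    and "\<And>x y. x \<in> Obj A \<Longrightarrow> y \<in> Obj A \<Longrightarrow> Cmp \<sigma> (x \<otimes>\<^bsub>A\<^esub> y) \<cdot> F2 (Src \<sigma>) x y = F2 (Tgt \<sigma>) x y \<cdot> (Cmp \<sigma> x \<odot> Cmp \<sigma> y)"
  shows "MT A B \<sigma>"
proof -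
  interpret Src: symmetric_monoidal_functor A B "Src \<sigma>" by fact
  interpret Tgt: symmetric_monoidal_functor A B "Tgt \<sigma>" by fact
  show ?thesis
    by standard (use assms in \<open>auto simp: PiE_iff\<close>)
qed

lemma smtrans_eqI:
  assumes "Src \<sigma> = Src \<tau>" "Tgt \<sigma> = Tgt \<tau>" "Cmp \<sigma> \<in> extensional X" "Cmp \<tau> \<in> extensional X"
    and "\<And>x. x \<in> X \<Longrightarrow> Cmp \<sigma> x = Cmp \<tau> x"
  shows "(\<sigma> :: ('o1, 'm1, 'o2, 'm2) smtrans) = \<tau>"
  using assms extensionalityI [OF assms(3,4)] by simp

lemma internal_hom_simps [simp]:
  "Obj \<lbrakk>A, B\<rbrakk> = {F. SMF A B F}"
  "Arr \<lbrakk>A, B\<rbrakk> = {\<sigma>. MT A B \<sigma>}"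
  "Dom \<lbrakk>A, B\<rbrakk> = Src"
  "Cod \<lbrakk>A, B\<rbrakk> = Tgt"
  "UnitO \<lbrakk>A, B\<rbrakk> = unit_functor A B"
  "TenO \<lbrakk>A, B\<rbrakk> = box_functor A B"
  by (simp_all add: internal_hom_def)

lemma internal_hom_Src_Tgt [simp]:
  "Src (Ide \<lbrakk>A, B\<rbrakk> F) = F" "Tgt (Ide \<lbrakk>A, B\<rbrakk> F) = F"
  "Src (\<tau> \<cdot>\<^bsub>\<lbrakk>A, B\<rbrakk>\<^esub> \<sigma>) = Src \<sigma>" "Tgt (\<tau> \<cdot>\<^bsub>\<lbrakk>A, B\<rbrakk>\<^esub> \<sigma>) = Tgt \<tau>"
  "Src (\<sigma> \<odot>\<^bsub>\<lbrakk>A, B\<rbrakk>\<^esub> \<tau>) = box_functor A B (Src \<sigma>) (Src \<tau>)"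
  "Tgt (\<sigma> \<odot>\<^bsub>\<lbrakk>A, B\<rbrakk>\<^esub> \<tau>) = box_functor A B (Tgt \<sigma>) (Tgt \<tau>)"
  "Src (Ass \<lbrakk>A, B\<rbrakk> F G H) = box_functor A B F (box_functor A B G H)"
  "Tgt (Ass \<lbrakk>A, B\<rbrakk> F G H) = box_functor A B (box_functor A B F G) H"
  "Src (Run \<lbrakk>A, B\<rbrakk> F) = box_functor A B F (unit_functor A B)" "Tgt (Run \<lbrakk>A, B\<rbrakk> F) = F"
  "Src (Lun \<lbrakk>A, B\<rbrakk> F) = box_functor A B (unit_functor A B) F" "Tgt (Lun \<lbrakk>A, B\<rbrakk> F) = F"
  "Src (Sym \<lbrakk>A, B\<rbrakk> F G) = box_functor A B F G" "Tgt (Sym \<lbrakk>A, B\<rbrakk> F G) = box_functor A B G F"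
  by (simp_all add: internal_hom_def)

lemma internal_hom_Cmp [simp]:
  assumes "a \<in> Obj A"
  shows "Cmp (Ide \<lbrakk>A, B\<rbrakk> F) a = Ide B (FO F a)"
    "Cmp (\<tau> \<cdot>\<^bsub>\<lbrakk>A, B\<rbrakk>\<^esub> \<sigma>) a = Cmp \<tau> a \<cdot>\<^bsub>B\<^esub> Cmp \<sigma> a"
    "Cmp (\<sigma> \<odot>\<^bsub>\<lbrakk>A, B\<rbrakk>\<^esub> \<tau>) a = Cmp \<sigma> a \<odot>\<^bsub>B\<^esub> Cmp \<tau> a"
    "Cmp (Ass \<lbrakk>A, B\<rbrakk> F G H) a = Ass B (FO F a) (FO G a) (FO H a)"
    "Cmp (Run \<lbrakk>A, B\<rbrakk> F) a = Run B (FO F a)"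
    "Cmp (Lun \<lbrakk>A, B\<rbrakk> F) a = Lun B (FO F a)"
    "Cmp (Sym \<lbrakk>A, B\<rbrakk> F G) a = Sym B (FO F a) (FO G a)"
  using assms by (simp_all add: internal_hom_def)

lemma internal_hom_ext [simp]:
  "Cmp (Ide \<lbrakk>A, B\<rbrakk> F) \<in> extensional (Obj A)"
  "Cmp (\<tau> \<cdot>\<^bsub>\<lbrakk>A, B\<rbrakk>\<^esub> \<sigma>) \<in> extensional (Obj A)"
  "Cmp (\<sigma> \<odot>\<^bsub>\<lbrakk>A, B\<rbrakk>\<^esub> \<tau>) \<in> extensional (Obj A)"
  "Cmp (Ass \<lbrakk>A, B\<rbrakk> F G H) \<in> extensional (Obj A)"
  "Cmp (Run \<lbrakk>A, B\<rbrakk> F) \<in> extensional (Obj A)"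
  "Cmp (Lun \<lbrakk>A, B\<rbrakk> F) \<in> extensional (Obj A)"
  "Cmp (Sym \<lbrakk>A, B\<rbrakk> F G) \<in> extensional (Obj A)"
  by (simp_all add: internal_hom_def)

lemma box_functor_simps [simp]:
  "a \<in> Obj A \<Longrightarrow> FO (box_functor A B F G) a = FO F a \<otimes>\<^bsub>B\<^esub> FO G a"
  "f \<in> Arr A \<Longrightarrow> FA (box_functor A B F G) f = FA F f \<odot>\<^bsub>B\<^esub> FA G f"
  "F0 (box_functor A B F G) = (F0 F \<odot>\<^bsub>B\<^esub> F0 G) \<cdot>\<^bsub>B\<^esub> inv_arr B (Run B (UnitO B))"
  "a \<in> Obj A \<Longrightarrow> b \<in> Obj A \<Longrightarrow> F2 (box_functor A B F G) a b =
    (F2 F a b \<odot>\<^bsub>B\<^esub> F2 G a b) \<cdot>\<^bsub>B\<^esub> interchange B (FO F a) (FO G a) (FO F b) (FO G b)"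
  by (simp_all add: box_functor_def)

lemma unit_functor_simps [simp]:
  "a \<in> Obj A \<Longrightarrow> FO (unit_functor A B) a = UnitO B"
  "f \<in> Arr A \<Longrightarrow> FA (unit_functor A B) f = Ide B (UnitO B)"
  "F0 (unit_functor A B) = Ide B (UnitO B)"
  "a \<in> Obj A \<Longrightarrow> b \<in> Obj A \<Longrightarrow> F2 (unit_functor A B) a b = Run B (UnitO B)"
  by (simp_all add: unit_functor_def)

context symmetric_monoidal_category
begin

text \<open>Associativity of \<open>Run\<close> as a multiplication on the unit object, which is the
  associativity axiom of the constant functor.\<close>

lemma Run_Run_Ass_UnitO:
  "Run C (UnitO C) \<cdot> (Ide C (UnitO C) \<odot> Run C (UnitO C)) =
   Run C (UnitO C) \<cdot> (Run C (UnitO C) \<odot> Ide C (UnitO C)) \<cdot> Ass C (UnitO C) (UnitO C) (UnitO C)"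
  using triangle [of "UnitO C" "UnitO C"] by (simp flip: Run_UnitO)

end

section \<open>Objects, arrows and structure arrows of the internal hom\<close>

lemma unit_functor_SMF:
  assumes "symmetric_monoidal_category A" "symmetric_monoidal_category B"
  shows "SMF A B (unit_functor A B)"
proof -
  interpret A: symmetric_monoidal_category A by fact
  interpret B: symmetric_monoidal_category B by fact
  show ?thesis
    by (rule symmetric_monoidal_functorI)
       (auto simp: assms B.Run_Run_Ass_UnitO [unfolded B.Run_UnitO] B.Run_UnitO B.Sym_UnitO, simp_all add: unit_functor_def)
qed

text \<open>In each axiom naturality of \<open>interchange\<close> brings the structure maps of
  \<open>F\<close> and of \<open>G\<close> together where this is needed, the axiom is applied to
  \<open>F\<close> and \<open>G\<close> side by side, and the remaining canonical arrows agree by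
  the matching interchange equation.\<close>

lemma box_functor_SMF:
  fixes B (structure)
  assumes "SMF A B F" "SMF A B G"
  shows "SMF A B (box_functor A B F G)" (is "SMF A B ?H")
proof -
  interpret F: symmetric_monoidal_functor A B F by fact
  interpret G: symmetric_monoidal_functor A B G by fact
  let ?I = "UnitO A" and ?J = "UnitO B"
  show ?thesis
  proof (rule symmetric_monoidal_functorI)
    fix f g assume [simp]: "f \<in> Arr A" "g \<in> Arr A"
    have "F2 ?H (Cod A f) (Cod A g) \<cdot> (FA ?H f \<odot> FA ?H g)
      = (F2 F (Cod A f) (Cod A g) \<odot> F2 G (Cod A f) (Cod A g)) \<cdot> ((FA F f \<odot> FA F g) \<odot> (FA G f \<odot> FA G g))
       \<cdot> interchange B (FO F (Dom A f)) (FO G (Dom A f)) (FO F (Dom A g)) (FO G (Dom A g))" (is "?lhs = _")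
      by (simp add: F.B.interchange_natural)
    also have "\<dots> = FA ?H (f \<odot>\<^bsub>A\<^esub> g) \<cdot> F2 ?H (Dom A f) (Dom A g)"
      by (simp add: F.F2_nat G.F2_nat)
    finally show "?lhs = \<dots>" .
  next
    fix x y z assume [simp]: "x \<in> Obj A" "y \<in> Obj A" "z \<in> Obj A"
    let ?a = "FO F x" and ?a' = "FO G x" and ?b = "FO F y" and ?b' = "FO G y" and ?c = "FO F z"
      and ?c' = "FO G z"
      and ?m = "interchange B"
    have "FA ?H (Ass A x y z) \<cdot> F2 ?H x (y \<otimes>\<^bsub>A\<^esub> z) \<cdot> (Ide B (FO ?H x) \<odot> F2 ?H y z)
      = ((FA F (Ass A x y z) \<cdot> F2 F x (y \<otimes>\<^bsub>A\<^esub> z)) \<odot> (FA G (Ass A x y z) \<cdot> F2 G x (y \<otimes>\<^bsub>A\<^esub> z)))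
       \<cdot> (?m ?a ?a' (FO F (y \<otimes>\<^bsub>A\<^esub> z)) (FO G (y \<otimes>\<^bsub>A\<^esub> z))
       \<cdot> ((Ide B ?a \<odot> Ide B ?a') \<odot> (F2 F y z \<odot> F2 G y z)))
       \<cdot> (Ide B (?a \<otimes> ?a') \<odot> ?m ?b ?b' ?c ?c')" (is "?lhs = _")
      by simp
    also have "\<dots> = ((FA F (Ass A x y z) \<cdot> F2 F x (y \<otimes>\<^bsub>A\<^esub> z)
      \<cdot> (Ide B ?a \<odot> F2 F y z)) \<odot> (FA G (Ass A x y z) \<cdot> F2 G x (y \<otimes>\<^bsub>A\<^esub> z) \<cdot> (Ide B ?a' \<odot> F2 G y z)))
       \<cdot> ?m ?a ?a' (?b \<otimes> ?c) (?b' \<otimes> ?c')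
       \<cdot> (Ide B (?a \<otimes> ?a') \<odot> ?m ?b ?b' ?c ?c')"
      by (subst F.B.interchange_natural) auto
    also have "\<dots> = ((F2 F (x \<otimes>\<^bsub>A\<^esub> y) z \<cdot> (F2 F x y \<odot> Ide B ?c)) \<odot> (F2 G (x \<otimes>\<^bsub>A\<^esub> y) z \<cdot> (F2 G x y \<odot> Ide B ?c')))
       \<cdot> ((Ass B ?a ?b ?c \<odot> Ass B ?a' ?b' ?c')
       \<cdot> ?m ?a ?a' (?b \<otimes> ?c) (?b' \<otimes> ?c')
       \<cdot> (Ide B (?a \<otimes> ?a') \<odot> ?m ?b ?b' ?c ?c'))"
      by (simp add: F.F2_Ass G.F2_Ass)
    also have "\<dots> = (F2 F (x \<otimes>\<^bsub>A\<^esub> y) z \<odot> F2 G (x \<otimes>\<^bsub>A\<^esub> y) z)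
       \<cdot> (((F2 F x y \<odot> Ide B ?c) \<odot> (F2 G x y \<odot> Ide B ?c'))
         \<cdot> ?m (?a \<otimes> ?b) (?a' \<otimes> ?b') ?c ?c')
       \<cdot> (?m ?a ?a' ?b ?b' \<odot> Ide B (?c \<otimes> ?c'))
       \<cdot> Ass B (?a \<otimes> ?a') (?b \<otimes> ?b') (?c \<otimes> ?c')"
      by (subst F.B.interchange_Ass) auto
    also have "\<dots> = (F2 F (x \<otimes>\<^bsub>A\<^esub> y) z \<odot> F2 G (x \<otimes>\<^bsub>A\<^esub> y) z)
       \<cdot> (?m (FO F (x \<otimes>\<^bsub>A\<^esub> y)) (FO G (x \<otimes>\<^bsub>A\<^esub> y)) ?c ?c'
         \<cdot> ((F2 F x y \<odot> F2 G x y) \<odot> (Ide B ?c \<odot> Ide B ?c')))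
       \<cdot> (?m ?a ?a' ?b ?b' \<odot> Ide B (?c \<otimes> ?c'))
       \<cdot> Ass B (?a \<otimes> ?a') (?b \<otimes> ?b') (?c \<otimes> ?c')"
      by (subst F.B.interchange_natural) auto
    also have "\<dots> = F2 ?H (x \<otimes>\<^bsub>A\<^esub> y) z \<cdot> (F2 ?H x y \<odot> Ide B (FO ?H z)) \<cdot> Ass B (FO ?H x) (FO ?H y) (FO ?H z)"
      by simp
    finally show "?lhs = \<dots>" .
  next
    fix x assume [simp]: "x \<in> Obj A"
    let ?a = "FO F x" and ?a' = "FO G x"
      and ?m = "interchange B"
    have "FA ?H (Run A x) \<cdot> F2 ?H x ?I \<cdot> (Ide B (FO ?H x) \<odot> F0 ?H)
       = ((FA F (Run A x) \<cdot> F2 F x ?I) \<odot> (FA G (Run A x) \<cdot> F2 G x ?I))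
       \<cdot> (?m ?a ?a' (FO F ?I) (FO G ?I) \<cdot> ((Ide B ?a \<odot> Ide B ?a') \<odot> (F0 F \<odot> F0 G)))
       \<cdot> (Ide B (?a \<otimes> ?a') \<odot> inv_arr B (Run B ?J))" (is "?lhs = _")
      by simp
    also have "\<dots> = ((FA F (Run A x) \<cdot> F2 F x ?I \<cdot> (Ide B ?a \<odot> F0 F)) \<odot> (FA G (Run A x) \<cdot> F2 G x ?I
      \<cdot> (Ide B ?a' \<odot> F0 G)))
       \<cdot> ?m ?a ?a' ?J ?J \<cdot> (Ide B (?a \<otimes> ?a') \<odot> inv_arr B (Run B ?J))"
      by (subst F.B.interchange_natural) auto
    also have "\<dots> = Run B (FO ?H x)"
      by (simp add: F.F2_Run G.F2_Run F.B.interchange_Run)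
    finally show "?lhs = \<dots>" .
    have "FA ?H (Lun A x) \<cdot> F2 ?H ?I x \<cdot> (F0 ?H \<odot> Ide B (FO ?H x))
       = ((FA F (Lun A x) \<cdot> F2 F ?I x) \<odot> (FA G (Lun A x) \<cdot> F2 G ?I x))
       \<cdot> (?m (FO F ?I) (FO G ?I) ?a ?a' \<cdot> ((F0 F \<odot> F0 G) \<odot> (Ide B ?a \<odot> Ide B ?a')))
       \<cdot> (inv_arr B (Run B ?J) \<odot> Ide B (?a \<otimes> ?a'))" (is "?lhs = _")
      by simp
    also have "\<dots> = ((FA F (Lun A x) \<cdot> F2 F ?I x \<cdot> (F0 F \<odot> Ide B ?a)) \<odot> (FA G (Lun A x) \<cdot> F2 G ?I x
      \<cdot> (F0 G \<odot> Ide B ?a')))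
       \<cdot> ?m ?J ?J ?a ?a' \<cdot> (inv_arr B (Run B ?J) \<odot> Ide B (?a \<otimes> ?a'))"
      by (subst F.B.interchange_natural) auto
    also have "\<dots> = Lun B (FO ?H x)"
      by (simp add: F.F2_Lun G.F2_Lun F.B.interchange_Lun)
    finally show "?lhs = \<dots>" .
  next
    fix x y assume [simp]: "x \<in> Obj A" "y \<in> Obj A"
    let ?a = "FO F x" and ?a' = "FO G x" and ?b = "FO F y" and ?b' = "FO G y"
      and ?m = "interchange B"
    have "FA ?H (Sym A x y) \<cdot> F2 ?H x y = ((FA F (Sym A x y) \<cdot> F2 F x y) \<odot> (FA G (Sym A x y) \<cdot> F2 G x y))
      \<cdot> ?m ?a ?a' ?b ?b'" (is "?lhs = _")
      by simp
    also have "\<dots> = (F2 F y x \<odot> F2 G y x) \<cdot> ((Sym B ?a ?b \<odot> Sym B ?a' ?b') \<cdot> ?m ?a ?a' ?b ?b')"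
      by (simp add: F.F2_Sym G.F2_Sym)
    also have "\<dots> = F2 ?H y x \<cdot> Sym B (FO ?H x) (FO ?H y)"
      by (subst F.B.interchange_Sym) auto
    finally show "?lhs = \<dots>" .
  qed (auto intro: F.A.SMC_axioms F.B.SMC_axioms, simp_all add: box_functor_def)
qed


lemma Ide_MT:
  assumes "SMF A B F"
  shows "MT A B (Ide \<lbrakk>A, B\<rbrakk> F)"
proof -
  interpret F: symmetric_monoidal_functor A B F by fact
  show ?thesis by (rule monoidal_transformationI) (auto simp: assms)
qed

lemma Comp_MT:
  fixes B (structure)
  assumes "MT A B \<sigma>" "MT A B \<tau>" and eq: "Src \<tau> = Tgt \<sigma>"
  shows "MT A B (\<tau> \<cdot>\<^bsub>\<lbrakk>A, B\<rbrakk>\<^esub> \<sigma>)" (is "MT _ _ ?\<sigma>")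
proof -
  interpret S: monoidal_transformation A B \<sigma> by fact
  interpret T: monoidal_transformation A B \<tau> by fact
  note [simp] = eq
  show ?thesis
  proof (rule monoidal_transformationI)
    fix f assume [simp]: "f \<in> Arr A"
    show "Cmp ?\<sigma> (Cod A f) \<cdot> FA (Src ?\<sigma>) f = FA (Tgt ?\<sigma>) f \<cdot> Cmp ?\<sigma> (Dom A f)"
      using S.Src.B.Comp_reassoc [OF T.Cmp_nat [of f "Cod A f", unfolded eq], of "Cmp \<sigma> (Dom A f)"]
        by (simp add: S.Cmp_nat)
  next
    show "Cmp ?\<sigma> (UnitO A) \<cdot> F0 (Src ?\<sigma>) = F0 (Tgt ?\<sigma>)"
      using T.Cmp_F0 by (simp add: S.Cmp_F0)
  next
    fix x y assume [simp]: "x \<in> Obj A" "y \<in> Obj A"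
    show "Cmp ?\<sigma> (x \<otimes>\<^bsub>A\<^esub> y) \<cdot> F2 (Src ?\<sigma>) x y =
       F2 (Tgt ?\<sigma>) x y \<cdot> (Cmp ?\<sigma> x \<odot> Cmp ?\<sigma> y)"
      using S.Src.B.Comp_reassoc [OF T.Cmp_F2 [of x y, unfolded eq], of "Cmp \<sigma> x \<odot> Cmp \<sigma> y"]
        by (simp add: S.Cmp_F2)
  qed (auto simp: S.Src.SMF_axioms T.Tgt.SMF_axioms)
qed

lemma TenA_MT:
  fixes B (structure)
  assumes "MT A B \<sigma>" "MT A B \<tau>"
  shows "MT A B (\<sigma> \<odot>\<^bsub>\<lbrakk>A, B\<rbrakk>\<^esub> \<tau>)" (is "MT _ _ ?\<sigma>")
proof -
  interpret S: monoidal_transformation A B \<sigma> by fact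
  interpret T: monoidal_transformation A B \<tau> by fact
  show ?thesis
  proof (rule monoidal_transformationI)
    fix x y assume [simp]: "x \<in> Obj A" "y \<in> Obj A"
    show "Cmp ?\<sigma> (x \<otimes>\<^bsub>A\<^esub> y) \<cdot> F2 (Src ?\<sigma>) x y =
       F2 (Tgt ?\<sigma>) x y \<cdot> (Cmp ?\<sigma> x \<odot> Cmp ?\<sigma> y)"
      by (simp add: S.Cmp_F2 T.Cmp_F2 S.Src.B.interchange_natural)
  qed (auto intro!: box_functor_SMF simp: S.Src.SMF_axioms T.Tgt.SMF_axioms
      T.Src.SMF_axioms S.Tgt.SMF_axioms S.Cmp_nat T.Cmp_nat S.Cmp_F0 T.Cmp_F0)
qed

lemma Sym_MT:
  fixes B (structure)
  assumes "SMF A B F" "SMF A B G"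
  shows "MT A B (Sym \<lbrakk>A, B\<rbrakk> F G)" (is "MT _ _ ?\<sigma>")
proof -
  interpret F: symmetric_monoidal_functor A B F by fact
  interpret G: symmetric_monoidal_functor A B G by fact
  show ?thesis
  proof (rule monoidal_transformationI)
    show "Cmp ?\<sigma> (UnitO A) \<cdot> F0 (Src ?\<sigma>) = F0 (Tgt ?\<sigma>)"
      using F.B.Comp_reassoc [OF F.B.Sym_nat [of "F0 F" "F0 G"], of _ _ "inv_arr B (Run B (UnitO B))"]
      by (simp add: F.B.Sym_UnitO)
  next
    fix x y assume [simp]: "x \<in> Obj A" "y \<in> Obj A"
    show "Cmp ?\<sigma> (x \<otimes>\<^bsub>A\<^esub> y) \<cdot> F2 (Src ?\<sigma>) x y =
      F2 (Tgt ?\<sigma>) x y \<cdot> (Cmp ?\<sigma> x \<odot> Cmp ?\<sigma> y)"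
      using F.B.Comp_reassoc [OF F.B.Sym_nat [of "F2 F x y" "F2 G x y"], of _ _ "interchange B (FO F x) (FO G x) (FO F y) (FO G y)"]
      by (simp add: F.B.interchange_Sym')
  qed (auto intro!: box_functor_SMF simp: assms F.B.Sym_nat)
qed

lemma Run_MT:
  fixes B (structure)
  assumes "SMF A B F"
  shows "MT A B (Run \<lbrakk>A, B\<rbrakk> F)" (is "MT _ _ ?\<sigma>")
proof -
  interpret F: symmetric_monoidal_functor A B F by fact
  show ?thesis
  proof (rule monoidal_transformationI)
    show "Cmp ?\<sigma> (UnitO A) \<cdot> F0 (Src ?\<sigma>) = F0 (Tgt ?\<sigma>)"
      using F.B.Comp_reassoc [OF F.B.Run_nat [of "F0 F"], of _ "inv_arr B (Run B (UnitO B))"] by simp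
  next
    fix x y assume [simp]: "x \<in> Obj A" "y \<in> Obj A"
    have "Cmp ?\<sigma> (x \<otimes>\<^bsub>A\<^esub> y) \<cdot> F2 (Src ?\<sigma>) x y =
      (Run B (FO F (x \<otimes>\<^bsub>A\<^esub> y)) \<cdot> (F2 F x y \<odot> Ide B (UnitO B))) \<cdot> (Ide B (FO F x \<otimes> FO F y) \<odot> Run B (UnitO B)) \<cdot> interchange B (FO F x) (UnitO B) (FO F y) (UnitO B)" (is "?lhs = _")
      by simp
    also have "\<dots> = F2 (Tgt ?\<sigma>) x y \<cdot> (Cmp ?\<sigma> x \<odot> Cmp ?\<sigma> y)"
      by (subst F.B.Run_nat) (auto simp: F.B.interchange_Run')
    finally show "?lhs = \<dots>" .
  qed (auto intro!: box_functor_SMF unit_functor_SMF simp: assms F.B.Run_nat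
       F.A.SMC_axioms F.B.SMC_axioms)
qed

lemma Lun_MT:
  fixes B (structure)
  assumes "SMF A B F"
  shows "MT A B (Lun \<lbrakk>A, B\<rbrakk> F)" (is "MT _ _ ?\<sigma>")
proof -
  interpret F: symmetric_monoidal_functor A B F by fact
  show ?thesis
  proof (rule monoidal_transformationI)
    show "Cmp ?\<sigma> (UnitO A) \<cdot> F0 (Src ?\<sigma>) = F0 (Tgt ?\<sigma>)"
      using F.B.Comp_reassoc [OF F.B.Lun_nat [of "F0 F"], of _ "inv_arr B (Lun B (UnitO B))"]
        by (simp add: F.B.Run_UnitO)
  next
    fix x y assume [simp]: "x \<in> Obj A" "y \<in> Obj A"
    have "Cmp ?\<sigma> (x \<otimes>\<^bsub>A\<^esub> y) \<cdot> F2 (Src ?\<sigma>) x y =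
      (Lun B (FO F (x \<otimes>\<^bsub>A\<^esub> y)) \<cdot> (Ide B (UnitO B) \<odot> F2 F x y)) \<cdot> (Run B (UnitO B) \<odot> Ide B (FO F x \<otimes> FO F y)) \<cdot> interchange B (UnitO B) (FO F x) (UnitO B) (FO F y)" (is "?lhs = _")
      by simp
    also have "\<dots> = F2 (Tgt ?\<sigma>) x y \<cdot> (Cmp ?\<sigma> x \<odot> Cmp ?\<sigma> y)"
      by (subst F.B.Lun_nat) (auto simp: F.B.interchange_Lun')
    finally show "?lhs = \<dots>" .
  qed (auto intro!: box_functor_SMF unit_functor_SMF simp: assms F.B.Lun_nat
       F.A.SMC_axioms F.B.SMC_axioms)
qed

lemma Ass_MT:
  fixes B (structure)
  assumes "SMF A B F" "SMF A B G" "SMF A B H"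
  shows "MT A B (Ass \<lbrakk>A, B\<rbrakk> F G H)" (is "MT _ _ ?\<sigma>")
proof -
  interpret F: symmetric_monoidal_functor A B F by fact
  interpret G: symmetric_monoidal_functor A B G by fact
  interpret H: symmetric_monoidal_functor A B H by fact
  let ?I = "UnitO B" and ?r = "inv_arr B (Run B (UnitO B))"
  show ?thesis
  proof (rule monoidal_transformationI)
    have "Cmp ?\<sigma> (UnitO A) \<cdot> F0 (Src ?\<sigma>)
      = (Ass B (FO F (UnitO A)) (FO G (UnitO A)) (FO H (UnitO A)) \<cdot> (F0 F \<odot> (F0 G \<odot> F0 H))) \<cdot> (Ide B ?I \<odot> ?r) \<cdot> ?r" (is "?lhs = _")
      by simp
    also have "\<dots> = ((F0 F \<odot> F0 G) \<odot> F0 H) \<cdot> (Ass B ?I ?I ?I \<cdot> (Ide B ?I \<odot> ?r)) \<cdot> ?r"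
      by (subst F.B.Ass_nat) auto
    also have "\<dots> = F0 (Tgt ?\<sigma>)"
      by (subst F.B.Ass_UnitO) auto
    finally show "?lhs = \<dots>" .
  next
    fix x y assume [simp]: "x \<in> Obj A" "y \<in> Obj A"
    let ?a = "FO F x" and ?b = "FO G x" and ?c = "FO H x" and ?a' = "FO F y" and ?b' = "FO G y"
      and ?c' = "FO H y"
    have "Cmp ?\<sigma> (x \<otimes>\<^bsub>A\<^esub> y) \<cdot> F2 (Src ?\<sigma>) x y
      = (Ass B (FO F (x \<otimes>\<^bsub>A\<^esub> y)) (FO G (x \<otimes>\<^bsub>A\<^esub> y)) (FO H (x \<otimes>\<^bsub>A\<^esub> y)) \<cdot> (F2 F x y \<odot> (F2 G x y \<odot> F2 H x y)))
        \<cdot> (Ide B (?a \<otimes> ?a') \<odot> interchange B ?b ?c ?b' ?c') \<cdot>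
        interchange B ?a (?b \<otimes> ?c) ?a' (?b' \<otimes> ?c')" (is "?lhs = _")
      by simp
    also have "\<dots> = ((F2 F x y \<odot> F2 G x y) \<odot> F2 H x y) \<cdot> (Ass B (?a \<otimes> ?a') (?b \<otimes> ?b') (?c \<otimes> ?c')
        \<cdot> (Ide B (?a \<otimes> ?a') \<odot> interchange B ?b ?c ?b' ?c') \<cdot> interchange B ?a (?b \<otimes> ?c) ?a' (?b' \<otimes> ?c'))"
      by (subst F.B.Ass_nat) auto
    also have "\<dots> = F2 (Tgt ?\<sigma>) x y \<cdot> (Cmp ?\<sigma> x \<odot> Cmp ?\<sigma> y)"
      by (subst F.B.interchange_Ass') auto
    finally show "?lhs = \<dots>" .
  qed (auto intro!: box_functor_SMF simp: assms F.B.Ass_nat)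
qed

text \<open>Componentwise inverses inherit naturality and the two monoidal equations by conjugation,
  so they form an arrow of the internal hom.\<close>

lemma iso_pointwise:
  fixes B (structure)
  assumes "MT A B \<sigma>" and iso: "\<And>x. x \<in> Obj A \<Longrightarrow> iso B (Cmp \<sigma> x)"
  shows "iso \<lbrakk>A, B\<rbrakk> \<sigma>"
proof -
  interpret S: monoidal_transformation A B \<sigma> by fact
  note [simp] = iso
  define \<tau> where "\<tau> = \<lparr>Src = Tgt \<sigma>, Tgt = Src \<sigma>, Cmp = \<lambda>x\<in>Obj A. inv_arr B (Cmp \<sigma> x)\<rparr>"
  have [simp]: "Src \<tau> = Tgt \<sigma>" "Tgt \<tau> = Src \<sigma>" "\<And>x. x \<in> Obj A \<Longrightarrow> Cmp \<tau> x = inv_arr B (Cmp \<sigma> x)"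
    by (simp_all add: \<tau>_def)
  have "MT A B \<tau>"
  proof (rule monoidal_transformationI)
    fix f assume [simp]: "f \<in> Arr A"
    have "Cmp \<tau> (Cod A f) \<cdot> FA (Src \<tau>) f = inv_arr B (Cmp \<sigma> (Cod A f)) \<cdot> (FA (Tgt \<sigma>) f
      \<cdot> Cmp \<sigma> (Dom A f)) \<cdot> inv_arr B (Cmp \<sigma> (Dom A f))" (is "?lhs = _")
      by simp
    also have "\<dots> = FA (Tgt \<tau>) f \<cdot> Cmp \<tau> (Dom A f)"
      by (subst S.Cmp_nat [symmetric]) auto
    finally show "?lhs = \<dots>" .
  next
    show "Cmp \<tau> (UnitO A) \<cdot> F0 (Src \<tau>) = F0 (Tgt \<tau>)"
      by (simp flip: S.Cmp_F0)
  next
    fix x y assume [simp]: "x \<in> Obj A" "y \<in> Obj A"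
    have "Cmp \<tau> (x \<otimes>\<^bsub>A\<^esub> y) \<cdot> F2 (Src \<tau>) x y = inv_arr B (Cmp \<sigma> (x \<otimes>\<^bsub>A\<^esub> y)) \<cdot> (F2 (Tgt \<sigma>) x y
      \<cdot> (Cmp \<sigma> x \<odot> Cmp \<sigma> y)) \<cdot> (Cmp \<tau> x \<odot> Cmp \<tau> y)" (is "?lhs = _")
      by simp
    also have "\<dots> = F2 (Tgt \<tau>) x y \<cdot> (Cmp \<tau> x \<odot> Cmp \<tau> y)"
      by (subst S.Cmp_F2 [symmetric]) auto
    finally show "?lhs = \<dots>" .
  qed (auto simp: S.Tgt.SMF_axioms S.Src.SMF_axioms, simp add: \<tau>_def)
  moreover have "\<tau> \<cdot>\<^bsub>\<lbrakk>A, B\<rbrakk>\<^esub> \<sigma> = Ide \<lbrakk>A, B\<rbrakk> (Src \<sigma>)" "\<sigma> \<cdot>\<^bsub>\<lbrakk>A, B\<rbrakk>\<^esub> \<tau> = Ide \<lbrakk>A, B\<rbrakk> (Tgt \<sigma>)"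
    by (rule smtrans_eqI [where X = "Obj A"]; simp)+
  ultimately have "is_inverse \<lbrakk>A, B\<rbrakk> \<sigma> \<tau>"
    using assms(1) by (simp add: is_inverse_def)
  then show ?thesis unfolding iso_def by blast
qed

lemma monoidal_transformation_SMF:
  "MT A B \<sigma> \<Longrightarrow> SMF A B (Src \<sigma>)"
  "MT A B \<sigma> \<Longrightarrow> SMF A B (Tgt \<sigma>)"
  by (simp_all add: monoidal_transformation_def)

text \<open>The equations hold because they hold in \<open>B\<close> at every component. The content
  lies in the closure lemmas above: the tensor of functors is a functor, and the structure arrows
  are monoidal transformations.\<close>

theorem internal_hom_SMC:
  assumes "symmetric_monoidal_category A" "symmetric_monoidal_category B"
  shows "symmetric_monoidal_category \<lbrakk>A, B\<rbrakk>"
proof -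
  interpret A: symmetric_monoidal_category A by fact
  interpret B: symmetric_monoidal_category B by fact
  note SMF_intros = box_functor_SMF unit_functor_SMF [OF assms]
  show ?thesis
    by unfold_locales
       (auto intro!: smtrans_eqI [where X = "Obj A"] SMF_intros Ide_MT Comp_MT TenA_MT Ass_MT Run_MT Lun_MT Sym_MT iso_pointwise
         monoidal_transformation.Cmp_ext
         simp: monoidal_transformation.Cmp_simps [of A B] symmetric_monoidal_functor.FO_in_Obj [of A B]
          monoidal_transformation_SMF B.Ass_nat B.Run_nat B.Lun_nat B.Sym_nat B.triangle B.Lun_Sym
           B.pentagon B.hexagon)
qed

section \<open>Composition, whiskering and postcomposition\<close>

lemma comp_functor_simps [simp]:
  "x \<in> Obj A \<Longrightarrow> FO (comp_functor A C G F) x = FO G (FO F x)"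
  "f \<in> Arr A \<Longrightarrow> FA (comp_functor A C G F) f = FA G (FA F f)"
  "F0 (comp_functor A C G F) = FA G (F0 F) \<cdot>\<^bsub>C\<^esub> F0 G"
  "x \<in> Obj A \<Longrightarrow> y \<in> Obj A \<Longrightarrow> F2 (comp_functor A C G F) x y = FA G (F2 F x y) \<cdot>\<^bsub>C\<^esub> F2 G (FO F x) (FO F y)"
  by (simp_all add: comp_functor_def)

text \<open>Naturality of the constraints of \<open>G\<close> collects those of \<open>F\<close>
  under \<open>G\<close>; then the axiom for \<open>F\<close> is applied inside \<open>G\<close> and
  the axiom for \<open>G\<close> outside.\<close>

lemma comp_functor_SMF:
  fixes C (structure)
  assumes "SMF A B F" "SMF B C G"
  shows "SMF A C (comp_functor A C G F)" (is "SMF A C ?H")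
proof -
  interpret F: symmetric_monoidal_functor A B F by fact
  interpret G: symmetric_monoidal_functor B C G by fact
  show ?thesis
  proof (rule symmetric_monoidal_functorI)
    fix f g assume [simp]: "f \<in> Arr A" "g \<in> Arr A"
    have "F2 ?H (Cod A f) (Cod A g) \<cdot> (FA ?H f \<odot> FA ?H g)
      = FA G (F2 F (Cod A f) (Cod A g) \<cdot>\<^bsub>B\<^esub> (FA F f \<odot>\<^bsub>B\<^esub> FA F g)) \<cdot> F2 G (FO F (Dom A f)) (FO F (Dom A g))" (is "?lhs = _")
      by (simp add: G.F2_nat)
    also have "\<dots> = FA ?H (f \<odot>\<^bsub>A\<^esub> g) \<cdot> F2 ?H (Dom A f) (Dom A g)"
      by (subst F.F2_nat) auto
    finally show "?lhs = \<dots>" .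
  next
    fix x y z assume [simp]: "x \<in> Obj A" "y \<in> Obj A" "z \<in> Obj A"
    let ?x = "FO F x" and ?y = "FO F y" and ?z = "FO F z"
    have "FA ?H (Ass A x y z) \<cdot> F2 ?H x (y \<otimes>\<^bsub>A\<^esub> z) \<cdot> (Ide C (FO ?H x) \<odot> F2 ?H y z)
      = FA G (FA F (Ass A x y z) \<cdot>\<^bsub>B\<^esub> F2 F x (y \<otimes>\<^bsub>A\<^esub> z)) \<cdot> (F2 G ?x (FO F (y \<otimes>\<^bsub>A\<^esub> z)) \<cdot> (FA G (Ide B ?x) \<odot> FA G (F2 F y z))) \<cdot> (Ide C (FO G ?x) \<odot> F2 G ?y ?z)" (is "?lhs = _")
      by simp
    also have "\<dots> = FA G (FA F (Ass A x y z) \<cdot>\<^bsub>B\<^esub> F2 F x (y \<otimes>\<^bsub>A\<^esub> z) \<cdot>\<^bsub>B\<^esub> (Ide B ?x \<odot>\<^bsub>B\<^esub> F2 F y z))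
      \<cdot> F2 G ?x (?y \<otimes>\<^bsub>B\<^esub> ?z) \<cdot> (Ide C (FO G ?x) \<odot> F2 G ?y ?z)"
      by (subst G.F2_nat) auto
    also have "\<dots> = FA G (F2 F (x \<otimes>\<^bsub>A\<^esub> y) z) \<cdot> FA G (F2 F x y \<odot>\<^bsub>B\<^esub> Ide B ?z) \<cdot> (FA G (Ass B ?x ?y ?z)
      \<cdot> F2 G ?x (?y \<otimes>\<^bsub>B\<^esub> ?z) \<cdot> (Ide C (FO G ?x) \<odot> F2 G ?y ?z))"
      by (subst F.F2_Ass) auto
    also have "\<dots> = FA G (F2 F (x \<otimes>\<^bsub>A\<^esub> y) z) \<cdot> (FA G (F2 F x y \<odot>\<^bsub>B\<^esub> Ide B ?z) \<cdot> F2 G (?x \<otimes>\<^bsub>B\<^esub> ?y) ?z)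
      \<cdot> (F2 G ?x ?y \<odot> Ide C (FO G ?z)) \<cdot> Ass C (FO G ?x) (FO G ?y) (FO G ?z)"
      by (subst G.F2_Ass) auto
    also have "\<dots> = FA G (F2 F (x \<otimes>\<^bsub>A\<^esub> y) z) \<cdot> (F2 G (FO F (x \<otimes>\<^bsub>A\<^esub> y)) ?z
      \<cdot> (FA G (F2 F x y) \<odot> FA G (Ide B ?z))) \<cdot> (F2 G ?x ?y \<odot> Ide C (FO G ?z)) \<cdot> Ass C (FO G ?x) (FO G ?y) (FO G ?z)"
      by (subst G.F2_nat) auto
    also have "\<dots> = F2 ?H (x \<otimes>\<^bsub>A\<^esub> y) z \<cdot> (F2 ?H x y \<odot> Ide C (FO ?H z)) \<cdot> Ass C (FO ?H x) (FO ?H y) (FO ?H z)"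
      by simp
    finally show "?lhs = \<dots>" .
  next
    fix x assume [simp]: "x \<in> Obj A"
    let ?I = "UnitO A" and ?x = "FO F x"
    have "FA ?H (Run A x) \<cdot> F2 ?H x ?I \<cdot> (Ide C (FO ?H x) \<odot> F0 ?H)
       = FA G (FA F (Run A x) \<cdot>\<^bsub>B\<^esub> F2 F x ?I) \<cdot> (F2 G ?x (FO F ?I) \<cdot> (FA G (Ide B ?x) \<odot> FA G (F0 F))) \<cdot> (Ide C (FO G ?x) \<odot> F0 G)" (is "?lhs = _")
      by simp
    also have "\<dots> = FA G (FA F (Run A x) \<cdot>\<^bsub>B\<^esub> F2 F x ?I \<cdot>\<^bsub>B\<^esub> (Ide B ?x \<odot>\<^bsub>B\<^esub> F0 F)) \<cdot> F2 G ?x (UnitO B)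
      \<cdot> (Ide C (FO G ?x) \<odot> F0 G)"
      by (subst G.F2_nat) auto
    also have "\<dots> = Run C (FO ?H x)"
      by (subst F.F2_Run) (auto simp: G.F2_Run)
    finally show "?lhs = \<dots>" .
    have "FA ?H (Lun A x) \<cdot> F2 ?H ?I x \<cdot> (F0 ?H \<odot> Ide C (FO ?H x))
       = FA G (FA F (Lun A x) \<cdot>\<^bsub>B\<^esub> F2 F ?I x) \<cdot> (F2 G (FO F ?I) ?x \<cdot> (FA G (F0 F) \<odot> FA G (Ide B ?x))) \<cdot> (F0 G \<odot> Ide C (FO G ?x))" (is "?lhs = _")
      by simp
    also have "\<dots> = FA G (FA F (Lun A x) \<cdot>\<^bsub>B\<^esub> F2 F ?I x \<cdot>\<^bsub>B\<^esub> (F0 F \<odot>\<^bsub>B\<^esub> Ide B ?x)) \<cdot> F2 G (UnitO B) ?x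
      \<cdot> (F0 G \<odot> Ide C (FO G ?x))"
      by (subst G.F2_nat) auto
    also have "\<dots> = Lun C (FO ?H x)"
      by (subst F.F2_Lun) (auto simp: G.F2_Lun)
    finally show "?lhs = \<dots>" .
  next
    fix x y assume [simp]: "x \<in> Obj A" "y \<in> Obj A"
    have "FA ?H (Sym A x y) \<cdot> F2 ?H x y = FA G (FA F (Sym A x y) \<cdot>\<^bsub>B\<^esub> F2 F x y)
      \<cdot> F2 G (FO F x) (FO F y)" (is "?lhs = _")
      by simp
    also have "\<dots> = F2 ?H y x \<cdot> Sym C (FO ?H x) (FO ?H y)"
      by (subst F.F2_Sym) (auto simp: G.F2_Sym)
    finally show "?lhs = \<dots>" .
  qed (auto intro: F.A.SMC_axioms G.B.SMC_axioms, simp_all add: comp_functor_def)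
qed

lemma id_functor_simps [simp]:
  "x \<in> Obj A \<Longrightarrow> FO (id_functor A) x = x"
  "f \<in> Arr A \<Longrightarrow> FA (id_functor A) f = f"
  "F0 (id_functor A) = Ide A (UnitO A)"
  "x \<in> Obj A \<Longrightarrow> y \<in> Obj A \<Longrightarrow> F2 (id_functor A) x y = Ide A (x \<otimes>\<^bsub>A\<^esub> y)"
  by (simp_all add: id_functor_def)

lemma id_functor_SMF:
  assumes "symmetric_monoidal_category A"
  shows "SMF A A (id_functor A)"
proof -
  interpret A: symmetric_monoidal_category A by fact
  show ?thesis
    by (rule symmetric_monoidal_functorI) (auto simp: assms, simp_all add: id_functor_def)
qed

lemma comp_id_functor:
  assumes "SMF A B F"
  shows "comp_functor A B F (id_functor A) = F" "comp_functor A B (id_functor B) F = F"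
proof -
  interpret F: symmetric_monoidal_functor A B F by fact
  have "SMF A A (id_functor A)" "SMF B B (id_functor B)"
    by (auto intro!: id_functor_SMF F.A.SMC_axioms F.B.SMC_axioms)
  then show "comp_functor A B F (id_functor A) = F" "comp_functor A B (id_functor B) F = F"
    using assms by (auto intro!: smfun_eqI [of A B] comp_functor_SMF)
qed

lemma whisker_left_simps [simp]:
  "Src (whisker_left A C F \<theta>) = comp_functor A C F (Src \<theta>)"
  "Tgt (whisker_left A C F \<theta>) = comp_functor A C F (Tgt \<theta>)"
  "a \<in> Obj A \<Longrightarrow> Cmp (whisker_left A C F \<theta>) a = FA F (Cmp \<theta> a)"
  "Cmp (whisker_left A C F \<theta>) \<in> extensional (Obj A)"
  by (simp_all add: whisker_left_def)

lemma whisker_right_simps [simp]: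
  "Src (whisker_right A C \<sigma> H) = comp_functor A C (Src \<sigma>) H"
  "Tgt (whisker_right A C \<sigma> H) = comp_functor A C (Tgt \<sigma>) H"
  "a \<in> Obj A \<Longrightarrow> Cmp (whisker_right A C \<sigma> H) a = Cmp \<sigma> (FO H a)"
  "Cmp (whisker_right A C \<sigma> H) \<in> extensional (Obj A)"
  by (simp_all add: whisker_right_def)

lemma whisker_left_MT:
  fixes C (structure)
  assumes "SMF B C F" "MT A B \<theta>"
  shows "MT A C (whisker_left A C F \<theta>)" (is "MT _ _ ?\<sigma>")
proof -
  interpret F: symmetric_monoidal_functor B C F by fact
  interpret T: monoidal_transformation A B \<theta> by fact
  show ?thesis
  proof (rule monoidal_transformationI)
    show "Cmp ?\<sigma> (UnitO A) \<cdot> F0 (Src ?\<sigma>) = F0 (Tgt ?\<sigma>)"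
      by (simp flip: T.Cmp_F0)
  next
    fix f assume [simp]: "f \<in> Arr A"
    show "Cmp ?\<sigma> (Cod A f) \<cdot> FA (Src ?\<sigma>) f = FA (Tgt ?\<sigma>) f \<cdot> Cmp ?\<sigma> (Dom A f)"
      by (simp add: T.Cmp_nat flip: F.FA_Comp_eq)
  next
    fix x y assume [simp]: "x \<in> Obj A" "y \<in> Obj A"
    have "Cmp ?\<sigma> (x \<otimes>\<^bsub>A\<^esub> y) \<cdot> F2 (Src ?\<sigma>) x y
      = FA F (Cmp \<theta> (x \<otimes>\<^bsub>A\<^esub> y) \<cdot>\<^bsub>B\<^esub> F2 (Src \<theta>) x y) \<cdot> F2 F (FO (Src \<theta>) x) (FO (Src \<theta>) y)" (is "?lhs = _")
      by simp
    also have "\<dots> = F2 (Tgt ?\<sigma>) x y \<cdot> (Cmp ?\<sigma> x \<odot> Cmp ?\<sigma> y)"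
      by (subst T.Cmp_F2) (auto simp: F.F2_nat)
    finally show "?lhs = \<dots>" .
  qed (auto intro!: comp_functor_SMF assms(1) T.Src.SMF_axioms T.Tgt.SMF_axioms)
qed

text \<open>Both monoidal equations come from naturality of \<open>\<sigma>\<close> at the
  constraints of \<open>H\<close>, followed by the monoidal equations of
  \<open>\<sigma>\<close>.\<close>

lemma whisker_right_MT:
  fixes C (structure)
  assumes "SMF A B H" "MT B C \<sigma>"
  shows "MT A C (whisker_right A C \<sigma> H)" (is "MT _ _ ?\<sigma>")
proof -
  interpret H: symmetric_monoidal_functor A B H by fact
  interpret S: monoidal_transformation B C \<sigma> by fact
  show ?thesis
  proof (rule monoidal_transformationI)
    show "Cmp ?\<sigma> (UnitO A) \<cdot> F0 (Src ?\<sigma>) = F0 (Tgt ?\<sigma>)"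
      using S.Src.B.Comp_reassoc [OF S.Cmp_nat [of "F0 H" "FO H (UnitO A)"], of "F0 (Src \<sigma>)"]
        by (simp add: S.Cmp_F0)
  next
    fix x y assume [simp]: "x \<in> Obj A" "y \<in> Obj A"
    have "Cmp ?\<sigma> (x \<otimes>\<^bsub>A\<^esub> y) \<cdot> F2 (Src ?\<sigma>) x y
      = (Cmp \<sigma> (FO H (x \<otimes>\<^bsub>A\<^esub> y)) \<cdot> FA (Src \<sigma>) (F2 H x y)) \<cdot> F2 (Src \<sigma>) (FO H x) (FO H y)" (is "?lhs = _")
      by simp
    also have "\<dots> = F2 (Tgt ?\<sigma>) x y \<cdot> (Cmp ?\<sigma> x \<odot> Cmp ?\<sigma> y)"
      by (subst S.Cmp_nat) (auto simp: S.Cmp_F2)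
    finally show "?lhs = \<dots>" .
  qed (auto intro!: comp_functor_SMF assms(1) simp: S.Cmp_nat intro: S.Src.SMF_axioms S.Tgt.SMF_axioms)
qed

section \<open>Compatibility of a lax functor with canonical arrows\<close>

context symmetric_monoidal_functor
begin

text \<open>The iterated constraint from \<open>evF s\<close>, the tensor of the images, to the
  image of the tensor.\<close>

primrec collect :: "'o1 bracketing \<Rightarrow> 'm2" where
  "collect Unit = F0 F"
| "collect (Leaf x) = Ide B (FO F x)"
| "collect (Node s t) = F2 F (A.ev s) (A.ev t) \<cdot>\<^bsub>B\<^esub> (collect s \<odot>\<^bsub>B\<^esub> collect t)"

abbreviation evF :: "'o1 bracketing \<Rightarrow> 'o2" where
  "evF s \<equiv> B.ev (map_bracketing (FO F) s)"

lemma valid_map [simp]: "A.valid s \<Longrightarrow> B.valid (map_bracketing (FO F) s)"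
  by (auto simp: bracketing.set_map)

lemma collect_simps [simp]:
  assumes "A.valid s"
  shows "collect s \<in> Arr B" "Dom B (collect s) = evF s" "Cod B (collect s) = FO F (A.ev s)"
  using assms by (induction s) auto

text \<open>In use, \<open>g\<close> is the canonical arrow of \<open>B\<close> with the same shape
  as the canonical arrow \<open>f\<close> of \<open>A\<close>. For a lax functor
  \<open>collect\<close> need not be invertible, so the two are related by a square and not by
  conjugation.\<close>

definition lifts :: "'o1 bracketing \<Rightarrow> 'o1 bracketing \<Rightarrow> 'm1 \<Rightarrow> 'm2 \<Rightarrow> bool" where
  "lifts s t f g \<longleftrightarrow> A.valid s \<and> A.valid t \<and> f \<in> Arr A \<and> Dom A f = A.ev s \<and> Cod A f = A.ev t \<and>
     g \<in> Arr B \<and> Dom B g = evF s \<and> Cod B g = evF t \<and> FA F f \<cdot>\<^bsub>B\<^esub> collect s = collect t \<cdot>\<^bsub>B\<^esub> g"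


lemma lifts_Ide: "A.valid s \<Longrightarrow> lifts s s (Ide A (A.ev s)) (Ide B (evF s))"
  by (simp add: lifts_def)

lemma lifts_Comp:
  assumes "lifts s t f g" "lifts t u f' g'"
  shows "lifts s u (f' \<cdot>\<^bsub>A\<^esub> f) (g' \<cdot>\<^bsub>B\<^esub> g)"
proof -
  have 1: "A.valid s" "A.valid t" "f \<in> Arr A" "Dom A f = A.ev s" "Cod A f = A.ev t"
     "g \<in> Arr B" "Dom B g = evF s" "Cod B g = evF t" "FA F f \<cdot>\<^bsub>B\<^esub> collect s = collect t \<cdot>\<^bsub>B\<^esub> g"
    and 2: "A.valid u" "f' \<in> Arr A" "Dom A f' = A.ev t" "Cod A f' = A.ev u"
     "g' \<in> Arr B" "Dom B g' = evF t" "Cod B g' = evF u" "FA F f' \<cdot>\<^bsub>B\<^esub> collect t = collect u \<cdot>\<^bsub>B\<^esub> g'"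
    using assms by (simp_all add: lifts_def)
  have "FA F (f' \<cdot>\<^bsub>A\<^esub> f) \<cdot>\<^bsub>B\<^esub> collect s = FA F f' \<cdot>\<^bsub>B\<^esub> (FA F f \<cdot>\<^bsub>B\<^esub> collect s)"
    using 1(1-8) 2(1-7) by simp
  also have "\<dots> = (FA F f' \<cdot>\<^bsub>B\<^esub> collect t) \<cdot>\<^bsub>B\<^esub> g"
    unfolding 1(9) using 1(1-8) 2(1-7) by simp
  also have "\<dots> = collect u \<cdot>\<^bsub>B\<^esub> g' \<cdot>\<^bsub>B\<^esub> g"
    unfolding 2(8) using 1(1-8) 2(1-7) by simp
  finally show ?thesis using 1(1-8) 2(1-7) by (simp add: lifts_def)
qed

lemma lifts_TenA:
  assumes "lifts s t f g" "lifts s' t' f' g'"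
  shows "lifts (Node s s') (Node t t') (f \<odot>\<^bsub>A\<^esub> f') (g \<odot>\<^bsub>B\<^esub> g')"
proof -
  have [simp]: "A.valid s" "A.valid t" "f \<in> Arr A" "Dom A f = A.ev s" "Cod A f = A.ev t"
     "g \<in> Arr B" "Dom B g = evF s" "Cod B g = evF t"
     "A.valid s'" "A.valid t'" "f' \<in> Arr A" "Dom A f' = A.ev s'" "Cod A f' = A.ev t'"
     "g' \<in> Arr B" "Dom B g' = evF s'" "Cod B g' = evF t'"
    and eq: "FA F f \<cdot>\<^bsub>B\<^esub> collect s = collect t \<cdot>\<^bsub>B\<^esub> g" "FA F f' \<cdot>\<^bsub>B\<^esub> collect s' = collect t' \<cdot>\<^bsub>B\<^esub> g'"
    using assms by (simp_all add: lifts_def)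
  have "FA F (f \<odot>\<^bsub>A\<^esub> f') \<cdot>\<^bsub>B\<^esub> collect (Node s s') = (FA F (f \<odot>\<^bsub>A\<^esub> f') \<cdot>\<^bsub>B\<^esub> F2 F (A.ev s) (A.ev s'))
    \<cdot>\<^bsub>B\<^esub> (collect s \<odot>\<^bsub>B\<^esub> collect s')"
    by simp
  also have "\<dots> = F2 F (A.ev t) (A.ev t') \<cdot>\<^bsub>B\<^esub> ((FA F f \<cdot>\<^bsub>B\<^esub> collect s) \<odot>\<^bsub>B\<^esub> (FA F f' \<cdot>\<^bsub>B\<^esub> collect s'))"
    using B.Comp_reassoc [OF F2_nat [of f f' "A.ev t" "A.ev t'"], of "collect s \<odot>\<^bsub>B\<^esub> collect s'"] by simp
  also have "\<dots> = collect (Node t t') \<cdot>\<^bsub>B\<^esub> (g \<odot>\<^bsub>B\<^esub> g')"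
    unfolding eq by simp
  finally show ?thesis by (simp add: lifts_def)
qed

text \<open>Only \<open>f\<close> and \<open>g\<close> are inverted; the possibly non-invertible
  sides \<open>collect s\<close> and \<open>collect t\<close> of the square stay in place.\<close>

lemma lifts_inverse:
  assumes "lifts s t f g" "iso A f" "iso B g"
  shows "lifts t s (inv_arr A f) (inv_arr B g)"
proof -
  have 1: "A.valid s" "A.valid t" "f \<in> Arr A" "Dom A f = A.ev s" "Cod A f = A.ev t"
     "g \<in> Arr B" "Dom B g = evF s" "Cod B g = evF t" "FA F f \<cdot>\<^bsub>B\<^esub> collect s = collect t \<cdot>\<^bsub>B\<^esub> g"
    using assms by (simp_all add: lifts_def)
  have i: "iso B (FA F f)" "inv_arr B (FA F f) = FA F (inv_arr A f)" using assms(2) by auto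
  have "FA F (inv_arr A f) \<cdot>\<^bsub>B\<^esub> collect t = FA F (inv_arr A f) \<cdot>\<^bsub>B\<^esub> (collect t \<cdot>\<^bsub>B\<^esub> g) \<cdot>\<^bsub>B\<^esub> inv_arr B g"
    using 1(1-8) assms(2,3) by simp
  also have "\<dots> = inv_arr B (FA F f) \<cdot>\<^bsub>B\<^esub> (FA F f \<cdot>\<^bsub>B\<^esub> (collect s \<cdot>\<^bsub>B\<^esub> inv_arr B g))"
    unfolding 1(9) [symmetric] i(2) using 1(1-8) assms(2,3) by simp
  also have "\<dots> = collect s \<cdot>\<^bsub>B\<^esub> inv_arr B g"
    by (subst B.inv_arr_Comp_Comp(1) [OF i(1)]) (use 1(1-8) assms(2,3) in auto)
  finally show ?thesis using 1(1-8) assms(2,3) by (simp add: lifts_def)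
qed

lemma lifts_Ass:
  assumes [simp]: "A.valid s" "A.valid t" "A.valid u"
  shows "lifts (Node s (Node t u)) (Node (Node s t) u) (Ass A (A.ev s) (A.ev t) (A.ev u)) (Ass B (evF s) (evF t) (evF u))"
proof -
  let ?s = "A.ev s" and ?t = "A.ev t" and ?u = "A.ev u"
  have "FA F (Ass A ?s ?t ?u) \<cdot>\<^bsub>B\<^esub> collect (Node s (Node t u))
     = (FA F (Ass A ?s ?t ?u) \<cdot>\<^bsub>B\<^esub> F2 F ?s (?t \<otimes>\<^bsub>A\<^esub> ?u) \<cdot>\<^bsub>B\<^esub> (Ide B (FO F ?s) \<odot>\<^bsub>B\<^esub> F2 F ?t ?u)) \<cdot>\<^bsub>B\<^esub> (collect s \<odot>\<^bsub>B\<^esub> (collect t \<odot>\<^bsub>B\<^esub> collect u))"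
    by simp
  also have "\<dots> = F2 F (?s \<otimes>\<^bsub>A\<^esub> ?t) ?u \<cdot>\<^bsub>B\<^esub> (F2 F ?s ?t \<odot>\<^bsub>B\<^esub> Ide B (FO F ?u))
    \<cdot>\<^bsub>B\<^esub> (Ass B (FO F ?s) (FO F ?t) (FO F ?u) \<cdot>\<^bsub>B\<^esub> (collect s \<odot>\<^bsub>B\<^esub> (collect t \<odot>\<^bsub>B\<^esub> collect u)))"
    by (subst F2_Ass) auto
  also have "\<dots> = collect (Node (Node s t) u) \<cdot>\<^bsub>B\<^esub> Ass B (evF s) (evF t) (evF u)"
    by (subst B.Ass_nat) auto
  finally show ?thesis by (simp add: lifts_def)
qed

lemma lifts_Sym:
  assumes [simp]: "A.valid s" "A.valid t"
  shows "lifts (Node s t) (Node t s) (Sym A (A.ev s) (A.ev t)) (Sym B (evF s) (evF t))"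
proof -
  have "FA F (Sym A (A.ev s) (A.ev t)) \<cdot>\<^bsub>B\<^esub> collect (Node s t)
     = (FA F (Sym A (A.ev s) (A.ev t)) \<cdot>\<^bsub>B\<^esub> F2 F (A.ev s) (A.ev t)) \<cdot>\<^bsub>B\<^esub> (collect s \<odot>\<^bsub>B\<^esub> collect t)"
    by simp
  also have "\<dots> = F2 F (A.ev t) (A.ev s) \<cdot>\<^bsub>B\<^esub> (Sym B (FO F (A.ev s)) (FO F (A.ev t))
    \<cdot>\<^bsub>B\<^esub> (collect s \<odot>\<^bsub>B\<^esub> collect t))"
    by (subst F2_Sym) auto
  also have "\<dots> = collect (Node t s) \<cdot>\<^bsub>B\<^esub> Sym B (evF s) (evF t)"
    by (subst B.Sym_nat) auto
  finally show ?thesis by (simp add: lifts_def)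
qed

text \<open>The square for \<open>interchange\<close> is assembled factor by factor from those for
  \<open>Ass\<close> and \<open>Sym\<close>. It makes the constraint \<open>F2\<close> of
  \<open>hom_post\<close> a monoidal transformation.\<close>

lemma F2_interchange:
  assumes [simp]: "w \<in> Obj A" "x \<in> Obj A" "y \<in> Obj A" "z \<in> Obj A"
  shows "FA F (interchange A w x y z) \<cdot>\<^bsub>B\<^esub> F2 F (w \<otimes>\<^bsub>A\<^esub> x) (y \<otimes>\<^bsub>A\<^esub> z) \<cdot>\<^bsub>B\<^esub> (F2 F w x \<odot>\<^bsub>B\<^esub> F2 F y z)
    = F2 F (w \<otimes>\<^bsub>A\<^esub> y) (x \<otimes>\<^bsub>A\<^esub> z) \<cdot>\<^bsub>B\<^esub> (F2 F w y \<odot>\<^bsub>B\<^esub> F2 F x z) \<cdot>\<^bsub>B\<^esub> interchange B (FO F w) (FO F x) (FO F y) (FO F z)"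
proof -
  let ?w = "Leaf w" and ?x = "Leaf x" and ?y = "Leaf y" and ?z = "Leaf z"
  have "lifts (Node (Node ?w ?x) (Node ?y ?z)) (Node (Node ?w ?y) (Node ?x ?z)) (interchange A w x y z)
     (interchange B (FO F w) (FO F x) (FO F y) (FO F z))"
    unfolding interchange_def
    using lifts_Comp [OF lifts_Comp [OF lifts_Comp [OF lifts_Comp [OF lifts_Ass [of "Node ?w ?x" ?y ?z]
      lifts_TenA [OF lifts_inverse [OF lifts_Ass [of ?w ?x ?y]] lifts_Ide [of ?z]]]
      lifts_TenA [OF lifts_TenA [OF lifts_Ide [of ?w] lifts_Sym [of ?x ?y]] lifts_Ide [of ?z]]]
      lifts_TenA [OF lifts_Ass [of ?w ?y ?x] lifts_Ide [of ?z]]]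
      lifts_inverse [OF lifts_Ass [of "Node ?w ?y" ?x ?z]]]
    by simp
  then show ?thesis by (simp add: lifts_def)
qed

text \<open>The right unit axiom at the unit object, with naturality of \<open>Run\<close>
  extracting \<open>F0 F\<close>. Both constraints of \<open>hom_post\<close> need it for their
  monoidality.\<close>

lemma F2_UnitO: "F2 F (UnitO A) (UnitO A) \<cdot>\<^bsub>B\<^esub> (F0 F \<odot>\<^bsub>B\<^esub> F0 F) = FA F (inv_arr A (Run A (UnitO A)))
  \<cdot>\<^bsub>B\<^esub> F0 F \<cdot>\<^bsub>B\<^esub> Run B (UnitO B)"
proof -
  let ?I = "UnitO A"
  have "F2 F ?I ?I \<cdot>\<^bsub>B\<^esub> (F0 F \<odot>\<^bsub>B\<^esub> F0 F) = FA F (inv_arr A (Run A ?I)) \<cdot>\<^bsub>B\<^esub> (FA F (Run A ?I) \<cdot>\<^bsub>B\<^esub> F2 F ?I ?I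
    \<cdot>\<^bsub>B\<^esub> (Ide B (FO F ?I) \<odot>\<^bsub>B\<^esub> F0 F)) \<cdot>\<^bsub>B\<^esub> (F0 F \<odot>\<^bsub>B\<^esub> Ide B (UnitO B))"
    using B.inv_arr_Comp_Comp(1) [of "FA F (Run A ?I)" "F2 F ?I ?I \<cdot>\<^bsub>B\<^esub> (F0 F \<odot>\<^bsub>B\<^esub> F0 F)"] by simp
  also have "\<dots> = FA F (inv_arr A (Run A ?I)) \<cdot>\<^bsub>B\<^esub> (Run B (FO F ?I) \<cdot>\<^bsub>B\<^esub> (F0 F \<odot>\<^bsub>B\<^esub> Ide B (UnitO B)))"
    by (subst F2_Run) auto
  also have "\<dots> = FA F (inv_arr A (Run A ?I)) \<cdot>\<^bsub>B\<^esub> F0 F \<cdot>\<^bsub>B\<^esub> Run B (UnitO B)"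
    by (subst B.Run_nat) auto
  finally show ?thesis .
qed

end


section \<open>Postcomposition as a symmetric monoidal functor between internal homs\<close>

lemma hom_post_simps [simp]:
  "SMF A B H \<Longrightarrow> FO (hom_post A B C F) H = comp_functor A C F H"
  "MT A B \<theta> \<Longrightarrow> FA (hom_post A B C F) \<theta> = whisker_left A C F \<theta>"
  by (simp_all add: hom_post_def)

lemma hom_post_structure [simp]:
  "Src (F0 (hom_post A B C F)) = unit_functor A C"
  "Tgt (F0 (hom_post A B C F)) = comp_functor A C F (unit_functor A B)"
  "a \<in> Obj A \<Longrightarrow> Cmp (F0 (hom_post A B C F)) a = F0 F"
  "Cmp (F0 (hom_post A B C F)) \<in> extensional (Obj A)"
  by (simp_all add: hom_post_def)

lemma hom_post_F2 [simp]:
  assumes "SMF A B H" "SMF A B K"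
  shows "Src (F2 (hom_post A B C F) H K) = box_functor A C (comp_functor A C F H) (comp_functor A C F K)"
  "Tgt (F2 (hom_post A B C F) H K) = comp_functor A C F (box_functor A B H K)"
  "a \<in> Obj A \<Longrightarrow> Cmp (F2 (hom_post A B C F) H K) a = F2 F (FO H a) (FO K a)"
  "Cmp (F2 (hom_post A B C F) H K) \<in> extensional (Obj A)"
  using assms by (simp_all add: hom_post_def)

lemma hom_post_F0_MT:
  fixes C (structure)
  assumes A: "symmetric_monoidal_category A" and F: "SMF B C F"
  shows "MT A C (F0 (hom_post A B C F))" (is "MT _ _ ?\<sigma>")
proof -
  interpret A: symmetric_monoidal_category A by fact
  interpret F: symmetric_monoidal_functor B C F by fact
  show ?thesis
  proof (rule monoidal_transformationI)
    fix x y assume [simp]: "x \<in> Obj A" "y \<in> Obj A"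
    show "Cmp ?\<sigma> (x \<otimes>\<^bsub>A\<^esub> y) \<cdot> F2 (Src ?\<sigma>) x y =
      F2 (Tgt ?\<sigma>) x y \<cdot> (Cmp ?\<sigma> x \<odot> Cmp ?\<sigma> y)"
      using F.B.inv_arr_Comp_Comp(2) [of "FA F (Run B (UnitO B))" "F0 F
        \<cdot> Run C (UnitO C)"] by (simp add: F.F2_UnitO)
  qed (auto intro!: unit_functor_SMF comp_functor_SMF [OF _ F] simp: A F.A.SMC_axioms F.B.SMC_axioms)
qed

lemma hom_post_F2_MT:
  fixes C (structure)
  assumes "SMF B C F" "SMF A B H" "SMF A B K"
  shows "MT A C (F2 (hom_post A B C F) H K)" (is "MT _ _ ?\<sigma>")
proof -
  interpret F: symmetric_monoidal_functor B C F by fact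
  interpret H: symmetric_monoidal_functor A B H by fact
  interpret K: symmetric_monoidal_functor A B K by fact
  note [simp] = assms
  show ?thesis
  proof (rule monoidal_transformationI)
    fix f assume [simp]: "f \<in> Arr A"
    show "Cmp ?\<sigma> (Cod A f) \<cdot> FA (Src ?\<sigma>) f =
      FA (Tgt ?\<sigma>) f \<cdot> Cmp ?\<sigma> (Dom A f)"
      by (simp add: F.F2_nat)
  next
    let ?r = "inv_arr C (Run C (UnitO C))" and ?I = "UnitO B"
    have "Cmp ?\<sigma> (UnitO A) \<cdot> F0 (Src ?\<sigma>)
      = (F2 F (FO H (UnitO A)) (FO K (UnitO A)) \<cdot> (FA F (F0 H) \<odot> FA F (F0 K))) \<cdot> (F0 F \<odot> F0 F) \<cdot> ?r" (is "?lhs = _")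
      by simp
    also have "\<dots> = FA F (F0 H \<odot>\<^bsub>B\<^esub> F0 K) \<cdot> (F2 F ?I ?I \<cdot> (F0 F \<odot> F0 F)) \<cdot> ?r"
      by (subst F.F2_nat) auto
    also have "\<dots> = F0 (Tgt ?\<sigma>)"
      by (subst F.F2_UnitO) auto
    finally show "?lhs = \<dots>" .
  next
    fix x y assume [simp]: "x \<in> Obj A" "y \<in> Obj A"
    let ?a = "FO H x" and ?b = "FO K x" and ?c = "FO H y" and ?d = "FO K y"
    have "Cmp ?\<sigma> (x \<otimes>\<^bsub>A\<^esub> y) \<cdot> F2 (Src ?\<sigma>) x y
      = (F2 F (FO H (x \<otimes>\<^bsub>A\<^esub> y)) (FO K (x \<otimes>\<^bsub>A\<^esub> y)) \<cdot> (FA F (F2 H x y) \<odot> FA F (F2 K x y)))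
        \<cdot> (F2 F ?a ?c \<odot> F2 F ?b ?d) \<cdot> interchange C (FO F ?a) (FO F ?b) (FO F ?c) (FO F ?d)" (is "?lhs = _")
      by simp
    also have "\<dots> = FA F (F2 H x y \<odot>\<^bsub>B\<^esub> F2 K x y) \<cdot> (F2 F (?a \<otimes>\<^bsub>B\<^esub> ?c) (?b \<otimes>\<^bsub>B\<^esub> ?d)
      \<cdot> (F2 F ?a ?c \<odot> F2 F ?b ?d) \<cdot> interchange C (FO F ?a) (FO F ?b) (FO F ?c) (FO F ?d))"
      by (subst F.F2_nat) auto
    also have "\<dots> = F2 (Tgt ?\<sigma>) x y \<cdot> (Cmp ?\<sigma> x \<odot> Cmp ?\<sigma> y)"
      by (subst F.F2_interchange [symmetric]) auto
    finally show "?lhs = \<dots>" .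
  qed (auto intro!: box_functor_SMF comp_functor_SMF [OF _ assms(1)])
qed

theorem hom_post_SMF:
  assumes A: "symmetric_monoidal_category A" and F: "SMF B C F"
  shows "SMF \<lbrakk>A, B\<rbrakk> \<lbrakk>A, C\<rbrakk> (hom_post A B C F)"
proof -
  interpret A: symmetric_monoidal_category A by fact
  interpret F: symmetric_monoidal_functor B C F by fact
  have B: "symmetric_monoidal_category B" and C: "symmetric_monoidal_category C"
    by (rule F.A.SMC_axioms F.B.SMC_axioms)+
  interpret AB: symmetric_monoidal_category "\<lbrakk>A, B\<rbrakk>" by (rule internal_hom_SMC [OF A B])
  interpret AC: symmetric_monoidal_category "\<lbrakk>A, C\<rbrakk>" by (rule internal_hom_SMC [OF A C])
  note intros = comp_functor_SMF [OF _ F] box_functor_SMF unit_functor_SMF [OF A B] unit_functor_SMF [OF A C]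
    whisker_left_MT [OF F] hom_post_F0_MT [OF A F] hom_post_F2_MT [OF F]
  show ?thesis
    by (rule symmetric_monoidal_functorI)
      (auto intro!: smtrans_eqI [where X = "Obj A"] intros
        simp: Ide_MT Run_MT Lun_MT Sym_MT Ass_MT Comp_MT TenA_MT
          monoidal_transformation.Cmp_simps [of A B] symmetric_monoidal_functor.FO_in_Obj [of A B]
          monoidal_transformation_SMF box_functor_SMF unit_functor_SMF [OF A B] AB.SMC_axioms AC.SMC_axioms
          F.F2_nat F.F2_Ass F.F2_Run F.F2_Lun F.F2_Sym, simp_all add: hom_post_def)
qed

section \<open>Doctrinal adjunction with identity unit\<close>

text \<open>The left adjoint is given by bare functions \<open>l\<close> on objects and
  \<open>la\<close> on arrows; that \<open>la\<close> preserves identities and composition is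
  derived by transposition. Invertibility of \<open>\<epsilon>\<close> is asked only at the unit and
  at tensors of objects \<open>l x\<close>.\<close>

locale doctrinal_adjunction =
  E: symmetric_monoidal_category E + D: symmetric_monoidal_category D
  for E :: "('o1, 'm1) smcat" and D :: "('o2, 'm2) smcat" (structure) +
  fixes R :: "('o2, 'm2, 'o1, 'm1) smfun"
    and l :: "'o1 \<Rightarrow> 'o2" and la :: "'m1 \<Rightarrow> 'm2" and \<epsilon> :: "'o2 \<Rightarrow> 'm2"
  assumes strict: "strict_functor D E R"
    and l_Obj [simp]: "x \<in> Obj E \<Longrightarrow> l x \<in> Obj D"
    and la_Arr [simp]: "f \<in> Arr E \<Longrightarrow> la f \<in> Arr D"
    and Dom_la [simp]: "f \<in> Arr E \<Longrightarrow> Dom D (la f) = l (Dom E f)"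
    and Cod_la [simp]: "f \<in> Arr E \<Longrightarrow> Cod D (la f) = l (Cod E f)"
    and R_l [simp]: "x \<in> Obj E \<Longrightarrow> FO R (l x) = x"
    and R_la [simp]: "f \<in> Arr E \<Longrightarrow> FA R (la f) = f"
    and \<epsilon>_Arr [simp]: "d \<in> Obj D \<Longrightarrow> \<epsilon> d \<in> Arr D"
    and Dom_\<epsilon> [simp]: "d \<in> Obj D \<Longrightarrow> Dom D (\<epsilon> d) = l (FO R d)"
    and Cod_\<epsilon> [simp]: "d \<in> Obj D \<Longrightarrow> Cod D (\<epsilon> d) = d"
    and \<epsilon>_natural: "h \<in> Arr D \<Longrightarrow> \<epsilon> (Cod D h) \<cdot> la (FA R h) = h \<cdot> \<epsilon> (Dom D h)"
    and \<epsilon>_l [simp]: "x \<in> Obj E \<Longrightarrow> \<epsilon> (l x) = Ide D (l x)"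
    and R_\<epsilon> [simp]: "d \<in> Obj D \<Longrightarrow> FA R (\<epsilon> d) = Ide E (FO R d)"
    and \<epsilon>_TenO_iso [simp]: "x \<in> Obj E \<Longrightarrow> y \<in> Obj E \<Longrightarrow> iso D (\<epsilon> (l x \<otimes> l y))"
    and \<epsilon>_UnitO_iso [simp]: "iso D (\<epsilon> (UnitO D))"
begin

sublocale R: symmetric_monoidal_functor D E R
  using strict by (simp add: strict_functor_def)

lemma R_F0 [simp]: "F0 R = Ide E (UnitO E)"
  using strict by (simp add: strict_functor_def)

lemma R_F2 [simp]: "x \<in> Obj D \<Longrightarrow> y \<in> Obj D \<Longrightarrow> F2 R x y = Ide E (FO R x \<otimes>\<^bsub>E\<^esub> FO R y)"
  using strict by (simp add: strict_functor_def)

lemma R_UnitO [simp]: "FO R (UnitO D) = UnitO E"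
  using R.F0_simps(3) by simp

lemma R_TenO [simp]: "x \<in> Obj D \<Longrightarrow> y \<in> Obj D \<Longrightarrow> FO R (x \<otimes> y) = FO R x \<otimes>\<^bsub>E\<^esub> FO R y"
  using R.F2_simps(3) [of x y] by simp

lemma R_TenA [simp]: "f \<in> Arr D \<Longrightarrow> g \<in> Arr D \<Longrightarrow> FA R (f \<odot> g) = FA R f \<odot>\<^bsub>E\<^esub> FA R g"
  using R.F2_nat [of f g] by simp

lemma R_structure [simp]:
  "x \<in> Obj D \<Longrightarrow> y \<in> Obj D \<Longrightarrow> z \<in> Obj D \<Longrightarrow> FA R (Ass D x y z) = Ass E (FO R x) (FO R y) (FO R z)"
  "x \<in> Obj D \<Longrightarrow> FA R (Run D x) = Run E (FO R x)"
  "x \<in> Obj D \<Longrightarrow> FA R (Lun D x) = Lun E (FO R x)"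
  "x \<in> Obj D \<Longrightarrow> y \<in> Obj D \<Longrightarrow> FA R (Sym D x y) = Sym E (FO R x) (FO R y)"
  using R.F2_Ass [of x y z] R.F2_Run [of x] R.F2_Lun [of x] R.F2_Sym [of x y] by simp_all

text \<open>Transposition along the adjunction is \<open>R\<close> itself, the unit being the identity.\<close>

lemma transpose_eqI:
  assumes "x \<in> Obj E" "f \<in> Arr D" "g \<in> Arr D" "Dom D f = l x" "Dom D g = l x" "Cod D f = Cod D g"
    and eq: "FA R f = FA R g"
  shows "f = g"
proof -
  have "f = \<epsilon> (Cod D f) \<cdot> la (FA R f)" using \<epsilon>_natural [of f] assms by simp
  also have "\<dots> = g" using \<epsilon>_natural [of g] assms by simp
  finally show ?thesis .
qed

lemma la_Ide [simp]: "x \<in> Obj E \<Longrightarrow> la (Ide E x) = Ide D (l x)"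
  by (rule transpose_eqI [of x]) auto

lemma la_Comp:
  "f \<in> Arr E \<Longrightarrow> g \<in> Arr E \<Longrightarrow> Dom E g = Cod E f \<Longrightarrow> la (g \<cdot>\<^bsub>E\<^esub> f) = la g \<cdot> la f"
  by (rule transpose_eqI [of "Dom E f"]) auto

definition left_adjoint :: "('o1, 'm1, 'o2, 'm2) smfun" where
  "left_adjoint = \<lparr>FO = \<lambda>x\<in>Obj E. l x, FA = \<lambda>f\<in>Arr E. la f, F0 = inv_arr D (\<epsilon> (UnitO D)),
     F2 = \<lambda>x\<in>Obj E. \<lambda>y\<in>Obj E. inv_arr D (\<epsilon> (l x \<otimes> l y))\<rparr>"

definition counit :: "('o2, 'm2, 'o2, 'm2) smtrans" where
  "counit = \<lparr>Src = comp_functor D D left_adjoint R, Tgt = id_functor D, Cmp = \<lambda>d\<in>Obj D. \<epsilon> d\<rparr>"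

lemma left_adjoint_simps [simp]:
  "x \<in> Obj E \<Longrightarrow> FO left_adjoint x = l x"
  "f \<in> Arr E \<Longrightarrow> FA left_adjoint f = la f"
  "F0 left_adjoint = inv_arr D (\<epsilon> (UnitO D))"
  "x \<in> Obj E \<Longrightarrow> y \<in> Obj E \<Longrightarrow> F2 left_adjoint x y = inv_arr D (\<epsilon> (l x \<otimes> l y))"
  by (simp_all add: left_adjoint_def)

text \<open>The lax axioms start at objects such as \<open>l x \<otimes> l y\<close>, to which
  transposition does not apply. Each one is therefore proved first with the constraints reversed, so
  that it starts at some \<open>l z\<close>, and is then multiplied by the inverses.\<close>

lemma left_adjoint_SMF: "SMF E D left_adjoint"
proof (rule symmetric_monoidal_functorI)
  let ?L = left_adjoint
  fix f g assume [simp]: "f \<in> Arr E" "g \<in> Arr E"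
  let ?x = "Dom E f" and ?y = "Dom E g" and ?x' = "Cod E f" and ?y' = "Cod E g"
  have "\<epsilon> (l ?x' \<otimes> l ?y') \<cdot> la (f \<odot>\<^bsub>E\<^esub> g) = (la f \<odot> la g) \<cdot> \<epsilon> (l ?x \<otimes> l ?y)"
    by (rule transpose_eqI [of "?x \<otimes>\<^bsub>E\<^esub> ?y"]) auto
  then have "inv_arr D (\<epsilon> (l ?x' \<otimes> l ?y')) \<cdot> (\<epsilon> (l ?x' \<otimes> l ?y') \<cdot> la (f \<odot>\<^bsub>E\<^esub> g)) \<cdot> inv_arr D (\<epsilon> (l ?x \<otimes> l ?y)) =
    inv_arr D (\<epsilon> (l ?x' \<otimes> l ?y')) \<cdot> ((la f \<odot> la g) \<cdot> \<epsilon> (l ?x \<otimes> l ?y)) \<cdot> inv_arr D (\<epsilon> (l ?x \<otimes> l ?y))"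
    by simp
  then show "F2 ?L ?x' ?y' \<cdot> (FA ?L f \<odot> FA ?L g) = FA ?L (f \<odot>\<^bsub>E\<^esub> g) \<cdot> F2 ?L ?x ?y"
    by simp
next
  let ?L = left_adjoint
  fix x y z assume [simp]: "x \<in> Obj E" "y \<in> Obj E" "z \<in> Obj E"
  let ?e = "\<lambda>x y. \<epsilon> (l x \<otimes> l y)"
  have eq: "Ass D (l x) (l y) (l z) \<cdot> (Ide D (l x) \<odot> ?e y z) \<cdot> ?e x (y \<otimes>\<^bsub>E\<^esub> z)
    = (?e x y \<odot> Ide D (l z)) \<cdot> ?e (x \<otimes>\<^bsub>E\<^esub> y) z \<cdot> la (Ass E x y z)"
    by (rule transpose_eqI [of "x \<otimes>\<^bsub>E\<^esub> (y \<otimes>\<^bsub>E\<^esub> z)"]) auto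
  \<comment> \<open>In these terms \<open>eq\<close> reads \<open>Ass D (l x) (l y) (l z) \<cdot> ?q
    = ?p \<cdot> la (Ass E x y z)\<close>. Composing both sides of the goal with the invertible
    \<open>?p\<close> reduces each to the associator of \<open>D\<close>.\<close>
  let ?p = "(?e x y \<odot> Ide D (l z)) \<cdot> ?e (x \<otimes>\<^bsub>E\<^esub> y) z" and ?q = "(Ide D (l x) \<odot> ?e y z) \<cdot> ?e x (y \<otimes>\<^bsub>E\<^esub> z)"
  have "?p \<cdot> FA ?L (Ass E x y z) \<cdot> F2 ?L x (y \<otimes>\<^bsub>E\<^esub> z) \<cdot> (Ide D (FO ?L x) \<odot> F2 ?L y z)
    = (?p \<cdot> la (Ass E x y z)) \<cdot> F2 ?L x (y \<otimes>\<^bsub>E\<^esub> z) \<cdot> (Ide D (FO ?L x) \<odot> F2 ?L y z)"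
    by simp
  also have "\<dots> = Ass D (l x) (l y) (l z)"
    using eq by (simp flip: eq)
  also have "\<dots> = ?p \<cdot> F2 ?L (x \<otimes>\<^bsub>E\<^esub> y) z \<cdot> (F2 ?L x y \<odot> Ide D (FO ?L z)) \<cdot> Ass D (FO ?L x) (FO ?L y) (FO ?L z)"
    by simp
  finally show "FA ?L (Ass E x y z) \<cdot> F2 ?L x (y \<otimes>\<^bsub>E\<^esub> z) \<cdot> (Ide D (FO ?L x) \<odot> F2 ?L y z)
    = F2 ?L (x \<otimes>\<^bsub>E\<^esub> y) z \<cdot> (F2 ?L x y \<odot> Ide D (FO ?L z)) \<cdot> Ass D (FO ?L x) (FO ?L y) (FO ?L z)"
    by (rule D.iso_cancel_left [rotated -1]) auto
next
  let ?L = left_adjoint and ?I = "UnitO E" and ?J = "UnitO D"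
  fix x assume [simp]: "x \<in> Obj E"
  have i [simp]: "iso D (\<epsilon> (l x \<otimes> l ?I))" "iso D (\<epsilon> (l ?I \<otimes> l x))" by simp_all
  have "Run D (l x) \<cdot> (Ide D (l x) \<odot> \<epsilon> ?J) \<cdot> \<epsilon> (l x \<otimes> l ?I) = la (Run E x)"
    by (rule transpose_eqI [of "x \<otimes>\<^bsub>E\<^esub> ?I"]) auto
  then have "la (Run E x) \<cdot> inv_arr D (\<epsilon> (l x \<otimes> l ?I)) \<cdot> (Ide D (l x) \<odot> inv_arr D (\<epsilon> ?J))
    = (Run D (l x) \<cdot> (Ide D (l x) \<odot> \<epsilon> ?J) \<cdot> \<epsilon> (l x \<otimes> l ?I)) \<cdot>
    inv_arr D (\<epsilon> (l x \<otimes> l ?I)) \<cdot> (Ide D (l x) \<odot> inv_arr D (\<epsilon> ?J))"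
    by simp
  then show "FA ?L (Run E x) \<cdot> F2 ?L x ?I \<cdot> (Ide D (FO ?L x) \<odot> F0 ?L) = Run D (FO ?L x)"
    by simp
  have "Lun D (l x) \<cdot> (\<epsilon> ?J \<odot> Ide D (l x)) \<cdot> \<epsilon> (l ?I \<otimes> l x) = la (Lun E x)"
    by (rule transpose_eqI [of "?I \<otimes>\<^bsub>E\<^esub> x"]) auto
  then have "la (Lun E x) \<cdot> inv_arr D (\<epsilon> (l ?I \<otimes> l x)) \<cdot> (inv_arr D (\<epsilon> ?J) \<odot> Ide D (l x))
    = (Lun D (l x) \<cdot> (\<epsilon> ?J \<odot> Ide D (l x)) \<cdot> \<epsilon> (l ?I \<otimes> l x)) \<cdot>
    inv_arr D (\<epsilon> (l ?I \<otimes> l x)) \<cdot> (inv_arr D (\<epsilon> ?J) \<odot> Ide D (l x))"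
    by simp
  then show "FA ?L (Lun E x) \<cdot> F2 ?L ?I x \<cdot> (F0 ?L \<odot> Ide D (FO ?L x)) = Lun D (FO ?L x)"
    by simp
next
  let ?L = left_adjoint
  fix x y assume [simp]: "x \<in> Obj E" "y \<in> Obj E"
  have "\<epsilon> (l y \<otimes> l x) \<cdot> la (Sym E x y) = Sym D (l x) (l y) \<cdot> \<epsilon> (l x \<otimes> l y)"
    by (rule transpose_eqI [of "x \<otimes>\<^bsub>E\<^esub> y"]) auto
  then have "inv_arr D (\<epsilon> (l y \<otimes> l x)) \<cdot> (\<epsilon> (l y \<otimes> l x) \<cdot> la (Sym E x y)) \<cdot> inv_arr D (\<epsilon> (l x \<otimes> l y))
    = inv_arr D (\<epsilon> (l y \<otimes> l x)) \<cdot> (Sym D (l x) (l y) \<cdot> \<epsilon> (l x \<otimes> l y)) \<cdot> inv_arr D (\<epsilon> (l x \<otimes> l y))"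
    by simp
  then show "FA ?L (Sym E x y) \<cdot> F2 ?L x y = F2 ?L y x \<cdot> Sym D (FO ?L x) (FO ?L y)"
    by simp
qed (auto simp: la_Comp E.SMC_axioms D.SMC_axioms, simp_all add: left_adjoint_def)

text \<open>\<open>R\<close> sends the components of \<open>\<epsilon>\<close> to identities, hence
  their inverses as well; so the constraints of the composite are identities and the unit can be an
  identity 2-cell.\<close>

lemma comp_R_left_adjoint: "comp_functor E E R left_adjoint = id_functor E"
  by (rule smfun_eqI [OF comp_functor_SMF [OF left_adjoint_SMF R.SMF_axioms] id_functor_SMF])
    (auto simp: E.SMC_axioms simp flip: R.iso_FA(2))

lemma counit_MT: "MT D D counit"
proof (rule monoidal_transformationI)
  show "SMF D D (Src counit)" "SMF D D (Tgt counit)"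
    by (auto simp: counit_def intro!: comp_functor_SMF [OF R.SMF_axioms left_adjoint_SMF]
        id_functor_SMF D.SMC_axioms)
next
  fix x y assume [simp]: "x \<in> Obj D" "y \<in> Obj D"
  \<comment> \<open>This is naturality of \<open>\<epsilon>\<close> at the arrow
    \<open>\<epsilon> x \<odot> \<epsilon> y\<close>, whose image under \<open>R\<close> is an
    identity.\<close>
  have "\<epsilon> (x \<otimes> y) = (\<epsilon> x \<odot> \<epsilon> y) \<cdot> \<epsilon> (l (FO R x) \<otimes> l (FO R y))"
    using \<epsilon>_natural [of "\<epsilon> x \<odot> \<epsilon> y"] by simp
  then show "Cmp counit (x \<otimes> y) \<cdot> F2 (Src counit) x y = F2 (Tgt counit) x y \<cdot> (Cmp counit x \<odot> Cmp counit y)"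
    by (simp add: counit_def)
qed (auto simp: counit_def \<epsilon>_natural)

text \<open>On components the triangle identities are \<open>\<epsilon> (l x) = 1\<close> and
  \<open>R (\<epsilon> d) = 1\<close>; what remains is agreement of sources and targets.\<close>

theorem adjunction: "smc_adjunction E D left_adjoint R (Ide \<lbrakk>E, E\<rbrakk> (id_functor E)) counit"
proof -
  note E = E.SMC_axioms and D = D.SMC_axioms
  note R = R.SMF_axioms
  have "whisker_right E D counit left_adjoint
    \<cdot>\<^bsub>\<lbrakk>E, D\<rbrakk>\<^esub> whisker_left E D left_adjoint (Ide \<lbrakk>E, E\<rbrakk> (id_functor E)) = Ide \<lbrakk>E, D\<rbrakk> left_adjoint"
    by (rule smtrans_eqI [where X = "Obj E"]) (auto simp: counit_def comp_id_functor [OF left_adjoint_SMF])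
  moreover have "whisker_left D E R counit \<cdot>\<^bsub>\<lbrakk>D, E\<rbrakk>\<^esub> whisker_right D E (Ide \<lbrakk>E, E\<rbrakk> (id_functor E)) R
    = Ide \<lbrakk>D, E\<rbrakk> R"
    by (rule smtrans_eqI [where X = "Obj D"]) (auto simp: counit_def comp_id_functor [OF R])
  moreover have "Src counit = comp_functor D D left_adjoint R" "Tgt counit = id_functor D"
    by (simp_all add: counit_def)
  ultimately show ?thesis
    using left_adjoint_SMF R counit_MT Ide_MT [OF id_functor_SMF [OF E]]
    by (simp add: smc_adjunction_def comp_R_left_adjoint)
qed

end

section \<open>The tensor product and its universal functor\<close>

locale tensor_product = A: symmetric_monoidal_category A + B: symmetric_monoidal_category B
  for A :: "('o1, 'm1) smcat" and B :: "('o2, 'm2) smcat"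
begin

abbreviation T :: "(('o1, 'o2) word, ('o1, 'm1, 'o2, 'm2) arrow_term set) smcat" where "T \<equiv> tensor A B"
abbreviation "word \<equiv> is_word A B"
abbreviation "arrow \<equiv> is_arrow A B"
abbreviation "dm \<equiv> tdom A B"
abbreviation "cd \<equiv> tcod A B"
abbreviation "cl \<equiv> cls A B"

section \<open>Formal arrows modulo the congruence\<close>

lemma word_dm_cd [simp]: "arrow p \<Longrightarrow> word (dm p) \<and> word (cd p)"
  by (induction p) auto

lemma tcong_parallel: "tcong A B p q \<Longrightarrow> arrow p \<and> arrow q \<and> dm p = dm q \<and> cd p = cd q"
  by (induction rule: tcong.induct) auto

lemma cls_iff: "q \<in> cl p \<longleftrightarrow> tcong A B p q"
  by (simp add: cls_def)

lemma cls_eq_iff: "arrow p \<Longrightarrow> cl p = cl q \<longleftrightarrow> tcong A B p q"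
  by (auto simp: set_eq_iff cls_iff intro: tcong_refl tcong_sym tcong_trans)

text \<open>Together with closure of \<open>tcong\<close> under the operations, this lets every
  operation of \<open>tensor\<close> be computed on classes \<open>cl p\<close>, with
  \<open>rep\<close> eliminated.\<close>

lemma tcong_rep: "arrow p \<Longrightarrow> tcong A B p (rep (cl p))"
  unfolding rep_def cls_iff [symmetric] by (rule someI [of _ p]) (simp add: cls_iff tcong_refl)

lemma rep_cls:
  assumes "arrow p"
  shows "arrow (rep (cl p))" "dm (rep (cl p)) = dm p" "cd (rep (cl p)) = cd p"
  using tcong_parallel [OF tcong_rep [OF assms]] by auto

lemma Obj_tensor [simp]: "Obj T = {X. word X}"
  by (simp add: tensor_def)

lemma cls_Arr [simp]: "arrow p \<Longrightarrow> cl p \<in> Arr T"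
  by (auto simp: tensor_def cls_def quotient_def)

lemma Arr_tensorE:
  assumes "f \<in> Arr T"
  obtains p where "arrow p" "f = cl p"
  using assms by (auto simp: tensor_def cls_def quotient_def)

lemma Dom_Cod_cls [simp]: "arrow p \<Longrightarrow> Dom T (cl p) = dm p" "arrow p \<Longrightarrow> Cod T (cl p) = cd p"
  by (simp_all add: tensor_def rep_cls)

lemma tensor_structure:
  "Ide T X = cl (TIde X)" "UnitO T = WUnit" "TenO T = WTen"
  "Ass T X Y Z = cl (TAss X Y Z)" "Run T X = cl (TRun X)" "Lun T X = cl (TLun X)" "Sym T X Y = cl (TSym X Y)"
  by (simp_all add: tensor_def)

lemma Comp_cls:
  assumes "arrow p" "arrow q" "dm q = cd p"
  shows "cl q \<cdot>\<^bsub>T\<^esub> cl p = cl (q \<bullet> p)"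
proof -
  have "tcong A B (q \<bullet> p) (rep (cl q) \<bullet> rep (cl p))"
    by (rule tcong_comp [OF tcong_rep tcong_rep]) (use assms in auto)
  then show ?thesis using assms by (simp add: tensor_def cls_eq_iff rep_cls tcong_sym)
qed

lemma TenA_cls:
  assumes "arrow p" "arrow q"
  shows "cl p \<odot>\<^bsub>T\<^esub> cl q = cl (TRight p (cd q) \<bullet> TLeft (dm p) q)"
proof -
  have "tcong A B (TRight p (cd q) \<bullet> TLeft (dm p) q) (TRight (rep (cl p)) (cd q) \<bullet> TLeft (dm p) (rep (cl q)))"
    using assms by (auto intro!: tcong_comp tcong_left tcong_right tcong_rep)
  then show ?thesis using assms by (simp add: tensor_def tpar_def cls_eq_iff rep_cls tcong_sym)
qed

lemma cls_eqI:
  "trel A B p q \<Longrightarrow> arrow p \<Longrightarrow> arrow q \<Longrightarrow> dm p = dm q \<Longrightarrow> cd p = cd q \<Longrightarrow> cl p = cl q"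
  by (simp add: cls_eq_iff tcong_rel)

lemma cls_Comp_TIde:
  "arrow p \<Longrightarrow> X = dm p \<Longrightarrow> cl (p \<bullet> TIde X) = cl p"
  "arrow p \<Longrightarrow> X = cd p \<Longrightarrow> cl (TIde X \<bullet> p) = cl p"
  by (rule cls_eqI [OF trel.comp_ide]; simp) (rule cls_eqI [OF trel.ide_comp]; simp)

sublocale T: category T
proof
  fix f g h w x y z
  assume "f \<in> hom T w x" "g \<in> hom T x y" "h \<in> hom T y z"
  then obtain p q r where "arrow p" "f = cl p" "arrow q" "g = cl q" "arrow r" "h = cl r" "dm q
    = cd p" "dm r = cd q"
    by (auto elim!: Arr_tensorE)
  then show "h \<cdot>\<^bsub>T\<^esub> (g \<cdot>\<^bsub>T\<^esub> f) = (h \<cdot>\<^bsub>T\<^esub> g) \<cdot>\<^bsub>T\<^esub> f"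
    by (simp add: Comp_cls) (rule cls_eqI [OF trel.comp_assoc]; simp)
qed (auto elim!: Arr_tensorE simp: tensor_structure Comp_cls cls_Comp_TIde)

lemma left_ide: "word X \<Longrightarrow> word Y \<Longrightarrow> cl (TLeft X (TIde Y)) = Ide T (X \<oplus> Y)"
  unfolding tensor_structure by (rule cls_eqI [OF trel.left_ide]) auto

lemma right_ide: "word X \<Longrightarrow> word Y \<Longrightarrow> cl (TRight (TIde X) Y) = Ide T (X \<oplus> Y)"
  unfolding tensor_structure by (rule cls_eqI [OF trel.right_ide]) auto

lemma left_comp:
  "word X \<Longrightarrow> arrow p \<Longrightarrow> arrow q \<Longrightarrow> dm q = cd p \<Longrightarrow> cl (TLeft X (q \<bullet> p)) = cl (TLeft X q) \<cdot>\<^bsub>T\<^esub> cl (TLeft X p)"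
  by (simp add: Comp_cls) (rule cls_eqI [OF trel.left_comp]; simp)

lemma right_comp:
  "word X \<Longrightarrow> arrow p \<Longrightarrow> arrow q \<Longrightarrow> dm q = cd p \<Longrightarrow> cl (TRight (q \<bullet> p) X) = cl (TRight q X) \<cdot>\<^bsub>T\<^esub> cl (TRight p X)"
  by (simp add: Comp_cls) (rule cls_eqI [OF trel.right_comp]; simp)

lemma left_right:
  assumes "arrow p" "arrow q" "X = cd p" "Y = dm q"
  shows "cl (TLeft X q) \<cdot>\<^bsub>T\<^esub> cl (TRight p Y) = cl (TRight p (cd q)) \<cdot>\<^bsub>T\<^esub> cl (TLeft (dm p) q)"
  using assms by (simp add: Comp_cls) (rule cls_eqI [OF trel.left_right, symmetric]; simp)

lemma TenA_cls': "arrow p \<Longrightarrow> arrow q \<Longrightarrow> cl p \<odot>\<^bsub>T\<^esub> cl q = cl (TRight p (cd q)) \<cdot>\<^bsub>T\<^esub> cl (TLeft (dm p) q)"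
  by (simp add: TenA_cls Comp_cls)

lemma Ide_TenA_cls: "word X \<Longrightarrow> arrow p \<Longrightarrow> cl (TIde X) \<odot>\<^bsub>T\<^esub> cl p = cl (TLeft X p)"
  by (simp add: TenA_cls' right_ide)

lemma cls_TenA_Ide: "word X \<Longrightarrow> arrow p \<Longrightarrow> cl p \<odot>\<^bsub>T\<^esub> cl (TIde X) = cl (TRight p X)"
  by (simp add: TenA_cls' left_ide)

lemma TIde_TenA_TIde: "word X \<Longrightarrow> word Y \<Longrightarrow> cl (TIde X) \<odot>\<^bsub>T\<^esub> cl (TIde Y) = cl (TIde (X \<oplus> Y))"
  by (simp add: Ide_TenA_cls left_ide [unfolded tensor_structure])

lemma inverse_cls:
  assumes "trel A B (p \<bullet> q) (TIde (cd p))" "trel A B (q \<bullet> p) (TIde (dm p))" "arrow p" "arrow q" "dm q = cd p" "cd q = dm p"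
  shows "iso T (cl p)" "inv_arr T (cl p) = cl q"
proof -
  have "cl (q \<bullet> p) = cl (TIde (dm p))"
    by (rule cls_eqI) (use assms in simp_all)
  moreover have "cl (p \<bullet> q) = cl (TIde (cd p))"
    by (rule cls_eqI) (use assms in simp_all)
  ultimately
  show "iso T (cl p)" "inv_arr T (cl p) = cl q"
    using T.isoI [of "cl p" "cl q"] assms by (simp_all add: Comp_cls tensor_structure)
qed

lemma inverse_structure:
  "word X \<Longrightarrow> word Y \<Longrightarrow> word Z \<Longrightarrow> iso T (cl (TAss X Y Z))"
  "word X \<Longrightarrow> word Y \<Longrightarrow> word Z \<Longrightarrow> inv_arr T (cl (TAss X Y Z)) = cl (TAssInv X Y Z)"
  "word X \<Longrightarrow> iso T (cl (TRun X))" "word X \<Longrightarrow> inv_arr T (cl (TRun X)) = cl (TRunInv X)"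
  "word X \<Longrightarrow> iso T (cl (TLun X))" "word X \<Longrightarrow> inv_arr T (cl (TLun X)) = cl (TLunInv X)"
  using inverse_cls [of "TAss X Y Z" "TAssInv X Y Z"] inverse_cls [of "TRun X" "TRunInv X"]
    inverse_cls [of "TLun X" "TLunInv X"]
  by (simp_all add: trel.intros)

text \<open>Expanding both tensors gives four one-sided factors; the relation
  \<open>left_right\<close> exchanges the middle two.\<close>

lemma TenA_Comp_tensor:
  assumes "arrow p" "arrow p'" "arrow q" "arrow q'" "dm p' = cd p" "dm q' = cd q"
  shows "(cl p' \<cdot>\<^bsub>T\<^esub> cl p) \<odot>\<^bsub>T\<^esub> (cl q' \<cdot>\<^bsub>T\<^esub> cl q) = (cl p' \<odot>\<^bsub>T\<^esub> cl q') \<cdot>\<^bsub>T\<^esub> (cl p \<odot>\<^bsub>T\<^esub> cl q)"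
proof -
  have "(cl p' \<cdot>\<^bsub>T\<^esub> cl p) \<odot>\<^bsub>T\<^esub> (cl q' \<cdot>\<^bsub>T\<^esub> cl q)
    = cl (TRight p' (cd q')) \<cdot>\<^bsub>T\<^esub> (cl (TRight p (cd q')) \<cdot>\<^bsub>T\<^esub> cl (TLeft (dm p) q')) \<cdot>\<^bsub>T\<^esub> cl (TLeft (dm p) q)"
    using assms by (simp add: Comp_cls [of p p'] Comp_cls [of q q'] TenA_cls' left_comp right_comp)
  also have "\<dots> = cl (TRight p' (cd q')) \<cdot>\<^bsub>T\<^esub> (cl (TLeft (cd p) q') \<cdot>\<^bsub>T\<^esub> cl (TRight p (cd q)))
    \<cdot>\<^bsub>T\<^esub> cl (TLeft (dm p) q)"
    using assms left_right [of p q' "cd p" "cd q"] by simp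
  also have "\<dots> = (cl p' \<odot>\<^bsub>T\<^esub> cl q') \<cdot>\<^bsub>T\<^esub> (cl p \<odot>\<^bsub>T\<^esub> cl q)"
    using assms by (simp add: TenA_cls')
  finally show ?thesis .
qed

lemma natural_tensor:
  "arrow p \<Longrightarrow> arrow q \<Longrightarrow> arrow r \<Longrightarrow>
    cl (TAss (cd p) (cd q) (cd r)) \<cdot>\<^bsub>T\<^esub> (cl p \<odot>\<^bsub>T\<^esub> (cl q \<odot>\<^bsub>T\<^esub> cl r)) = ((cl p \<odot>\<^bsub>T\<^esub> cl q) \<odot>\<^bsub>T\<^esub> cl r) \<cdot>\<^bsub>T\<^esub> cl (TAss (dm p) (dm q) (dm r))"
  "arrow p \<Longrightarrow> cl (TRun (cd p)) \<cdot>\<^bsub>T\<^esub> (cl p \<odot>\<^bsub>T\<^esub> cl (TIde WUnit)) = cl p \<cdot>\<^bsub>T\<^esub> cl (TRun (dm p))"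
  "arrow p \<Longrightarrow> cl (TLun (cd p)) \<cdot>\<^bsub>T\<^esub> (cl (TIde WUnit) \<odot>\<^bsub>T\<^esub> cl p) = cl p \<cdot>\<^bsub>T\<^esub> cl (TLun (dm p))"
  "arrow p \<Longrightarrow> arrow q \<Longrightarrow> cl (TSym (cd p) (cd q)) \<cdot>\<^bsub>T\<^esub> (cl p \<odot>\<^bsub>T\<^esub> cl q) = (cl q \<odot>\<^bsub>T\<^esub> cl p) \<cdot>\<^bsub>T\<^esub> cl (TSym (dm p) (dm q))"
  subgoal by (simp add: TenA_cls Comp_cls) (rule cls_eqI [OF trel.ass_natural [unfolded tpar_def, of _ _ _ _ _ p q r, simplified]]; simp)
  subgoal by (simp add: cls_TenA_Ide Comp_cls) (rule cls_eqI [OF trel.run_natural]; simp)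
  subgoal by (simp add: Ide_TenA_cls Comp_cls) (rule cls_eqI [OF trel.lun_natural]; simp)
  subgoal by (simp add: TenA_cls Comp_cls) (rule cls_eqI [OF trel.sym_natural [unfolded tpar_def]]; simp)
  done

text \<open>Arrows of the quotient are written as classes of formal arrows; each axiom is then a
  defining relation or one of the lemmas above.\<close>

sublocale T: symmetric_monoidal_category T
proof
  fix f f' g g' x x' x'' y y' y''
  assume "f \<in> hom T x x'" "f' \<in> hom T x' x''" "g \<in> hom T y y'" "g' \<in> hom T y' y''"
  then obtain p p' q q' where "arrow p" "f = cl p" "arrow p'" "f' = cl p'" "arrow q" "g
    = cl q" "arrow q'" "g' = cl q'"
     "dm p' = cd p" "dm q' = cd q"
    by (auto elim!: Arr_tensorE)
  then show "(f' \<cdot>\<^bsub>T\<^esub> f) \<odot>\<^bsub>T\<^esub> (g' \<cdot>\<^bsub>T\<^esub> g) = (f' \<odot>\<^bsub>T\<^esub> g') \<cdot>\<^bsub>T\<^esub> (f \<odot>\<^bsub>T\<^esub> g)"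
    using TenA_Comp_tensor by simp
next
  fix f g x x' y y'
  assume "f \<in> hom T x x'" "g \<in> hom T y y'"
  then obtain p q where "arrow p" "f = cl p" "arrow q" "g = cl q" "x = dm p" "x' = cd p" "y
    = dm q" "y' = cd q"
    by (auto elim!: Arr_tensorE)
  then show "f \<odot>\<^bsub>T\<^esub> g \<in> hom T (TenO T x y) (TenO T x' y')"
    by (simp add: TenA_cls tensor_structure)
next
  fix w x y z assume "w \<in> Obj T" "x \<in> Obj T" "y \<in> Obj T" "z \<in> Obj T"
  then show "Ass T (TenO T w x) y z \<cdot>\<^bsub>T\<^esub> Ass T w x (TenO T y z) =
       (Ass T w x y \<odot>\<^bsub>T\<^esub> Ide T z) \<cdot>\<^bsub>T\<^esub> Ass T w (TenO T x y) z \<cdot>\<^bsub>T\<^esub> (Ide T w \<odot>\<^bsub>T\<^esub> Ass T x y z)"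
    by (simp add: tensor_structure Ide_TenA_cls cls_TenA_Ide Comp_cls) (rule cls_eqI [OF trel.pentagon]; simp)
next
  fix x y z assume "x \<in> Obj T" "y \<in> Obj T" "z \<in> Obj T"
  then show "Ass T z x y \<cdot>\<^bsub>T\<^esub> Sym T (TenO T x y) z \<cdot>\<^bsub>T\<^esub> Ass T x y z =
       (Sym T x z \<odot>\<^bsub>T\<^esub> Ide T y) \<cdot>\<^bsub>T\<^esub> Ass T x z y \<cdot>\<^bsub>T\<^esub> (Ide T x \<odot>\<^bsub>T\<^esub> Sym T y z)"
    by (simp add: tensor_structure Ide_TenA_cls cls_TenA_Ide Comp_cls) (rule cls_eqI [OF trel.hexagon]; simp)
next
  fix x y assume "x \<in> Obj T" "y \<in> Obj T"
  then show "(Run T x \<odot>\<^bsub>T\<^esub> Ide T y) \<cdot>\<^bsub>T\<^esub> Ass T x (UnitO T) y = Ide T x \<odot>\<^bsub>T\<^esub> Lun T y"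
    by (simp add: tensor_structure Ide_TenA_cls cls_TenA_Ide Comp_cls) (rule cls_eqI [OF trel.triangle]; simp)
next
  fix x y assume "x \<in> Obj T" "y \<in> Obj T"
  then show "Sym T y x \<cdot>\<^bsub>T\<^esub> Sym T x y = Ide T (TenO T x y)"
    by (simp add: tensor_structure Comp_cls) (rule cls_eqI [OF trel.sym_sym]; simp)
next
  fix x assume "x \<in> Obj T"
  then show "Lun T x \<cdot>\<^bsub>T\<^esub> Sym T x (UnitO T) = Run T x"
    by (simp add: tensor_structure Comp_cls) (rule cls_eqI [OF trel.lun_sym]; simp)
qed (auto elim!: Arr_tensorE simp: inverse_structure natural_tensor tensor_structure TIde_TenA_TIde)


text \<open>Formal inverses denote actual inverses in the quotient, so the formal term in the
  relation \<open>gamma_delta\<close> denotes the interchange there.\<close>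

lemma interchange_tensor:
  assumes "word W" "word X" "word Y" "word Z"
  shows "interchange T W X Y Z = cl (tinterchange W X Y Z)"
  using assms by (simp add: interchange_def tinterchange_def tensor_structure inverse_structure
    Ide_TenA_cls cls_TenA_Ide Comp_cls)

lemma TenA_tpar: "arrow p \<Longrightarrow> arrow q \<Longrightarrow> cl p \<odot>\<^bsub>T\<^esub> cl q = cl (tpar A B p q)"
  by (simp add: TenA_cls tpar_def)

lemma tpar_simps [simp]:
  "arrow (tpar A B p q) \<longleftrightarrow> arrow p \<and> arrow q"
  "dm (tpar A B p q) = dm p \<oplus> dm q" "cd (tpar A B p q) = cd p \<oplus> cd q"
  by (auto simp: tpar_def)

lemma tinterchange_simps [simp]:
  "arrow (tinterchange W X Y Z) \<longleftrightarrow> word W \<and> word X \<and> word Y \<and> word Z"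
  "dm (tinterchange W X Y Z) = (W \<oplus> X) \<oplus> (Y \<oplus> Z)" "cd (tinterchange W X Y Z) = (W \<oplus> Y) \<oplus> (X \<oplus> Z)"
  by (auto simp: tinterchange_def)

section \<open>The universal functor \<open>eta\<close>\<close>

lemma eta_at_simps [simp]:
  "b \<in> Obj B \<Longrightarrow> FO (eta_at A B a) b = WGen a b"
  "g \<in> Arr B \<Longrightarrow> FA (eta_at A B a) g = cl (TSnd a g)"
  "F0 (eta_at A B a) = cl (TBeta a)"
  "b \<in> Obj B \<Longrightarrow> b' \<in> Obj B \<Longrightarrow> F2 (eta_at A B a) b b' = cl (TDelta a b b')"
  by (simp_all add: eta_at_def)

lemma eta_at_SMF:
  assumes [simp]: "a \<in> Obj A"
  shows "SMF B T (eta_at A B a)" (is "SMF _ _ ?F")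
proof (rule symmetric_monoidal_functorI)
  show "\<And>x. x \<in> Obj B \<Longrightarrow> FA ?F (Ide B x) = Ide T (FO ?F x)"
    by (simp add: tensor_structure) (rule cls_eqI [OF trel.snd_ide]; simp)
  show "\<And>f g. f \<in> Arr B \<Longrightarrow> g \<in> Arr B \<Longrightarrow> Dom B g = Cod B f \<Longrightarrow>
      FA ?F (g \<cdot>\<^bsub>B\<^esub> f) = FA ?F g \<cdot>\<^bsub>T\<^esub> FA ?F f"
    by (simp add: Comp_cls) (rule cls_eqI [OF trel.snd_comp]; simp)
  show "\<And>f g. f \<in> Arr B \<Longrightarrow> g \<in> Arr B \<Longrightarrow>
      F2 ?F (Cod B f) (Cod B g) \<cdot>\<^bsub>T\<^esub> (FA ?F f \<odot>\<^bsub>T\<^esub> FA ?F g) =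
      FA ?F (f \<odot>\<^bsub>B\<^esub> g) \<cdot>\<^bsub>T\<^esub> F2 ?F (Dom B f) (Dom B g)"
    by (simp add: Comp_cls TenA_tpar) (rule cls_eqI [OF trel.delta_natural]; simp)
  show "\<And>x y z. x \<in> Obj B \<Longrightarrow> y \<in> Obj B \<Longrightarrow> z \<in> Obj B \<Longrightarrow>
      FA ?F (Ass B x y z) \<cdot>\<^bsub>T\<^esub> F2 ?F x (y \<otimes>\<^bsub>B\<^esub> z) \<cdot>\<^bsub>T\<^esub>
        (Ide T (FO ?F x) \<odot>\<^bsub>T\<^esub> F2 ?F y z) =
      F2 ?F (x \<otimes>\<^bsub>B\<^esub> y) z \<cdot>\<^bsub>T\<^esub> (F2 ?F x y \<odot>\<^bsub>T\<^esub> Ide T (FO ?F z)) \<cdot>\<^bsub>T\<^esub>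
        Ass T (FO ?F x) (FO ?F y) (FO ?F z)"
    by (simp add: tensor_structure Comp_cls Ide_TenA_cls cls_TenA_Ide) (rule cls_eqI [OF trel.delta_ass]; simp)
  show "\<And>x. x \<in> Obj B \<Longrightarrow> FA ?F (Run B x) \<cdot>\<^bsub>T\<^esub> F2 ?F x (UnitO B) \<cdot>\<^bsub>T\<^esub>
        (Ide T (FO ?F x) \<odot>\<^bsub>T\<^esub> F0 ?F) = Run T (FO ?F x)"
    by (simp add: tensor_structure Comp_cls Ide_TenA_cls cls_TenA_Ide) (rule cls_eqI [OF trel.delta_run]; simp)
  show "\<And>x. x \<in> Obj B \<Longrightarrow> FA ?F (Lun B x) \<cdot>\<^bsub>T\<^esub> F2 ?F (UnitO B) x \<cdot>\<^bsub>T\<^esub>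
        (F0 ?F \<odot>\<^bsub>T\<^esub> Ide T (FO ?F x)) = Lun T (FO ?F x)"
    by (simp add: tensor_structure Comp_cls Ide_TenA_cls cls_TenA_Ide) (rule cls_eqI [OF trel.delta_lun]; simp)
  show "\<And>x y. x \<in> Obj B \<Longrightarrow> y \<in> Obj B \<Longrightarrow> FA ?F (Sym B x y) \<cdot>\<^bsub>T\<^esub> F2 ?F x y =
      F2 ?F y x \<cdot>\<^bsub>T\<^esub> Sym T (FO ?F x) (FO ?F y)"
    by (simp add: tensor_structure Comp_cls) (rule cls_eqI [OF trel.delta_sym]; simp)
qed (auto simp: B.SMC_axioms T.SMC_axioms tensor_structure,
     simp_all add: eta_at_def)

lemma eta_simps [simp]:
  "a \<in> Obj A \<Longrightarrow> FO (eta A B) a = eta_at A B a"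
  "Src (F0 (eta A B)) = unit_functor B T" "Tgt (F0 (eta A B)) = eta_at A B (UnitO A)"
  "b \<in> Obj B \<Longrightarrow> Cmp (F0 (eta A B)) b = cl (TAlpha b)"
  "Cmp (F0 (eta A B)) \<in> extensional (Obj B)"
  by (simp_all add: eta_def)

lemma eta_FA [simp]:
  assumes "f \<in> Arr A"
  shows "Src (FA (eta A B) f) = eta_at A B (Dom A f)" "Tgt (FA (eta A B) f) = eta_at A B (Cod A f)"
  "b \<in> Obj B \<Longrightarrow> Cmp (FA (eta A B) f) b = cl (TFst f b)"
  "Cmp (FA (eta A B) f) \<in> extensional (Obj B)"
  using assms by (simp_all add: eta_def)

lemma eta_F2 [simp]:
  assumes "a \<in> Obj A" "a' \<in> Obj A"
  shows "Src (F2 (eta A B) a a') = box_functor B T (eta_at A B a) (eta_at A B a')"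
  "Tgt (F2 (eta A B) a a') = eta_at A B (a \<otimes>\<^bsub>A\<^esub> a')"
  "b \<in> Obj B \<Longrightarrow> Cmp (F2 (eta A B) a a') b = cl (TGamma a a' b)"
  "Cmp (F2 (eta A B) a a') \<in> extensional (Obj B)"
  using assms by (simp_all add: eta_def)

text \<open>Naturality, the unit equation and the tensor equation are the relations
  \<open>snd_alpha\<close>, \<open>beta_alpha\<close> and \<open>alpha_delta\<close>.\<close>

lemma eta_F0_MT: "MT B T (F0 (eta A B))" (is "MT _ _ ?\<sigma>")
proof (rule monoidal_transformationI)
  fix g assume [simp]: "g \<in> Arr B"
  have "cl (TSnd (UnitO A) g \<bullet> TAlpha (Dom B g)) = cl (TAlpha (Cod B g))"
    by (rule cls_eqI [OF trel.snd_alpha]) auto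
  then show "Cmp ?\<sigma> (Cod B g) \<cdot>\<^bsub>T\<^esub> FA (Src ?\<sigma>) g = FA (Tgt ?\<sigma>) g \<cdot>\<^bsub>T\<^esub> Cmp ?\<sigma> (Dom B g)"
    by (simp add: tensor_structure Comp_cls cls_Comp_TIde)
next
  have "cl (TBeta (UnitO A)) = cl (TAlpha (UnitO B))"
    by (rule cls_eqI [OF trel.beta_alpha]) auto
  then show "Cmp ?\<sigma> (UnitO B) \<cdot>\<^bsub>T\<^esub> F0 (Src ?\<sigma>) = F0 (Tgt ?\<sigma>)"
    by (simp add: tensor_structure Comp_cls cls_Comp_TIde)
next
  fix x y assume [simp]: "x \<in> Obj B" "y \<in> Obj B"
  show "Cmp ?\<sigma> (x \<otimes>\<^bsub>B\<^esub> y) \<cdot>\<^bsub>T\<^esub> F2 (Src ?\<sigma>) x y =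
       F2 (Tgt ?\<sigma>) x y \<cdot>\<^bsub>T\<^esub> (Cmp ?\<sigma> x \<odot>\<^bsub>T\<^esub> Cmp ?\<sigma> y)"
    by (simp add: tensor_structure Comp_cls TenA_tpar) (rule cls_eqI [OF trel.alpha_delta]; simp)
qed (auto intro!: unit_functor_SMF eta_at_SMF B.SMC_axioms T.SMC_axioms simp: tensor_structure)

lemma eta_FA_MT:
  assumes [simp]: "f \<in> Arr A"
  shows "MT B T (FA (eta A B) f)" (is "MT _ _ ?\<sigma>")
proof (rule monoidal_transformationI)
  fix g assume [simp]: "g \<in> Arr B"
  show "Cmp ?\<sigma> (Cod B g) \<cdot>\<^bsub>T\<^esub> FA (Src ?\<sigma>) g = FA (Tgt ?\<sigma>) g \<cdot>\<^bsub>T\<^esub> Cmp ?\<sigma> (Dom B g)"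
    by (simp add: Comp_cls) (rule cls_eqI [OF trel.fst_snd]; simp)
next
  show "Cmp ?\<sigma> (UnitO B) \<cdot>\<^bsub>T\<^esub> F0 (Src ?\<sigma>) = F0 (Tgt ?\<sigma>)"
    by (simp add: Comp_cls) (rule cls_eqI [OF trel.fst_beta]; simp)
next
  fix x y assume [simp]: "x \<in> Obj B" "y \<in> Obj B"
  show "Cmp ?\<sigma> (x \<otimes>\<^bsub>B\<^esub> y) \<cdot>\<^bsub>T\<^esub> F2 (Src ?\<sigma>) x y =
       F2 (Tgt ?\<sigma>) x y \<cdot>\<^bsub>T\<^esub> (Cmp ?\<sigma> x \<odot>\<^bsub>T\<^esub> Cmp ?\<sigma> y)"
    by (simp add: Comp_cls TenA_tpar) (rule cls_eqI [OF trel.fst_delta]; simp)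
qed (auto intro!: eta_at_SMF)

lemma eta_F2_MT:
  assumes [simp]: "a \<in> Obj A" "a' \<in> Obj A"
  shows "MT B T (F2 (eta A B) a a')" (is "MT _ _ ?\<sigma>")
proof (rule monoidal_transformationI)
  fix g assume [simp]: "g \<in> Arr B"
  show "Cmp ?\<sigma> (Cod B g) \<cdot>\<^bsub>T\<^esub> FA (Src ?\<sigma>) g = FA (Tgt ?\<sigma>) g \<cdot>\<^bsub>T\<^esub> Cmp ?\<sigma> (Dom B g)"
    by (simp add: Comp_cls TenA_tpar) (rule cls_eqI [OF trel.snd_gamma, symmetric]; simp)
next
  have "cl (TGamma a a' (UnitO B)) \<cdot>\<^bsub>T\<^esub> (cl (TBeta a) \<odot>\<^bsub>T\<^esub> cl (TBeta a')) = cl (TBeta (a \<otimes>\<^bsub>A\<^esub> a')) \<cdot>\<^bsub>T\<^esub> Run T WUnit"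
    by (simp add: tensor_structure Comp_cls TenA_tpar) (rule cls_eqI [OF trel.beta_gamma, symmetric]; simp)
  \<comment> \<open>The relation \<open>beta_gamma\<close> has \<open>Run\<close> next to
    \<open>TBeta\<close>, whereas \<open>F0\<close> of the box functor contains its inverse;
    multiplication by the inverse moves it across.\<close>
  then have "(cl (TGamma a a' (UnitO B)) \<cdot>\<^bsub>T\<^esub> (cl (TBeta a) \<odot>\<^bsub>T\<^esub> cl (TBeta a')))
    \<cdot>\<^bsub>T\<^esub> inv_arr T (Run T WUnit) = cl (TBeta (a \<otimes>\<^bsub>A\<^esub> a'))"
    using T.Run_simps(4) [of WUnit] by (simp add: tensor_structure(2-))
  then show "Cmp ?\<sigma> (UnitO B) \<cdot>\<^bsub>T\<^esub> F0 (Src ?\<sigma>) = F0 (Tgt ?\<sigma>)"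
    by (simp add: tensor_structure inverse_structure(3))
next
  fix x y assume [simp]: "x \<in> Obj B" "y \<in> Obj B"
  let ?x = "WGen a x" and ?y = "WGen a' x" and ?z = "WGen a y" and ?w = "WGen a' y"
  have "cl (TGamma a a' (x \<otimes>\<^bsub>B\<^esub> y)) \<cdot>\<^bsub>T\<^esub> (cl (TDelta a x y) \<odot>\<^bsub>T\<^esub> cl (TDelta a' x y)) =
     cl (TDelta (a \<otimes>\<^bsub>A\<^esub> a') x y) \<cdot>\<^bsub>T\<^esub> (cl (TGamma a a' x) \<odot>\<^bsub>T\<^esub> cl (TGamma a a' y)) \<cdot>\<^bsub>T\<^esub> interchange T ?x ?z ?y ?w"
    by (simp add: Comp_cls TenA_tpar interchange_tensor) (rule cls_eqI [OF trel.gamma_delta]; simp)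
  \<comment> \<open>The relation \<open>gamma_delta\<close> has the interchange on the opposite side
    from the monoidality equation. The interchange with its middle arguments exchanged is inverse to
    it and moves it across.\<close>
  then have "(cl (TGamma a a' (x \<otimes>\<^bsub>B\<^esub> y)) \<cdot>\<^bsub>T\<^esub> (cl (TDelta a x y) \<odot>\<^bsub>T\<^esub> cl (TDelta a' x y)))
    \<cdot>\<^bsub>T\<^esub> interchange T ?x ?y ?z ?w =
     cl (TDelta (a \<otimes>\<^bsub>A\<^esub> a') x y) \<cdot>\<^bsub>T\<^esub> (cl (TGamma a a' x) \<odot>\<^bsub>T\<^esub> cl (TGamma a a' y))"
    using T.interchange_interchange [of ?x ?z ?y ?w] by (simp add: tensor_structure(2-))
  then show "Cmp ?\<sigma> (x \<otimes>\<^bsub>B\<^esub> y) \<cdot>\<^bsub>T\<^esub> F2 (Src ?\<sigma>) x y =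
       F2 (Tgt ?\<sigma>) x y \<cdot>\<^bsub>T\<^esub> (Cmp ?\<sigma> x \<odot>\<^bsub>T\<^esub> Cmp ?\<sigma> y)"
    by (simp add: tensor_structure)
qed (auto intro!: eta_at_SMF box_functor_SMF simp: tensor_structure)

text \<open>Equations between transformations are tested at each \<open>b\<close>, where they become
  the relations that make \<open>- \<otimes> b\<close> a symmetric monoidal functor.\<close>

theorem eta_SMF: "SMF A \<lbrakk>B, T\<rbrakk> (eta A B)" (is "SMF _ _ ?F")
proof -
  let ?H = "\<lbrakk>B, T\<rbrakk>"
  note eqI = smtrans_eqI [where X = "Obj B"]
  show ?thesis
  proof (rule symmetric_monoidal_functorI)
    show "symmetric_monoidal_category A" "symmetric_monoidal_category ?H"
      by (auto intro: A.SMC_axioms internal_hom_SMC B.SMC_axioms T.SMC_axioms)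
  next
    fix x y z assume [simp]: "x \<in> Obj A" "y \<in> Obj A" "z \<in> Obj A"
    show "FA ?F (Ide A x) = Ide ?H (FO ?F x)"
      by (rule eqI; simp add: tensor_structure) (rule cls_eqI [OF trel.fst_ide]; simp)
    show "FA ?F (Ass A x y z) \<cdot>\<^bsub>?H\<^esub> F2 ?F x (y \<otimes>\<^bsub>A\<^esub> z) \<cdot>\<^bsub>?H\<^esub>
          (Ide ?H (FO ?F x) \<odot>\<^bsub>?H\<^esub> F2 ?F y z) =
        F2 ?F (x \<otimes>\<^bsub>A\<^esub> y) z \<cdot>\<^bsub>?H\<^esub> (F2 ?F x y \<odot>\<^bsub>?H\<^esub> Ide ?H (FO ?F z)) \<cdot>\<^bsub>?H\<^esub>
          Ass ?H (FO ?F x) (FO ?F y) (FO ?F z)"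
      by (rule eqI; simp add: tensor_structure Comp_cls Ide_TenA_cls cls_TenA_Ide) (rule cls_eqI [OF trel.gamma_ass]; simp)
    show "FA ?F (Run A x) \<cdot>\<^bsub>?H\<^esub> F2 ?F x (UnitO A) \<cdot>\<^bsub>?H\<^esub>
          (Ide ?H (FO ?F x) \<odot>\<^bsub>?H\<^esub> F0 ?F) = Run ?H (FO ?F x)"
      by (rule eqI; simp add: tensor_structure Comp_cls Ide_TenA_cls cls_TenA_Ide) (rule cls_eqI [OF trel.gamma_run]; simp)
    show "FA ?F (Lun A x) \<cdot>\<^bsub>?H\<^esub> F2 ?F (UnitO A) x \<cdot>\<^bsub>?H\<^esub>
          (F0 ?F \<odot>\<^bsub>?H\<^esub> Ide ?H (FO ?F x)) = Lun ?H (FO ?F x)"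
      by (rule eqI; simp add: tensor_structure Comp_cls Ide_TenA_cls cls_TenA_Ide) (rule cls_eqI [OF trel.gamma_lun]; simp)
    show "FA ?F (Sym A x y) \<cdot>\<^bsub>?H\<^esub> F2 ?F x y =
        F2 ?F y x \<cdot>\<^bsub>?H\<^esub> Sym ?H (FO ?F x) (FO ?F y)"
      by (rule eqI; simp add: tensor_structure Comp_cls) (rule cls_eqI [OF trel.gamma_sym]; simp)
  next
    fix f g assume [simp]: "f \<in> Arr A" "g \<in> Arr A"
    show "F2 ?F (Cod A f) (Cod A g) \<cdot>\<^bsub>?H\<^esub> (FA ?F f \<odot>\<^bsub>?H\<^esub> FA ?F g) =
        FA ?F (f \<odot>\<^bsub>A\<^esub> g) \<cdot>\<^bsub>?H\<^esub> F2 ?F (Dom A f) (Dom A g)"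
      by (rule eqI; simp add: Comp_cls TenA_tpar) (rule cls_eqI [OF trel.gamma_natural]; simp)
    assume [simp]: "Dom A g = Cod A f"
    show "FA ?F (g \<cdot>\<^bsub>A\<^esub> f) = FA ?F g \<cdot>\<^bsub>?H\<^esub> FA ?F f"
      by (rule eqI; simp add: Comp_cls) (rule cls_eqI [OF trel.fst_comp]; simp)
  qed (auto intro: eta_at_SMF eta_F0_MT eta_FA_MT eta_F2_MT, simp_all add: eta_def)
qed

end

section \<open>The functor En\<close>

context symmetric_monoidal_category
begin

text \<open>Serves the formal inverse generators: a naturality square for a constraint yields the
  square for its inverse.\<close>

lemma iso_square_inverse:
  assumes sq: "k \<cdot> f = g \<cdot> h" and iso: "iso C f" "iso C g" and "h \<in> Arr C" "k \<in> Arr C"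
    and "Dom C f = Dom C h" "Cod C f = Dom C k" "Dom C g = Cod C h" "Cod C g = Cod C k"
  shows "inv_arr C g \<cdot> k = h \<cdot> inv_arr C f"
proof -
  have "inv_arr C g \<cdot> k = inv_arr C g \<cdot> (k \<cdot> f) \<cdot> inv_arr C f"
    using assms(2-) iso [THEN iso_Arr] by simp
  also have "\<dots> = h \<cdot> inv_arr C f"
    unfolding sq using assms(2-) iso [THEN iso_Arr] by simp
  finally show ?thesis .
qed

lemma Run_inv_nat: "f \<in> Arr C \<Longrightarrow> x = Cod C f \<Longrightarrow> inv_arr C (Run C x) \<cdot> f = (f \<odot> Ide C (UnitO C))
  \<cdot> inv_arr C (Run C (Dom C f))"
  by (rule iso_square_inverse) (auto simp: Run_nat)

lemma Lun_inv_nat: "f \<in> Arr C \<Longrightarrow> x = Cod C f \<Longrightarrow> inv_arr C (Lun C x) \<cdot> f = (Ide C (UnitO C) \<odot> f)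
  \<cdot> inv_arr C (Lun C (Dom C f))"
  by (rule iso_square_inverse) (auto simp: Lun_nat)

end

locale tensor_hom = tensor_product A B + C: symmetric_monoidal_category C
  for A :: "('o1, 'm1) smcat" and B :: "('o2, 'm2) smcat" and C :: "('o3, 'm3) smcat" (structure)

sublocale tensor_hom \<subseteq> BC: symmetric_monoidal_category "\<lbrakk>B, C\<rbrakk>"
  by (rule internal_hom_SMC) (rule B.SMC_axioms C.SMC_axioms)+

text \<open>The lemmas of this locale evaluate the axioms of \<open>F\<close> at objects of
  \<open>B\<close>. They become equations in \<open>C\<close> of the shape that
  \<open>en_term\<close> gives to the defining relations.\<close>

locale curried_functor = tensor_hom A B C + F: symmetric_monoidal_functor A "\<lbrakk>B, C\<rbrakk>" F
  for A :: "('o1, 'm1) smcat" and B :: "('o2, 'm2) smcat" and C :: "('o3, 'm3) smcat" (structure)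
    and F :: "('o1, 'm1, 'o2, 'm2, 'o3, 'm3) curried_fun"
begin

lemma at_SMF: "a \<in> Obj A \<Longrightarrow> SMF B C (FO F a)"
  using F.FO_in_Obj by simp

lemma FA_MT: "f \<in> Arr A \<Longrightarrow> MT B C (FA F f)"
  using F.FA_simps(1) by simp

lemma F0_MT: "MT B C (F0 F)"
  using F.F0_simps(1) by simp

lemma F2_MT: "a \<in> Obj A \<Longrightarrow> a' \<in> Obj A \<Longrightarrow> MT B C (F2 F a a')"
  using F.F2_simps(1) by simp

lemma Src_Tgt [simp]:
  "f \<in> Arr A \<Longrightarrow> Src (FA F f) = FO F (Dom A f)" "f \<in> Arr A \<Longrightarrow> Tgt (FA F f) = FO F (Cod A f)"
  "Src (F0 F) = unit_functor B C" "Tgt (F0 F) = FO F (UnitO A)"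
  "a \<in> Obj A \<Longrightarrow> a' \<in> Obj A \<Longrightarrow> Src (F2 F a a') = box_functor B C (FO F a) (FO F a')"
  "a \<in> Obj A \<Longrightarrow> a' \<in> Obj A \<Longrightarrow> Tgt (F2 F a a') = FO F (a \<otimes>\<^bsub>A\<^esub> a')"
  using F.FA_simps(2,3) [of f] F.F0_simps(2,3) F.F2_simps(2,3) [of a a'] by simp_all

lemma at_simps [simp]:
  assumes "a \<in> Obj A"
  shows "b \<in> Obj B \<Longrightarrow> FO (FO F a) b \<in> Obj C"
    "g \<in> Arr B \<Longrightarrow> FA (FO F a) g \<in> Arr C"
    "g \<in> Arr B \<Longrightarrow> Dom C (FA (FO F a) g) = FO (FO F a) (Dom B g)"
    "g \<in> Arr B \<Longrightarrow> Cod C (FA (FO F a) g) = FO (FO F a) (Cod B g)"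
    "b \<in> Obj B \<Longrightarrow> FA (FO F a) (Ide B b) = Ide C (FO (FO F a) b)"
    "g \<in> Arr B \<Longrightarrow> h \<in> Arr B \<Longrightarrow> Dom B h = Cod B g \<Longrightarrow> FA (FO F a) (h \<cdot>\<^bsub>B\<^esub> g) = FA (FO F a) h \<cdot> FA (FO F a) g"
    "F0 (FO F a) \<in> Arr C" "Dom C (F0 (FO F a)) = UnitO C" "Cod C (F0 (FO F a)) = FO (FO F a) (UnitO B)"
    "b \<in> Obj B \<Longrightarrow> b' \<in> Obj B \<Longrightarrow> F2 (FO F a) b b' \<in> Arr C"
    "b \<in> Obj B \<Longrightarrow> b' \<in> Obj B \<Longrightarrow> Dom C (F2 (FO F a) b b') = FO (FO F a) b \<otimes> FO (FO F a) b'"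
    "b \<in> Obj B \<Longrightarrow> b' \<in> Obj B \<Longrightarrow> Cod C (F2 (FO F a) b b') = FO (FO F a) (b \<otimes>\<^bsub>B\<^esub> b')"
  using symmetric_monoidal_functor.FO_in_Obj [OF at_SMF] symmetric_monoidal_functor.FA_simps [OF at_SMF]
    symmetric_monoidal_functor.FA_Ide_eq [OF at_SMF] symmetric_monoidal_functor.FA_Comp_eq [OF at_SMF]
    symmetric_monoidal_functor.F0_simps [OF at_SMF] symmetric_monoidal_functor.F2_simps [OF at_SMF] assms
  by auto

lemmas at_equations =
  symmetric_monoidal_functor.F2_nat [OF at_SMF] symmetric_monoidal_functor.F2_Ass [OF at_SMF]
  symmetric_monoidal_functor.F2_Run [OF at_SMF] symmetric_monoidal_functor.F2_Lun [OF at_SMF]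
  symmetric_monoidal_functor.F2_Sym [OF at_SMF]

lemma Cmp_FA [simp]:
  assumes "f \<in> Arr A" "b \<in> Obj B"
  shows "Cmp (FA F f) b \<in> Arr C" "Dom C (Cmp (FA F f) b) = FO (FO F (Dom A f)) b"
    "Cod C (Cmp (FA F f) b) = FO (FO F (Cod A f)) b"
  using monoidal_transformation.Cmp_simps [OF FA_MT] assms by simp_all

lemma Cmp_F0 [simp]:
  assumes "b \<in> Obj B"
  shows "Cmp (F0 F) b \<in> Arr C" "Dom C (Cmp (F0 F) b) = UnitO C" "Cod C (Cmp (F0 F) b) = FO (FO F (UnitO A)) b"
  using monoidal_transformation.Cmp_simps [OF F0_MT] assms by simp_all

lemma Cmp_F2 [simp]:
  assumes "a \<in> Obj A" "a' \<in> Obj A" "b \<in> Obj B"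
  shows "Cmp (F2 F a a') b \<in> Arr C" "Dom C (Cmp (F2 F a a') b) = FO (FO F a) b \<otimes> FO (FO F a') b"
    "Cod C (Cmp (F2 F a a') b) = FO (FO F (a \<otimes>\<^bsub>A\<^esub> a')) b"
  using monoidal_transformation.Cmp_simps [OF F2_MT] assms by simp_all

lemma FA_equations:
  assumes "f \<in> Arr A"
  shows "g \<in> Arr B \<Longrightarrow> Cmp (FA F f) (Cod B g) \<cdot> FA (FO F (Dom A f)) g = FA (FO F (Cod A f)) g
    \<cdot> Cmp (FA F f) (Dom B g)"
    "Cmp (FA F f) (UnitO B) \<cdot> F0 (FO F (Dom A f)) = F0 (FO F (Cod A f))"
    "b \<in> Obj B \<Longrightarrow> b' \<in> Obj B \<Longrightarrow> Cmp (FA F f) (b \<otimes>\<^bsub>B\<^esub> b') \<cdot> F2 (FO F (Dom A f)) b b'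
      = F2 (FO F (Cod A f)) b b' \<cdot> (Cmp (FA F f) b \<odot> Cmp (FA F f) b')"
  using monoidal_transformation.Cmp_nat [OF FA_MT] monoidal_transformation.Cmp_F0 [OF FA_MT]
    monoidal_transformation.Cmp_F2 [OF FA_MT] assms by simp_all

lemma F0_equations:
  "g \<in> Arr B \<Longrightarrow> FA (FO F (UnitO A)) g \<cdot> Cmp (F0 F) (Dom B g) = Cmp (F0 F) (Cod B g)"
  "F0 (FO F (UnitO A)) = Cmp (F0 F) (UnitO B)"
  "b \<in> Obj B \<Longrightarrow> b' \<in> Obj B \<Longrightarrow> Cmp (F0 F) (b \<otimes>\<^bsub>B\<^esub> b') \<cdot> Run C (UnitO C) = F2 (FO F (UnitO A)) b b'
    \<cdot> (Cmp (F0 F) b \<odot> Cmp (F0 F) b')"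
  using monoidal_transformation.Cmp_nat [OF F0_MT, of g "Cod B g"] monoidal_transformation.Cmp_F0 [OF F0_MT]
    monoidal_transformation.Cmp_F2 [OF F0_MT, of b b'] by simp_all

lemma F2_equations:
  assumes [simp]: "a \<in> Obj A" "a' \<in> Obj A"
  shows "g \<in> Arr B \<Longrightarrow> FA (FO F (a \<otimes>\<^bsub>A\<^esub> a')) g \<cdot> Cmp (F2 F a a') (Dom B g) = Cmp (F2 F a a') (Cod B g)
    \<cdot> (FA (FO F a) g \<odot> FA (FO F a') g)"
    "F0 (FO F (a \<otimes>\<^bsub>A\<^esub> a')) \<cdot> Run C (UnitO C) = Cmp (F2 F a a') (UnitO B) \<cdot> (F0 (FO F a) \<odot> F0 (FO F a'))"
    "b \<in> Obj B \<Longrightarrow> b' \<in> Obj B \<Longrightarrow> Cmp (F2 F a a') (b \<otimes>\<^bsub>B\<^esub> b') \<cdot> (F2 (FO F a) b b' \<odot> F2 (FO F a') b b') =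
      F2 (FO F (a \<otimes>\<^bsub>A\<^esub> a')) b b' \<cdot> (Cmp (F2 F a a') b \<odot> Cmp (F2 F a a') b')
       \<cdot> interchange C (FO (FO F a) b) (FO (FO F a) b') (FO (FO F a') b) (FO (FO F a') b')"
proof -
  interpret t: monoidal_transformation B C "F2 F a a'" by (rule F2_MT) auto
  show "g \<in> Arr B \<Longrightarrow> FA (FO F (a \<otimes>\<^bsub>A\<^esub> a')) g \<cdot> Cmp (F2 F a a') (Dom B g) = Cmp (F2 F a a') (Cod B g)
    \<cdot> (FA (FO F a) g \<odot> FA (FO F a') g)"
    using t.Cmp_nat [of g "Cod B g"] by simp
  show "F0 (FO F (a \<otimes>\<^bsub>A\<^esub> a')) \<cdot> Run C (UnitO C) = Cmp (F2 F a a') (UnitO B) \<cdot> (F0 (FO F a) \<odot> F0 (FO F a'))"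
    using t.Cmp_F0 [symmetric] by simp
  assume [simp]: "b \<in> Obj B" "b' \<in> Obj B"
  let ?m = "interchange C (FO (FO F a) b) (FO (FO F a) b') (FO (FO F a') b) (FO (FO F a') b')"
  \<comment> \<open>Monoidality of \<open>F2 F a a'\<close> has an interchange on its left side;
    composing with \<open>?m\<close>, which is inverse to it, gives the shape of
    \<open>gamma_delta\<close>.\<close>
  have "(Cmp (F2 F a a') (b \<otimes>\<^bsub>B\<^esub> b') \<cdot> F2 (Src (F2 F a a')) b b') \<cdot> ?m = (F2 (Tgt (F2 F a a')) b b'
    \<cdot> (Cmp (F2 F a a') b \<odot> Cmp (F2 F a a') b')) \<cdot> ?m"
    by (subst t.Cmp_F2) auto
  then show "Cmp (F2 F a a') (b \<otimes>\<^bsub>B\<^esub> b') \<cdot> (F2 (FO F a) b b' \<odot> F2 (FO F a') b b') =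
      F2 (FO F (a \<otimes>\<^bsub>A\<^esub> a')) b b' \<cdot> (Cmp (F2 F a a') b \<odot> Cmp (F2 F a a') b') \<cdot> ?m"
    by simp
qed

lemma gamma_equations:
  assumes [simp]: "b \<in> Obj B"
  shows "f \<in> Arr A \<Longrightarrow> g \<in> Arr A \<Longrightarrow> Cmp (F2 F (Cod A f) (Cod A g)) b \<cdot> (Cmp (FA F f) b \<odot> Cmp (FA F g) b) =
      Cmp (FA F (f \<odot>\<^bsub>A\<^esub> g)) b \<cdot> Cmp (F2 F (Dom A f) (Dom A g)) b"
    "a \<in> Obj A \<Longrightarrow> a' \<in> Obj A \<Longrightarrow> a'' \<in> Obj A \<Longrightarrow>
      Cmp (FA F (Ass A a a' a'')) b \<cdot> Cmp (F2 F a (a' \<otimes>\<^bsub>A\<^esub> a'')) b \<cdot> (Ide C (FO (FO F a) b) \<odot> Cmp (F2 F a' a'') b) =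
      Cmp (F2 F (a \<otimes>\<^bsub>A\<^esub> a') a'') b \<cdot> (Cmp (F2 F a a') b \<odot> Ide C (FO (FO F a'') b)) \<cdot> Ass C (FO (FO F a) b) (FO (FO F a') b) (FO (FO F a'') b)"
    "a \<in> Obj A \<Longrightarrow> Cmp (FA F (Run A a)) b \<cdot> Cmp (F2 F a (UnitO A)) b
      \<cdot> (Ide C (FO (FO F a) b) \<odot> Cmp (F0 F) b) = Run C (FO (FO F a) b)"
    "a \<in> Obj A \<Longrightarrow> Cmp (FA F (Lun A a)) b \<cdot> Cmp (F2 F (UnitO A) a) b
      \<cdot> (Cmp (F0 F) b \<odot> Ide C (FO (FO F a) b)) = Lun C (FO (FO F a) b)"
    "a \<in> Obj A \<Longrightarrow> a' \<in> Obj A \<Longrightarrow> Cmp (FA F (Sym A a a')) b \<cdot> Cmp (F2 F a a') b = Cmp (F2 F a' a) b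
      \<cdot> Sym C (FO (FO F a) b) (FO (FO F a') b)"
  using arg_cong [OF F.F2_nat [of f g "Cod A f" "Cod A g"], of "\<lambda>\<sigma>. Cmp \<sigma> b"] arg_cong [OF F.F2_Ass [of a a' a''], of "\<lambda>\<sigma>. Cmp \<sigma> b"]
    arg_cong [OF F.F2_Run [of a], of "\<lambda>\<sigma>. Cmp \<sigma> b"] arg_cong [OF F.F2_Lun [of a], of "\<lambda>\<sigma>. Cmp \<sigma> b"]
    arg_cong [OF F.F2_Sym [of a a'], of "\<lambda>\<sigma>. Cmp \<sigma> b"]
  by simp_all

lemma en_word_Obj [simp]: "word X \<Longrightarrow> en_word C F X \<in> Obj C"
  by (induction X) auto

lemma en_term_simps [simp]:
  assumes "arrow p"
  shows "en_term C F p \<in> Arr C" "Dom C (en_term C F p) = en_word C F (dm p)" "Cod C (en_term C F p)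
    = en_word C F (cd p)"
  using assms by (induction p) auto

lemma en_term_tpar [simp]: "arrow p \<Longrightarrow> arrow q \<Longrightarrow> en_term C F (tpar A B p q) = en_term C F p \<odot> en_term C F q"
  by (simp add: tpar_def)

lemma en_term_tinterchange [simp]:
  "en_term C F (tinterchange W X Y Z)
    = interchange C (en_word C F W) (en_word C F X) (en_word C F Y) (en_word C F Z)"
  by (simp add: tinterchange_def interchange_def)

text \<open>One case for each defining relation: those of the symmetric monoidal structure hold in
  \<open>C\<close>, the others are axioms of \<open>F\<close>, of the functors
  \<open>FO F a\<close>, or of the transformations \<open>FA F f\<close>, \<open>F0 F\<close> and
  \<open>F2 F a a'\<close>.\<close>

lemma en_term_trel:
  assumes "trel A B p q" "arrow p" "arrow q" "dm p = dm q" "cd p = cd q"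
  shows "en_term C F p = en_term C F q"
  using assms
  by (cases rule: trel.cases)
    (auto simp: C.Ass_nat C.Run_nat C.Lun_nat C.Sym_nat C.pentagon C.triangle C.Lun_Sym C.hexagon
       at_equations gamma_equations FA_equations F0_equations F2_equations)

lemma en_term_tcong: "tcong A B p q \<Longrightarrow> en_term C F p = en_term C F q"
proof (induction rule: tcong.induct)
  case (tcong_rel p q)
  then show ?case by (intro en_term_trel)
qed auto

lemma En_simps [simp]:
  "word X \<Longrightarrow> FO (En A B C F) X = en_word C F X"
  "arrow p \<Longrightarrow> FA (En A B C F) (cl p) = en_term C F p"
  "F0 (En A B C F) = Ide C (UnitO C)"
  "word X \<Longrightarrow> word Y \<Longrightarrow> F2 (En A B C F) X Y = Ide C (en_word C F X \<otimes> en_word C F Y)"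
  using en_term_tcong [OF tcong_rep] by (simp_all add: En_def)

text \<open>All constraints being identities, the axioms reduce to the recursive clauses of
  \<open>en_word\<close> and \<open>en_term\<close>.\<close>

theorem En_SMF: "SMF T C (En A B C F)" (is "SMF _ _ ?F")
proof (rule symmetric_monoidal_functorI)
  fix f g assume "f \<in> Arr T" "g \<in> Arr T"
  then obtain p q where "arrow p" "f = cl p" "arrow q" "g = cl q"
    by (auto elim!: Arr_tensorE)
  then show "F2 ?F (Cod T f) (Cod T g) \<cdot> (FA ?F f \<odot> FA ?F g) = FA ?F (TenA T f g) \<cdot> F2 ?F (Dom T f) (Dom T g)"
    by (simp add: TenA_tpar)
qed (auto elim!: Arr_tensorE simp: tensor_structure Comp_cls T.SMC_axioms C.SMC_axioms,
  simp_all add: En_def)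

end

locale curried_transformation = tensor_hom A B C + S: monoidal_transformation A "\<lbrakk>B, C\<rbrakk>" \<sigma>
  for A :: "('o1, 'm1) smcat" and B :: "('o2, 'm2) smcat" and C :: "('o3, 'm3) smcat" (structure)
    and \<sigma> :: "('o1, 'm1, 'o2, 'm2, 'o3, 'm3) curried_trans"

sublocale curried_transformation \<subseteq> Src: curried_functor A B C "Src \<sigma>" ..
sublocale curried_transformation \<subseteq> Tgt: curried_functor A B C "Tgt \<sigma>" ..

context curried_transformation
begin

lemma at_MT: "a \<in> Obj A \<Longrightarrow> MT B C (Cmp \<sigma> a)"
  using S.Cmp_simps(1) by simp

lemma Cmp_Src_Tgt [simp]:
  "a \<in> Obj A \<Longrightarrow> Src (Cmp \<sigma> a) = FO (Src \<sigma>) a" "a \<in> Obj A \<Longrightarrow> Tgt (Cmp \<sigma> a) = FO (Tgt \<sigma>) a"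
  using S.Cmp_simps(2,3) by simp_all

lemma Cmp_Cmp [simp]:
  assumes "a \<in> Obj A" "b \<in> Obj B"
  shows "Cmp (Cmp \<sigma> a) b \<in> Arr C" "Dom C (Cmp (Cmp \<sigma> a) b) = FO (FO (Src \<sigma>) a) b"
    "Cod C (Cmp (Cmp \<sigma> a) b) = FO (FO (Tgt \<sigma>) a) b"
  using monoidal_transformation.Cmp_simps [OF at_MT] assms by simp_all

lemma Cmp_equations:
  assumes "a \<in> Obj A"
  shows "g \<in> Arr B \<Longrightarrow> Cmp (Cmp \<sigma> a) (Cod B g) \<cdot> FA (FO (Src \<sigma>) a) g = FA (FO (Tgt \<sigma>) a) g
    \<cdot> Cmp (Cmp \<sigma> a) (Dom B g)"
    "Cmp (Cmp \<sigma> a) (UnitO B) \<cdot> F0 (FO (Src \<sigma>) a) = F0 (FO (Tgt \<sigma>) a)"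
    "b \<in> Obj B \<Longrightarrow> b' \<in> Obj B \<Longrightarrow> Cmp (Cmp \<sigma> a) (b \<otimes>\<^bsub>B\<^esub> b') \<cdot> F2 (FO (Src \<sigma>) a) b b'
      = F2 (FO (Tgt \<sigma>) a) b b' \<cdot> (Cmp (Cmp \<sigma> a) b \<odot> Cmp (Cmp \<sigma> a) b')"
  using monoidal_transformation.Cmp_nat [OF at_MT] monoidal_transformation.Cmp_F0 [OF at_MT]
    monoidal_transformation.Cmp_F2 [OF at_MT] assms by simp_all

lemma pointwise_equations:
  assumes [simp]: "b \<in> Obj B"
  shows "f \<in> Arr A \<Longrightarrow> Cmp (Cmp \<sigma> (Cod A f)) b \<cdot> Cmp (FA (Src \<sigma>) f) b = Cmp (FA (Tgt \<sigma>) f) b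
    \<cdot> Cmp (Cmp \<sigma> (Dom A f)) b"
    "Cmp (Cmp \<sigma> (UnitO A)) b \<cdot> Cmp (F0 (Src \<sigma>)) b = Cmp (F0 (Tgt \<sigma>)) b"
    "a \<in> Obj A \<Longrightarrow> a' \<in> Obj A \<Longrightarrow> Cmp (Cmp \<sigma> (a \<otimes>\<^bsub>A\<^esub> a')) b \<cdot> Cmp (F2 (Src \<sigma>) a a') b
      = Cmp (F2 (Tgt \<sigma>) a a') b \<cdot> (Cmp (Cmp \<sigma> a) b \<odot> Cmp (Cmp \<sigma> a') b)"
  using arg_cong [OF S.Cmp_nat [of f "Cod A f"], of "\<lambda>\<sigma>. Cmp \<sigma> b"] arg_cong [OF S.Cmp_F0, of "\<lambda>\<sigma>. Cmp \<sigma> b"]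
    arg_cong [OF S.Cmp_F2 [of a a'], of "\<lambda>\<sigma>. Cmp \<sigma> b"]
  by simp_all

lemma en_cmp_simps [simp]:
  assumes "word X"
  shows "en_cmp C \<sigma> X \<in> Arr C" "Dom C (en_cmp C \<sigma> X) = en_word C (Src \<sigma>) X" "Cod C (en_cmp C \<sigma> X)
    = en_word C (Tgt \<sigma>) X"
  using assms by (induction X) auto

text \<open>Naturality passes through composition and one-sided tensoring. On the remaining
  generators it is a naturality or monoidality equation of \<open>\<sigma>\<close> evaluated in
  \<open>B\<close>, or naturality of a constraint of \<open>C\<close> or of its inverse.\<close>

lemma en_cmp_natural:
  "arrow p \<Longrightarrow> en_cmp C \<sigma> (cd p) \<cdot> en_term C (Src \<sigma>) p = en_term C (Tgt \<sigma>) p \<cdot> en_cmp C \<sigma> (dm p)"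
proof (induction p)
  case (TComp q p)
  have "en_cmp C \<sigma> (cd (q \<bullet> p)) \<cdot> en_term C (Src \<sigma>) (q \<bullet> p) = (en_cmp C \<sigma> (cd q)
    \<cdot> en_term C (Src \<sigma>) q) \<cdot> en_term C (Src \<sigma>) p"
    using TComp.prems by simp
  also have "\<dots> = en_term C (Tgt \<sigma>) q \<cdot> (en_cmp C \<sigma> (cd p) \<cdot> en_term C (Src \<sigma>) p)"
    using TComp.prems by (subst TComp.IH(1)) auto
  also have "\<dots> = en_term C (Tgt \<sigma>) (q \<bullet> p) \<cdot> en_cmp C \<sigma> (dm (q \<bullet> p))"
    using TComp.prems by (subst TComp.IH(2)) auto
  finally show ?case .
qed (auto simp: C.Ass_nat C.Ass_inv_nat C.Run_nat C.Run_inv_nat C.Lun_nat C.Lun_inv_nat C.Sym_nat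
     Cmp_equations pointwise_equations)

theorem En_trans_MT: "MT T C (En_trans A B C \<sigma>)" (is "MT _ _ ?\<sigma>")
proof (rule monoidal_transformationI)
  show "SMF T C (Src ?\<sigma>)" "SMF T C (Tgt ?\<sigma>)"
    by (simp_all add: En_trans_def Src.En_SMF Tgt.En_SMF)
qed (auto elim!: Arr_tensorE simp: En_trans_def en_cmp_natural tensor_structure)

end

section \<open>The counit and the adjunction\<close>

lemma hom_post_trans_simps [simp]:
  "Src (hom_post_trans A B C \<sigma>) = hom_post A B C (Src \<sigma>)"
  "Tgt (hom_post_trans A B C \<sigma>) = hom_post A B C (Tgt \<sigma>)"
  "SMF A B H \<Longrightarrow> Cmp (hom_post_trans A B C \<sigma>) H = whisker_right A C \<sigma> H"
  by (simp_all add: hom_post_trans_def)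

lemma hom_post_trans_MT:
  assumes A: "symmetric_monoidal_category A" and S: "MT B C \<sigma>"
  shows "MT \<lbrakk>A, B\<rbrakk> \<lbrakk>A, C\<rbrakk> (hom_post_trans A B C \<sigma>)"
proof -
  interpret A: symmetric_monoidal_category A by fact
  interpret S: monoidal_transformation B C \<sigma> by fact
  have B: "symmetric_monoidal_category B" by (rule S.Src.A.SMC_axioms)
  show ?thesis
    by (rule monoidal_transformationI)
      (auto intro!: smtrans_eqI [where X = "Obj A"] hom_post_SMF [OF A] whisker_right_MT [OF _ S]
          S.Src.SMF_axioms S.Tgt.SMF_axioms
        simp: monoidal_transformation.Cmp_simps [of A B] symmetric_monoidal_functor.FO_in_Obj [of A B]
          monoidal_transformation_SMF unit_functor_SMF [OF A B] box_functor_SMF S.Cmp_nat S.Cmp_F0 S.Cmp_F2,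
       simp_all add: hom_post_trans_def)
qed

text \<open>Evaluation at \<open>a\<close> preserves composition and identities, hence inverses.
  This is needed because over \<open>\<lbrakk>B, C\<rbrakk>\<close> both the interchange and the
  unit constraint of \<open>box_functor\<close> are defined with \<open>inv_arr\<close>.\<close>

lemma Cmp_inv_arr:
  fixes B (structure)
  assumes A: "symmetric_monoidal_category A" and B: "symmetric_monoidal_category B"
    and "iso \<lbrakk>A, B\<rbrakk> \<sigma>" and [simp]: "a \<in> Obj A"
  shows "Cmp (inv_arr \<lbrakk>A, B\<rbrakk> \<sigma>) a = inv_arr B (Cmp \<sigma> a)"
proof -
  interpret B: symmetric_monoidal_category B by fact
  interpret AB: symmetric_monoidal_category "\<lbrakk>A, B\<rbrakk>" by (rule internal_hom_SMC [OF A B])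
  let ?\<tau> = "inv_arr \<lbrakk>A, B\<rbrakk> \<sigma>"
  have "MT A B \<sigma>" "MT A B ?\<tau>"
    and [simp]: "Src ?\<tau> = Tgt \<sigma>" "Tgt ?\<tau> = Src \<sigma>"
    using AB.iso_Arr [OF assms(3)] AB.inv_arr_simps(1-3) [OF assms(3)] by simp_all
  then interpret S: monoidal_transformation A B \<sigma> + T: monoidal_transformation A B ?\<tau>
    by simp_all
  have "inv_arr B (Cmp \<sigma> a) = Cmp ?\<tau> a"
  proof (rule B.isoI(2))
    show "Cmp ?\<tau> a \<cdot> Cmp \<sigma> a = Ide B (Dom B (Cmp \<sigma> a))"
      using arg_cong [OF AB.inv_arr_simps(4) [OF assms(3)], of "\<lambda>\<sigma>. Cmp \<sigma> a"] by simp
    show "Cmp \<sigma> a \<cdot> Cmp ?\<tau> a = Ide B (Cod B (Cmp \<sigma> a))"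
      using arg_cong [OF AB.inv_arr_simps(5) [OF assms(3)], of "\<lambda>\<sigma>. Cmp \<sigma> a"] by simp
  qed simp_all
  then show ?thesis by simp
qed

lemma Cmp_interchange:
  assumes A: "symmetric_monoidal_category A" and B: "symmetric_monoidal_category B"
    and "SMF A B F" "SMF A B G"
      "SMF A B H" "SMF A B K" and "a \<in> Obj A"
  shows "Cmp (interchange \<lbrakk>A, B\<rbrakk> F G H K) a = interchange B (FO F a) (FO G a) (FO H a) (FO K a)"
proof -
  interpret AB: symmetric_monoidal_category "\<lbrakk>A, B\<rbrakk>" by (rule internal_hom_SMC [OF A B])
  have "iso \<lbrakk>A, B\<rbrakk> (Ass \<lbrakk>A, B\<rbrakk> F G H)" "iso \<lbrakk>A, B\<rbrakk> (Ass \<lbrakk>A, B\<rbrakk> (box_functor A B F H) G K)"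
    using AB.Ass_iso [of F G H] AB.Ass_iso [of "box_functor A B F H" G K] assms
      by (simp_all add: box_functor_SMF)
  then show ?thesis
    using assms by (simp add: interchange_def Cmp_inv_arr [OF A B])
qed

context tensor_hom
begin

section \<open>Restriction along \<open>eta\<close>\<close>

abbreviation "\<D> \<equiv> \<lbrakk>T, C\<rbrakk>"

abbreviation "\<E> \<equiv> \<lbrakk>A, \<lbrakk>B, C\<rbrakk>\<rbrakk>"

text \<open>The simplifier rewrites \<open>Obj T\<close> to a set of words, so the extensionality
  rules are restated in that form.\<close>

lemmas tensor_hom_ext [simp] = internal_hom_ext [where A = T, unfolded Obj_tensor]

lemma Rn_SMF:
  assumes "SMF T C F"
  shows "SMF A \<lbrakk>B, C\<rbrakk> (Rn A B C F)"
  unfolding Rn_def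
  by (rule comp_functor_SMF [OF eta_SMF hom_post_SMF [OF B.SMC_axioms assms]])

lemma Rn_trans_MT:
  assumes "MT T C \<sigma>"
  shows "MT A \<lbrakk>B, C\<rbrakk> (Rn_trans A B C \<sigma>)"
  unfolding Rn_trans_def
  by (rule whisker_right_MT [OF eta_SMF hom_post_trans_MT [OF B.SMC_axioms assms]])

lemma Rn_simps [simp]:
  "a \<in> Obj A \<Longrightarrow> FO (Rn A B C F) a = comp_functor B C F (eta_at A B a)"
  "f \<in> Arr A \<Longrightarrow> FA (Rn A B C F) f = whisker_left B C F (FA (eta A B) f)"
  by (simp_all add: Rn_def eta_at_SMF eta_FA_MT)

lemma Rn_F0 [simp]:
  "Src (F0 (Rn A B C F)) = unit_functor B C"
  "Tgt (F0 (Rn A B C F)) = comp_functor B C F (eta_at A B (UnitO A))"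
  "b \<in> Obj B \<Longrightarrow> Cmp (F0 (Rn A B C F)) b = FA F (cl (TAlpha b)) \<cdot> F0 F"
  "Cmp (F0 (Rn A B C F)) \<in> extensional (Obj B)"
  by (simp_all add: Rn_def eta_F0_MT)

lemma Rn_F2 [simp]:
  assumes "a \<in> Obj A" "a' \<in> Obj A"
  shows "Src (F2 (Rn A B C F) a a')
    = box_functor B C (comp_functor B C F (eta_at A B a)) (comp_functor B C F (eta_at A B a'))"
  "Tgt (F2 (Rn A B C F) a a') = comp_functor B C F (eta_at A B (a \<otimes>\<^bsub>A\<^esub> a'))"
  "b \<in> Obj B \<Longrightarrow> Cmp (F2 (Rn A B C F) a a') b = FA F (cl (TGamma a a' b)) \<cdot> F2 F (WGen a b) (WGen a' b)"
  "Cmp (F2 (Rn A B C F) a a') \<in> extensional (Obj B)"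
  using assms by (simp_all add: Rn_def eta_F2_MT eta_at_SMF)

lemma Rn_trans_simps [simp]:
  "Src (Rn_trans A B C \<sigma>) = Rn A B C (Src \<sigma>)" "Tgt (Rn_trans A B C \<sigma>) = Rn A B C (Tgt \<sigma>)"
  "a \<in> Obj A \<Longrightarrow> Cmp (Rn_trans A B C \<sigma>) a = whisker_right B C \<sigma> (eta_at A B a)"
  "Cmp (Rn_trans A B C \<sigma>) \<in> extensional (Obj A)"
  by (simp_all add: Rn_trans_def Rn_def eta_at_SMF)

lemma comp_eta_at_SMF [simp]:
  "a \<in> Obj A \<Longrightarrow> SMF T C F \<Longrightarrow> SMF B C (comp_functor B C F (eta_at A B a))"
  by (rule comp_functor_SMF [OF eta_at_SMF])

text \<open>Sources and targets of \<open>FA F f\<close>, \<open>F0 F\<close> and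
  \<open>F2 F a a'\<close> are fixed by the object part of \<open>F\<close>, so beyond equality on
  objects only components need comparison.\<close>

lemma curried_eqI:
  assumes F: "SMF A \<lbrakk>B, C\<rbrakk> F" and G: "SMF A \<lbrakk>B, C\<rbrakk> G"
    and FO: "\<And>a. a \<in> Obj A \<Longrightarrow> FO F a = FO G a"
    and "\<And>f b. f \<in> Arr A \<Longrightarrow> b \<in> Obj B \<Longrightarrow> Cmp (FA F f) b = Cmp (FA G f) b"
    and "\<And>b. b \<in> Obj B \<Longrightarrow> Cmp (F0 F) b = Cmp (F0 G) b"
    and "\<And>a a' b. a \<in> Obj A \<Longrightarrow> a' \<in> Obj A \<Longrightarrow> b \<in> Obj B \<Longrightarrow> Cmp (F2 F a a') b = Cmp (F2 G a a') b"
  shows "F = G"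
proof -
  interpret F: curried_functor A B C F
    using F by (simp add: curried_functor_def tensor_hom_axioms)
  interpret G: curried_functor A B C G
    using G by (simp add: curried_functor_def tensor_hom_axioms)
  note ext = monoidal_transformation.Cmp_ext
  show ?thesis
    by (rule smfun_eqI [OF F G])
      (auto intro!: smtrans_eqI [where X = "Obj B"] ext [OF F.FA_MT] ext [OF G.FA_MT] ext [OF F.F0_MT] ext [OF G.F0_MT]
         ext [OF F.F2_MT] ext [OF G.F2_MT] simp: assms)
qed

lemma curried_trans_eqI:
  assumes "MT A \<lbrakk>B, C\<rbrakk> \<sigma>" "MT A \<lbrakk>B, C\<rbrakk> \<tau>"
    and "Src \<sigma> = Src \<tau>" "Tgt \<sigma> = Tgt \<tau>"
    and "\<And>a b. a \<in> Obj A \<Longrightarrow> b \<in> Obj B \<Longrightarrow> Cmp (Cmp \<sigma> a) b = Cmp (Cmp \<tau> a) b"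
  shows "\<sigma> = \<tau>"
proof -
  interpret S: curried_transformation A B C \<sigma>
    using assms(1) by (simp add: curried_transformation_def tensor_hom_axioms)
  interpret T: curried_transformation A B C \<tau>
    using assms(2) by (simp add: curried_transformation_def tensor_hom_axioms)
  note ext = monoidal_transformation.Cmp_ext
  show ?thesis
    by (rule smtrans_eqI [where X = "Obj A"])
      (auto intro!: smtrans_eqI [where X = "Obj B"] S.S.Cmp_ext T.S.Cmp_ext ext [OF S.at_MT] ext [OF T.at_MT] simp: assms)
qed

text \<open>\<open>eta\<close> picks, for each datum of \<open>F\<close>, the generator on which
  \<open>En\<close> takes this datum as value; the identity constraints of \<open>En\<close> add
  nothing.\<close>

lemma Rn_En:
  assumes "SMF A \<lbrakk>B, C\<rbrakk> F"
  shows "Rn A B C (En A B C F) = F"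
proof -
  interpret F: curried_functor A B C F
    using assms by (simp add: curried_functor_def tensor_hom_axioms)
  have FO: "comp_functor B C (En A B C F) (eta_at A B a) = FO F a" if [simp]: "a \<in> Obj A" for a
    by (rule smfun_eqI [OF comp_eta_at_SMF [OF _ F.En_SMF] F.at_SMF]) auto
  show ?thesis
    by (rule curried_eqI [OF Rn_SMF [OF F.En_SMF] assms]) (auto simp: FO)
qed

lemma Rn_trans_En_trans:
  assumes "MT A \<lbrakk>B, C\<rbrakk> \<sigma>"
  shows "Rn_trans A B C (En_trans A B C \<sigma>) = \<sigma>"
proof -
  interpret S: curried_transformation A B C \<sigma>
    using assms by (simp add: curried_transformation_def tensor_hom_axioms)
  show ?thesis
    by (rule curried_trans_eqI [OF Rn_trans_MT [OF S.En_trans_MT] assms])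
      (auto simp: En_trans_def Rn_En monoidal_transformation_SMF [OF assms])
qed

lemma Rn_unit: "Rn A B C (unit_functor T C) = unit_functor A \<lbrakk>B, C\<rbrakk>"
proof -
  have u: "SMF T C (unit_functor T C)" "SMF A \<lbrakk>B, C\<rbrakk> (unit_functor A \<lbrakk>B, C\<rbrakk>)"
    "SMF B C (unit_functor B C)"
    by (intro unit_functor_SMF A.SMC_axioms B.SMC_axioms
      T.SMC_axioms C.SMC_axioms BC.SMC_axioms)+
  have FO: "comp_functor B C (unit_functor T C) (eta_at A B a) = unit_functor B C" if "a \<in> Obj A" for a
    by (rule smfun_eqI [OF comp_eta_at_SMF [OF that u(1)] u(3)]) (use that in auto)
  show ?thesis
    by (rule curried_eqI [OF Rn_SMF [OF u(1)] u(2)]) (auto simp: FO)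
qed

text \<open>Strictness of \<open>Rn\<close> demands this equality on the nose. The constraints on
  the right involve an inverse and an interchange formed in \<open>\<lbrakk>B, C\<rbrakk>\<close>,
  which are evaluated at each \<open>b\<close>.\<close>

lemma Rn_box:
  assumes F: "SMF T C F" and G: "SMF T C G"
  shows "Rn A B C (box_functor T C F G) = box_functor A \<lbrakk>B, C\<rbrakk> (Rn A B C F) (Rn A B C G)"
proof -
  interpret F: symmetric_monoidal_functor T C F by fact
  interpret G: symmetric_monoidal_functor T C G by fact
  note FG = box_functor_SMF [OF F G]
    and B = B.SMC_axioms and C = C.SMC_axioms
  have iso: "iso \<lbrakk>B, C\<rbrakk> (Run \<lbrakk>B, C\<rbrakk> (unit_functor B C))"
    using BC.Run_iso [OF BC.UnitO_Obj] by simp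
  have FO: "comp_functor B C (box_functor T C F G) (eta_at A B a)
    = box_functor B C (comp_functor B C F (eta_at A B a)) (comp_functor B C G (eta_at A B a))"
    if [simp]: "a \<in> Obj A" for a
    by (rule smfun_eqI [OF comp_eta_at_SMF [OF _ FG] box_functor_SMF [OF comp_eta_at_SMF [OF _ F] comp_eta_at_SMF [OF _ G]]])
      (auto simp: tensor_structure)
  show ?thesis
    by (rule curried_eqI [OF Rn_SMF [OF FG] box_functor_SMF [OF Rn_SMF [OF F] Rn_SMF [OF G]]])
      (auto simp: FO tensor_structure Cmp_inv_arr [OF B C] Cmp_interchange [OF B C] comp_eta_at_SMF [OF _ F] comp_eta_at_SMF [OF _ G] iso)
qed

text \<open>Identities have the right source and target here only because \<open>Rn_unit\<close> and
  \<open>Rn_box\<close> are equalities.\<close>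

definition Rn_functor where
  "Rn_functor = \<lparr>FO = \<lambda>F\<in>Obj \<D>. Rn A B C F, FA = \<lambda>\<sigma>\<in>Arr \<D>. Rn_trans A B C \<sigma>,
     F0 = Ide \<E> (unit_functor A \<lbrakk>B, C\<rbrakk>),
     F2 = \<lambda>F\<in>Obj \<D>. \<lambda>G\<in>Obj \<D>. Ide \<E> (box_functor A \<lbrakk>B, C\<rbrakk> (Rn A B C F) (Rn A B C G))\<rparr>"

lemma eps_cmp_simps:
  assumes "SMF T C F" "word X"
  shows "eps_cmp C F X \<in> Arr C" "Dom C (eps_cmp C F X)
    = en_word C (Rn A B C F) X" "Cod C (eps_cmp C F X) = FO F X"
proof -
  interpret F: symmetric_monoidal_functor T C F by fact
  show "eps_cmp C F X \<in> Arr C" "Dom C (eps_cmp C F X)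
    = en_word C (Rn A B C F) X" "Cod C (eps_cmp C F X) = FO F X"
    using assms(2) F.F0_simps(3) F.F2_simps(3)
    by (induction X) (auto simp: tensor_structure)
qed

end

section \<open>The counit at a single functor\<close>

locale uncurried_functor = tensor_hom A B C + F: symmetric_monoidal_functor T C F
  for A :: "('o1, 'm1) smcat" and B :: "('o2, 'm2) smcat" and C :: "('o3, 'm3) smcat" (structure)
    and F :: "('o1, 'm1, 'o2, 'm2, 'o3, 'm3) tensor_fun"

sublocale uncurried_functor \<subseteq> Rn: curried_functor A B C "Rn A B C F"
  by (simp add: curried_functor_def tensor_hom_axioms Rn_SMF F.SMF_axioms)

context uncurried_functor
begin

abbreviation "w \<equiv> en_word C (Rn A B C F)"

abbreviation "e \<equiv> eps_cmp C F"

lemmas eps_simps [simp] = eps_cmp_simps [OF F.SMF_axioms]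

text \<open>Naturality moves \<open>Ass C\<close> past the three components, and what remains is the
  associativity axiom of \<open>F\<close>. The next three lemmas treat the other constraints in the
  same way.\<close>

lemma eps_Ass:
  assumes [simp]: "word X" "word Y" "word Z"
  shows "e ((X \<oplus> Y) \<oplus> Z) \<cdot> Ass C (w X) (w Y) (w Z)
    = FA F (Ass T X Y Z) \<cdot> e (X \<oplus> (Y \<oplus> Z))"
proof -
  have "e ((X \<oplus> Y) \<oplus> Z) \<cdot> Ass C (w X) (w Y) (w Z)
    = F2 F (X \<oplus> Y) Z \<cdot> (F2 F X Y \<odot> Ide C (FO F Z)) \<cdot> (Ass C (FO F X) (FO F Y) (FO F Z) \<cdot> (e X \<odot> (e Y \<odot> e Z)))"
    by (subst C.Ass_nat) (auto simp: tensor_structure)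
  also have "\<dots> = (F2 F (X \<oplus> Y) Z \<cdot> (F2 F X Y \<odot> Ide C (FO F Z)) \<cdot> Ass C (FO F X) (FO F Y) (FO F Z))
    \<cdot> (e X \<odot> (e Y \<odot> e Z))"
    by (simp add: tensor_structure)
  also have "\<dots> = FA F (Ass T X Y Z) \<cdot> e (X \<oplus> (Y \<oplus> Z))"
    using F.F2_Ass [of X Y Z, symmetric] by (simp add: tensor_structure)
  finally show ?thesis .
qed

lemma eps_Run:
  assumes [simp]: "word X"
  shows "e X \<cdot> Run C (w X) = FA F (Run T X) \<cdot> e (X \<oplus> WUnit)"
proof -
  have "e X \<cdot> Run C (w X) = Run C (FO F X) \<cdot> (e X \<odot> Ide C (UnitO C))"
    by (subst C.Run_nat) auto
  also have "\<dots> = FA F (Run T X) \<cdot> e (X \<oplus> WUnit)"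
    using F.F2_Run [of X, symmetric] F.F0_simps(3) by (simp add: tensor_structure)
  finally show ?thesis .
qed

lemma eps_Lun:
  assumes [simp]: "word X"
  shows "e X \<cdot> Lun C (w X) = FA F (Lun T X) \<cdot> e (WUnit \<oplus> X)"
proof -
  have "e X \<cdot> Lun C (w X) = Lun C (FO F X) \<cdot> (Ide C (UnitO C) \<odot> e X)"
    by (subst C.Lun_nat) auto
  also have "\<dots> = FA F (Lun T X) \<cdot> e (WUnit \<oplus> X)"
    using F.F2_Lun [of X, symmetric] F.F0_simps(3) by (simp add: tensor_structure)
  finally show ?thesis .
qed

lemma eps_Sym:
  assumes [simp]: "word X" "word Y"
  shows "e (Y \<oplus> X) \<cdot> Sym C (w X) (w Y) = FA F (Sym T X Y) \<cdot> e (X \<oplus> Y)"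
proof -
  have "e (Y \<oplus> X) \<cdot> Sym C (w X) (w Y)
    = (F2 F Y X \<cdot> Sym C (FO F X) (FO F Y)) \<cdot> (e X \<odot> e Y)"
    by (simp add: C.Sym_nat)
  also have "\<dots> = FA F (Sym T X Y) \<cdot> e (X \<oplus> Y)"
    by (subst F.F2_Sym [symmetric]) (auto simp: tensor_structure)
  finally show ?thesis .
qed

text \<open>Induction over formal arrows. On generators of the tensor product the equation is
  immediate, because \<open>Rn\<close> already composes with the constraints of \<open>F\<close>; on
  structural arrows it is an axiom of \<open>F\<close>, and on formal inverses the inverted
  square.\<close>

lemma eps_natural:
  "arrow p \<Longrightarrow> e (cd p) \<cdot> en_term C (Rn A B C F) p = FA F (cl p) \<cdot> e (dm p)"
proof (induction p)
  case (TComp q p)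
  have "e (cd (q \<bullet> p)) \<cdot> en_term C (Rn A B C F) (q \<bullet> p) = (e (cd q) \<cdot> en_term C (Rn A B C F) q)
    \<cdot> en_term C (Rn A B C F) p"
    using TComp.prems by simp
  also have "\<dots> = FA F (cl q) \<cdot> (e (cd p) \<cdot> en_term C (Rn A B C F) p)"
    using TComp.prems by (subst TComp.IH(1)) auto
  also have "\<dots> = FA F (cl q \<cdot>\<^bsub>T\<^esub> cl p) \<cdot> e (dm (q \<bullet> p))"
    using TComp.prems by (subst TComp.IH(2)) auto
  finally show ?case using TComp.prems by (simp add: Comp_cls)
next
  case (TLeft X p)
  then have [simp]: "word X" "arrow p" by auto
  have "e (cd (TLeft X p)) \<cdot> en_term C (Rn A B C F) (TLeft X p)
    = F2 F X (cd p) \<cdot> (e X \<odot> (e (cd p) \<cdot> en_term C (Rn A B C F) p))"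
    by simp
  \<comment> \<open>The identity \<open>FA F (Ide T X)\<close> is inserted so that naturality of
    \<open>F2 F\<close> applies to the pair \<open>Ide T X\<close>, \<open>cl p\<close>.\<close>
  also have "\<dots> = (F2 F X (cd p) \<cdot> (FA F (Ide T X) \<odot> FA F (cl p))) \<cdot> (e X \<odot> e (dm p))"
    by (simp add: TLeft.IH)
  also have "\<dots> = FA F (cl (TLeft X p)) \<cdot> e (dm (TLeft X p))"
    by (subst F.F2_nat) (auto simp: tensor_structure Ide_TenA_cls)
  finally show ?case .
next
  case (TRight p X)
  then have [simp]: "word X" "arrow p" by auto
  have "e (cd (TRight p X)) \<cdot> en_term C (Rn A B C F) (TRight p X)
    = F2 F (cd p) X \<cdot> ((e (cd p) \<cdot> en_term C (Rn A B C F) p) \<odot> e X)"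
    by simp
  also have "\<dots> = (F2 F (cd p) X \<cdot> (FA F (cl p) \<odot> FA F (Ide T X))) \<cdot> (e (dm p) \<odot> e X)"
    by (simp add: TRight.IH)
  also have "\<dots> = FA F (cl (TRight p X)) \<cdot> e (dm (TRight p X))"
    by (subst F.F2_nat) (auto simp: tensor_structure cls_TenA_Ide)
  finally show ?case .
next
  case (TAss X Y Z)
  then show ?case using eps_Ass [of X Y Z] by (simp add: tensor_structure)
next
  case (TAssInv X Y Z)
  then have [simp]: "word X" "word Y" "word Z" by auto
  show ?case
    using C.iso_square_inverse [OF eps_Ass [of X Y Z]] T.Ass_simps(4) [of X Y Z] F.iso_FA [of "Ass T X Y Z"]
    by (simp add: tensor_structure inverse_structure)
next
  case (TRun X)
  then show ?case using eps_Run [of X] by (simp add: tensor_structure)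
next
  case (TRunInv X)
  then have [simp]: "word X" by auto
  show ?case
    using C.iso_square_inverse [OF eps_Run [of X]] T.Run_simps(4) [of X] F.iso_FA [of "Run T X"] F.F0_simps(3)
    by (simp add: tensor_structure inverse_structure)
next
  case (TLun X)
  then show ?case using eps_Lun [of X] by (simp add: tensor_structure)
next
  case (TLunInv X)
  then have [simp]: "word X" by auto
  show ?case
    using C.iso_square_inverse [OF eps_Lun [of X]] T.Lun_simps(4) [of X] F.iso_FA [of "Lun T X"] F.F0_simps(3)
    by (simp add: tensor_structure inverse_structure)
next
  case (TSym X Y)
  then show ?case using eps_Sym [of X Y] by (simp add: tensor_structure)
next
  case (TIde X)
  then show ?case by (simp flip: tensor_structure(1))
qed (auto simp: tensor_structure(2,3))


lemma eps_simps' [simp]: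
  "Src (eps A B C F) = En A B C (Rn A B C F)" "Tgt (eps A B C F) = F"
  "word X \<Longrightarrow> Cmp (eps A B C F) X = e X"
  "Cmp (eps A B C F) \<in> extensional {X. word X}"
  by (simp_all add: eps_def)

theorem eps_MT: "MT T C (eps A B C F)" (is "MT _ _ ?\<sigma>")
proof (rule monoidal_transformationI)
  fix f assume "f \<in> Arr T"
  then obtain p where "arrow p" "f = cl p" by (rule Arr_tensorE)
  then show "Cmp ?\<sigma> (Cod T f) \<cdot> FA (Src ?\<sigma>) f = FA (Tgt ?\<sigma>) f \<cdot> Cmp ?\<sigma> (Dom T f)"
    by (simp add: eps_natural)
qed (use F.F0_simps(3) in \<open>auto simp: Rn.En_SMF F.SMF_axioms tensor_structure\<close>)

text \<open>\<open>eta\<close> reaches only the words \<open>WGen a b\<close>, at which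
  \<open>\<epsilon>\<close> is an identity.\<close>

lemma Rn_trans_eps: "Rn_trans A B C (eps A B C F) = Ide \<E> (Rn A B C F)"
  by (rule curried_trans_eqI [OF Rn_trans_MT [OF eps_MT] Ide_MT [OF Rn_SMF [OF F.SMF_axioms]]])
    (auto simp: Rn_En [OF Rn_SMF [OF F.SMF_axioms]])

text \<open>By induction on words, a component is assembled from \<open>F0 F\<close>, arrows
  \<open>F2 F X Y\<close> and identities. The hypotheses ask for a strong functor, since a box of
  strict functors is strong but need not be strict.\<close>

lemma iso_eps:
  assumes "iso C (F0 F)" "\<And>X Y. word X \<Longrightarrow> word Y \<Longrightarrow> iso C (F2 F X Y)"
  shows "iso \<D> (eps A B C F)"
proof (rule iso_pointwise [OF eps_MT])
  have "iso C (e X)" if "word X" for X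
    using that by (induction X) (auto simp: assms)
  then show "\<And>X. X \<in> Obj T \<Longrightarrow> iso C (Cmp (eps A B C F) X)" by simp
qed

end

lemma (in tensor_hom) uncurried_functorI: "SMF T C F \<Longrightarrow> uncurried_functor A B C F"
  by (simp add: uncurried_functor_def tensor_hom_axioms)

lemma (in curried_functor) eps_En: "eps A B C (En A B C F) = Ide \<D> (En A B C F)"
proof -
  interpret E: uncurried_functor A B C "En A B C F" by (rule uncurried_functorI [OF En_SMF])
  have "eps_cmp C (En A B C F) X = Ide C (en_word C F X)" if "word X" for X
    using that by (induction X) auto
  then show ?thesis
    by (intro smtrans_eqI [where X = "Obj T"]) (auto simp: Rn_En [OF F.SMF_axioms])
qed

context tensor_hom
begin

text \<open>Induction on words: the two monoidal equations of \<open>\<sigma>\<close> are the cases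
  of the unit and of a tensor, and at a generator both sides are the component of
  \<open>\<sigma>\<close>.\<close>

lemma eps_trans_natural:
  assumes "MT T C \<sigma>" "word X"
  shows "eps_cmp C (Tgt \<sigma>) X \<cdot> en_cmp C (Rn_trans A B C \<sigma>) X = Cmp \<sigma> X \<cdot> eps_cmp C (Src \<sigma>) X"
proof -
  interpret S: monoidal_transformation T C \<sigma> by fact
  interpret Src: uncurried_functor A B C "Src \<sigma>" by (rule uncurried_functorI [OF S.Src.SMF_axioms])
  interpret Tgt: uncurried_functor A B C "Tgt \<sigma>" by (rule uncurried_functorI [OF S.Tgt.SMF_axioms])
  interpret R: curried_transformation A B C "Rn_trans A B C \<sigma>"
    using Rn_trans_MT [OF assms(1)] by (simp add: curried_transformation_def tensor_hom_axioms)
  show ?thesis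
    using assms(2)
  proof (induction X)
    case WUnit
    then show ?case using S.Cmp_F0 S.Tgt.F0_simps by (simp add: tensor_structure)
  next
    case (WGen a b)
    then show ?case by simp
  next
    case (WTen X Y)
    then have [simp]: "word X" "word Y" by auto
    have "eps_cmp C (Tgt \<sigma>) (X \<oplus> Y) \<cdot> en_cmp C (Rn_trans A B C \<sigma>) (X \<oplus> Y)
      = F2 (Tgt \<sigma>) X Y \<cdot> ((eps_cmp C (Tgt \<sigma>) X \<cdot> en_cmp C (Rn_trans A B C \<sigma>) X) \<odot> (eps_cmp C (Tgt \<sigma>) Y \<cdot> en_cmp C (Rn_trans A B C \<sigma>) Y))"
      by simp
    also have "\<dots> = (F2 (Tgt \<sigma>) X Y \<cdot> (Cmp \<sigma> X \<odot> Cmp \<sigma> Y)) \<cdot> (eps_cmp C (Src \<sigma>) X \<odot> eps_cmp C (Src \<sigma>) Y)"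
      by (simp add: WTen.IH)
    also have "\<dots> = Cmp \<sigma> (X \<oplus> Y) \<cdot> eps_cmp C (Src \<sigma>) (X \<oplus> Y)"
      by (subst S.Cmp_F2 [symmetric]) (auto simp: tensor_structure)
    finally show ?case .
  qed
qed

lemma Rn_functor_simps [simp]:
  "SMF T C F \<Longrightarrow> FO Rn_functor F = Rn A B C F"
  "MT T C \<sigma> \<Longrightarrow> FA Rn_functor \<sigma> = Rn_trans A B C \<sigma>"
  "F0 Rn_functor = Ide \<E> (unit_functor A \<lbrakk>B, C\<rbrakk>)"
  "SMF T C F \<Longrightarrow> SMF T C G \<Longrightarrow>
    F2 Rn_functor F G = Ide \<E> (box_functor A \<lbrakk>B, C\<rbrakk> (Rn A B C F) (Rn A B C G))"
  by (simp_all add: Rn_functor_def)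

sublocale TC: symmetric_monoidal_category "\<D>"
  by (rule internal_hom_SMC) (rule T.SMC_axioms C.SMC_axioms)+

sublocale ABC: symmetric_monoidal_category "\<E>"
  by (rule internal_hom_SMC) (rule A.SMC_axioms BC.SMC_axioms)+

text \<open>Both monoidal structures are pointwise, so \<open>Rn_trans\<close> commutes with every
  operation by comparison of components at \<open>a\<close> and \<open>b\<close>; on objects this is
  \<open>Rn_unit\<close> and \<open>Rn_box\<close>.\<close>

theorem Rn_strict: "strict_functor \<D> \<E> Rn_functor"
proof -
  note [simp] = box_functor_SMF Rn_SMF Rn_trans_MT monoidal_transformation_SMF Rn_box Rn_unit
  have u [simp]: "SMF T C (unit_functor T C)" "SMF A \<lbrakk>B, C\<rbrakk> (unit_functor A \<lbrakk>B, C\<rbrakk>)"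
    using TC.UnitO_Obj ABC.UnitO_Obj by simp_all
  have Ide: "Rn_trans A B C (Ide \<D> F) = Ide \<E> (Rn A B C F)" if "SMF T C F" for F
    by (rule curried_trans_eqI) (use that in \<open>auto simp: Ide_MT\<close>)
  have Run: "Rn_trans A B C (Run \<D> F) = Run \<E> (Rn A B C F)" if "SMF T C F" for F
    by (rule curried_trans_eqI) (use that in \<open>auto simp: Run_MT\<close>)
  have Lun: "Rn_trans A B C (Lun \<D> F) = Lun \<E> (Rn A B C F)" if "SMF T C F" for F
    by (rule curried_trans_eqI) (use that in \<open>auto simp: Lun_MT\<close>)
  have Sym: "Rn_trans A B C (Sym \<D> F G) = Sym \<E> (Rn A B C F) (Rn A B C G)"
    if "SMF T C F" "SMF T C G" for F G
    by (rule curried_trans_eqI) (use that in \<open>auto simp: Sym_MT\<close>)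
  have Ass: "Rn_trans A B C (Ass \<D> F G H) = Ass \<E> (Rn A B C F) (Rn A B C G) (Rn A B C H)"
    if "SMF T C F" "SMF T C G" "SMF T C H" for F G H
    by (rule curried_trans_eqI) (use that in \<open>auto simp: Ass_MT\<close>)
  have Comp: "Rn_trans A B C (\<tau> \<cdot>\<^bsub>\<D>\<^esub> \<sigma>) = Rn_trans A B C \<tau> \<cdot>\<^bsub>\<E>\<^esub> Rn_trans A B C \<sigma>"
    if "MT T C \<sigma>" "MT T C \<tau>" "Src \<tau> = Tgt \<sigma>" for \<sigma> \<tau>
    by (rule curried_trans_eqI) (use that in \<open>auto simp: Comp_MT\<close>)
  have TenA: "Rn_trans A B C (\<sigma> \<odot>\<^bsub>\<D>\<^esub> \<tau>) = Rn_trans A B C \<sigma> \<odot>\<^bsub>\<E>\<^esub> Rn_trans A B C \<tau>"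
    if "MT T C \<sigma>" "MT T C \<tau>" for \<sigma> \<tau>
    by (rule curried_trans_eqI) (use that in \<open>auto simp: TenA_MT\<close>)
  have "SMF \<D> \<E> Rn_functor"
    by (rule symmetric_monoidal_functorI)
      (use TC.SMC_axioms ABC.SMC_axioms in
        \<open>auto simp: Comp_MT TenA_MT Ide Run Lun Sym Ass Comp TenA Ide_MT Run_MT Lun_MT Sym_MT Ass_MT\<close>,
       simp_all add: Rn_functor_def)
  then show ?thesis by (simp add: strict_functor_def)
qed

theorem En_Rn_adjunction: "doctrinal_adjunction \<E> \<D> Rn_functor (En A B C) (En_trans A B C) (eps A B C)"
proof -
  have cf: "curried_functor A B C F" if "SMF A \<lbrakk>B, C\<rbrakk> F" for F
    using that by (simp add: curried_functor_def tensor_hom_axioms)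
  have ct: "curried_transformation A B C \<sigma>" if "MT A \<lbrakk>B, C\<rbrakk> \<sigma>" for \<sigma>
    using that by (simp add: curried_transformation_def tensor_hom_axioms)
  note En_SMF = curried_functor.En_SMF [OF cf] and En_trans_MT = curried_transformation.En_trans_MT [OF ct]
    and eps_MT = uncurried_functor.eps_MT [OF uncurried_functorI]
    and eps_simps' = uncurried_functor.eps_simps' [OF uncurried_functorI]
    and iso_eps = uncurried_functor.iso_eps [OF uncurried_functorI]
  show ?thesis
  proof
    show "strict_functor \<D> \<E> Rn_functor" by (rule Rn_strict)
  next
    fix \<sigma> assume "\<sigma> \<in> Arr \<D>"
    then have S: "MT T C \<sigma>" by simp
    note F = monoidal_transformation_SMF [OF S]
    show "eps A B C (Cod \<D> \<sigma>) \<cdot>\<^bsub>\<D>\<^esub> En_trans A B C (FA Rn_functor \<sigma>) = \<sigma> \<cdot>\<^bsub>\<D>\<^esub> eps A B C (Dom \<D> \<sigma>)"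
      using S by (intro smtrans_eqI [where X = "Obj T"])
        (auto simp: eps_simps' [OF F(1)] eps_simps' [OF F(2)] En_trans_def eps_trans_natural [OF S])
  next
    fix F G assume "F \<in> Obj \<E>" "G \<in> Obj \<E>"
    then interpret F: curried_functor A B C F + G: curried_functor A B C G
      by (simp_all add: cf)
    \<comment> \<open>For strict \<open>En F\<close> and \<open>En G\<close> the constraints of the
      box are the inverse of \<open>Run\<close> at the unit and an interchange, both
      invertible.\<close>
    show "iso \<D> (eps A B C (TenO \<D> (En A B C F) (En A B C G)))"
      by (simp, rule iso_eps [OF box_functor_SMF [OF F.En_SMF G.En_SMF]]) (auto simp: tensor_structure)
  next
    \<comment> \<open>The unit functor has an identity as \<open>F0\<close> and \<open>Run\<close>
      at the unit as \<open>F2\<close>.\<close>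
    show "iso \<D> (eps A B C (UnitO \<D>))"
      using TC.UnitO_Obj by (simp, intro iso_eps) auto
  qed (auto simp: En_SMF En_trans_MT eps_MT Rn_En Rn_trans_En_trans eps_simps' curried_functor.eps_En [OF cf]
         uncurried_functor.Rn_trans_eps [OF uncurried_functorI], simp_all add: En_trans_def)
qed

end

theorem proposition14p10:
  fixes A :: "('o1, 'm1) smcat" and B :: "('o2, 'm2) smcat" and C :: "('o3, 'm3) smcat"
  assumes "symmetric_monoidal_category A"
    and "symmetric_monoidal_category B"
    and "symmetric_monoidal_category C"
  shows "\<exists>L R u e.
    smc_adjunction \<lbrakk>A, \<lbrakk>B, C\<rbrakk>\<rbrakk> \<lbrakk>tensor A B, C\<rbrakk> L R u e
    \<and> strict_functor \<lbrakk>tensor A B, C\<rbrakk> \<lbrakk>A, \<lbrakk>B, C\<rbrakk>\<rbrakk> R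
    \<and> FO L = (\<lambda>F\<in>Obj \<lbrakk>A, \<lbrakk>B, C\<rbrakk>\<rbrakk>. En A B C F)
    \<and> FA L = (\<lambda>\<sigma>\<in>Arr \<lbrakk>A, \<lbrakk>B, C\<rbrakk>\<rbrakk>. En_trans A B C \<sigma>)
    \<and> FO R = (\<lambda>F\<in>Obj \<lbrakk>tensor A B, C\<rbrakk>. Rn A B C F)
    \<and> FA R = (\<lambda>\<sigma>\<in>Arr \<lbrakk>tensor A B, C\<rbrakk>. Rn_trans A B C \<sigma>)
    \<and> (\<forall>F\<in>Obj \<lbrakk>A, \<lbrakk>B, C\<rbrakk>\<rbrakk>. Rn A B C (En A B C F) = F)
    \<and> (\<forall>\<sigma>\<in>Arr \<lbrakk>A, \<lbrakk>B, C\<rbrakk>\<rbrakk>. Rn_trans A B C (En_trans A B C \<sigma>) = \<sigma>)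
    \<and> (\<forall>F\<in>Obj \<lbrakk>A, \<lbrakk>B, C\<rbrakk>\<rbrakk>. Cmp u F = Ide \<lbrakk>A, \<lbrakk>B, C\<rbrakk>\<rbrakk> F)
    \<and> (\<forall>F\<in>Obj \<lbrakk>tensor A B, C\<rbrakk>. Cmp e F = eps A B C F)"
proof -
  interpret tensor_hom A B C
    using assms by (simp add: tensor_hom_def tensor_product_def)
  interpret adj: doctrinal_adjunction "\<lbrakk>A, \<lbrakk>B, C\<rbrakk>\<rbrakk>" "\<lbrakk>tensor A B, C\<rbrakk>" Rn_functor "En A B C" "En_trans A B C" "eps A B C"
    by (rule En_Rn_adjunction)
  show ?thesis
    \<comment> \<open>The two 2-cells are left open and fixed by matching with
      \<open>adj.adjunction\<close>: \<open>u\<close> becomes the identity on the identity functor,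
      and \<open>e\<close> becomes \<open>adj.counit\<close>, whose components are the
      transformations \<open>eps\<close>.\<close>
    by (intro exI [of _ adj.left_adjoint] exI [of _ Rn_functor] exI conjI, rule adj.adjunction)
      (simp_all add: Rn_strict Rn_En Rn_trans_En_trans adj.counit_def, simp_all add: adj.left_adjoint_def Rn_functor_def)
qed

end
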